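(* Let $X_\Omega\subset\mathbb{R}^4$ be a nice toric domain such that the curve $\partial_+\Omega$ has negative slope everywhere. Then its Ruelle invariant is $$\mathrm{Ru}(X_\Omega)=a(\Omega)+b(\Omega).$$
   Context: Toric domains. $\mathbb{R}^4=\mathbb{C}^2$ with coordinates $z_j=x_j+iy_j$. For a domain $\Omega$ in the nonnegative quadrant of $\mathbb{R}^2$, $X_\Omega=\{z\in\mathbb{C}^2\mid\pi(|z_1|^2,|z_2|^2)\in\Omega\}$. A nice star-shaped domain is a compact domain in $\mathbb{R}^4$ whose boundary is smooth and transverse to the radial vector field. A nice toric domain is a toric domain $X_\Omega$ that is a nice star-shaped domain; then $\partial\Omega$ consists of the segment from $(0,0)$ to $(a,0)$, the segment from $(0,0)$ to $(0,b)$, for some $a,b>0$, and a smooth curve from $(0,b)$ to $(a,0)$ transverse to the radial vector field. One writes $a(\Omega)=a$, $b(\Omega)=b$, and $\partial_+\Omega$ for this smooth curve. Ruelle invariant. For $\widetilde A\in\widetilde{\mathrm{Sp}}(2)$ (universal cover of the group of $2\times2$ real symplectic matrices) represented by a path $\{A_t\}_{t\in[0,1]}$ from $I$ to $A$, and $0\ne v\in\mathbb{R}^2$, let $2\pi\rho(v)\in\mathbb{R}$ be the angle by which the path $\{A_tv\}_{t\in[0,1]}$ rotates; set $\mathrm{rot}(\widetilde A)=\lim_{n\to\infty}\frac1n\sum_{k=1}^n\rho(A^{k-1}v)$, which is independent of $v$. Let $Y$ be a homology 3-sphere with contact form $\lambda$, $\xi=\ker\lambda$, Reeb flow $\phi_t$,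 and let $\tau$ be a global symplectic trivialization of $(\xi,d\lambda)$. For $y\in Y$ let $A^\tau_{y,t}=\tau\circ d\phi_t|_{\xi_y}\circ\tau^{-1}\in\mathrm{Sp}(2)$ and $\mathrm{rot}_\tau(y,T)=\mathrm{rot}(\{A^\tau_{y,t}\}_{t\in[0,T]})$. For almost every $y$ the limit $\rho(y)=\lim_{T\to\infty}\frac1T\mathrm{rot}_\tau(y,T)$ exists, is independent of $\tau$, and $\rho$ is integrable. Define $\mathrm{Ru}(Y,\lambda)=\int_Y\rho\,\lambda\wedge d\lambda$. For a nice star-shaped domain $X$, $\mathrm{Ru}(X)=\mathrm{Ru}(\partial X,\lambda_0|_{\partial X})$ where $\lambda_0=\frac12\sum_{i=1}^2(x_i\,dy_i-y_i\,dx_i)$, which restricts to a contact form on $\partial X$. *)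

theory Defs
  imports "HOL-Analysis.Analysis"
begin

section \<open>Smooth maps and submanifolds of Euclidean space\<close>

primrec Ck_on :: "nat \<Rightarrow> 'a::euclidean_space set \<Rightarrow> ('a \<Rightarrow> 'b::real_normed_vector) \<Rightarrow> bool" where
  "Ck_on 0 S f \<longleftrightarrow> continuous_on S f"
| "Ck_on (Suc k) S f \<longleftrightarrow> (\<forall>x\<in>S. f differentiable (at x)) \<and>
     (\<forall>v. Ck_on k S (\<lambda>x. frechet_derivative f (at x) v))"

text \<open>Intended for open \<open>S\<close>.\<close>

definition smooth_on :: "'a::euclidean_space set \<Rightarrow> ('a \<Rightarrow> 'b::real_normed_vector) \<Rightarrow> bool" where
  "smooth_on S f \<longleftrightarrow> (\<forall>k. Ck_on k S f)"

text \<open>Smoothness of a map defined on a submanifold: local smooth extension to the ambient space.\<close>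

definition smooth_along :: "'a::euclidean_space set \<Rightarrow> ('a \<Rightarrow> 'b::real_normed_vector) \<Rightarrow> bool" where
  "smooth_along Y f \<longleftrightarrow>
     (\<forall>p\<in>Y. \<exists>U g. open U \<and> p \<in> U \<and> smooth_on U g \<and> (\<forall>x\<in>U \<inter> Y. g x = f x))"

text \<open>On an embedded submanifold, curves that are merely differentiable at time 0 have the same
  velocities as smooth curves.\<close>

definition tangent_space :: "'a::euclidean_space set \<Rightarrow> 'a \<Rightarrow> 'a set" where
  "tangent_space Y p =
     {v. \<exists>c::real \<Rightarrow> 'a. (\<forall>t. c t \<in> Y) \<and> c 0 = p \<and> (c has_vector_derivative v) (at 0)}"

text \<open>A regular \<open>C\<^sup>1\<close> parametrization of an open piece of a 3-dimensional submanifold.\<close>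

definition parametrization ::
    "'a::euclidean_space set \<Rightarrow> (real^3) set \<Rightarrow> (real^3 \<Rightarrow> 'a) \<Rightarrow> bool" where
  "parametrization Y U \<psi> \<longleftrightarrow>
     open U \<and> Ck_on 1 U \<psi> \<and> (\<forall>x\<in>U. inj (frechet_derivative \<psi> (at x))) \<and>
     openin (top_of_set Y) (\<psi> ` U) \<and> (\<exists>g. homeomorphism U (\<psi> ` U) \<psi> g)"

section \<open>Contact geometry\<close>

text \<open>Throughout, \<open>Y\<close> is a 3-dimensional submanifold of a Euclidean space, and a 1-form on \<open>Y\<close> is
  given by a smooth 1-form \<open>\<alpha>\<close> of the ambient space: \<open>\<alpha> p v\<close> is its value at the point \<open>p\<close> on the
  vector \<open>v\<close>. Restriction to \<open>Y\<close> commutes with the exterior derivative, so the exterior derivative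
  is also taken in the ambient space.\<close>

type_synonym 'a one_form = "'a \<Rightarrow> 'a \<Rightarrow> real"

definition ext_deriv :: "'a::euclidean_space one_form \<Rightarrow> 'a \<Rightarrow> 'a \<Rightarrow> 'a \<Rightarrow> real" where
  "ext_deriv \<alpha> p u v =
     frechet_derivative (\<lambda>q. \<alpha> q v) (at p) u - frechet_derivative (\<lambda>q. \<alpha> q u) (at p) v"

text \<open>The 3-form \<open>\<alpha> \<and> d\<alpha>\<close>.\<close>

definition contact_volume :: "'a::euclidean_space one_form \<Rightarrow> 'a \<Rightarrow> 'a \<Rightarrow> 'a \<Rightarrow> 'a \<Rightarrow> real" where
  "contact_volume \<alpha> p u v w =
     \<alpha> p u * ext_deriv \<alpha> p v w + \<alpha> p v * ext_deriv \<alpha> p w u + \<alpha> p w * ext_deriv \<alpha> p u v"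

text \<open>The measure on \<open>Y\<close> given by integrating \<open>\<alpha> \<and> d\<alpha>\<close>. As usual a contact 3-manifold is oriented
  by \<open>\<alpha> \<and> d\<alpha>\<close>, hence the absolute value, which allows parametrizations of either orientation.\<close>

definition contact_measure :: "'a::euclidean_space set \<Rightarrow> 'a one_form \<Rightarrow> 'a measure" where
  "contact_measure Y \<alpha> = (THE \<mu>. sets \<mu> = sets (restrict_space borel Y) \<and>
     (\<forall>U \<psi>. parametrization Y U \<psi> \<longrightarrow>
       (\<forall>B\<in>sets borel. B \<subseteq> U \<longrightarrow>
         emeasure \<mu> (\<psi> ` B) =
         (\<integral>\<^sup>+x\<in>B. ennreal \<bar>contact_volume \<alpha> (\<psi> x)
             (frechet_derivative \<psi> (at x) (axis 1 1))
             (frechet_derivative \<psi> (at x) (axis 2 1))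
             (frechet_derivative \<psi> (at x) (axis 3 1))\<bar> \<partial>lborel))))"

definition contact_plane :: "'a::euclidean_space set \<Rightarrow> 'a one_form \<Rightarrow> 'a \<Rightarrow> 'a set" where
  "contact_plane Y \<alpha> y = {v \<in> tangent_space Y y. \<alpha> y v = 0}"

definition reeb_field :: "'a::euclidean_space set \<Rightarrow> 'a one_form \<Rightarrow> 'a \<Rightarrow> 'a" where
  "reeb_field Y \<alpha> y = (THE v. v \<in> tangent_space Y y \<and> \<alpha> y v = 1 \<and>
     (\<forall>w\<in>tangent_space Y y. ext_deriv \<alpha> y v w = 0))"

definition reeb_flow :: "'a::euclidean_space set \<Rightarrow> 'a one_form \<Rightarrow> real \<Rightarrow> 'a \<Rightarrow> 'a" where
  "reeb_flow Y \<alpha> t y = (THE c::real \<Rightarrow> 'a. c 0 = y \<and>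
     (\<forall>s. c s \<in> Y \<and> (c has_vector_derivative reeb_field Y \<alpha> (c s)) (at s))) t"

text \<open>The derivative relative to \<open>Y\<close> is determined only on \<open>tangent_space Y y\<close>, and is only
  used there.\<close>

definition reeb_flow_deriv ::
    "'a::euclidean_space set \<Rightarrow> 'a one_form \<Rightarrow> real \<Rightarrow> 'a \<Rightarrow> 'a \<Rightarrow> 'a" where
  "reeb_flow_deriv Y \<alpha> t y = frechet_derivative (reeb_flow Y \<alpha> t) (at y within Y)"

definition omega_std :: "real^2 \<Rightarrow> real^2 \<Rightarrow> real" where
  "omega_std u v = u $ 1 * v $ 2 - u $ 2 * v $ 1"

text \<open>\<open>\<tau> y\<close> is the fibre map from the contact plane at \<open>y\<close> to \<open>\<real>\<^sup>2\<close>; its values off the contact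
  plane are irrelevant. Smoothness of \<open>\<tau>\<close> is expressed through the inverse trivialization.\<close>

definition symplectic_trivialization ::
    "'a::euclidean_space set \<Rightarrow> 'a one_form \<Rightarrow> ('a \<Rightarrow> 'a \<Rightarrow> real^2) \<Rightarrow> bool" where
  "symplectic_trivialization Y \<alpha> \<tau> \<longleftrightarrow>
     (\<forall>y\<in>Y. bij_betw (\<tau> y) (contact_plane Y \<alpha> y) UNIV \<and>
        (\<forall>u\<in>contact_plane Y \<alpha> y. \<forall>v\<in>contact_plane Y \<alpha> y.
           \<tau> y (u + v) = \<tau> y u + \<tau> y v \<and> omega_std (\<tau> y u) (\<tau> y v) = ext_deriv \<alpha> y u v) \<and>
        (\<forall>u\<in>contact_plane Y \<alpha> y. \<forall>r. \<tau> y (r *\<^sub>R u) = r *\<^sub>R \<tau> y u)) \<and>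
     (\<forall>w. smooth_along Y (\<lambda>y. inv_into (contact_plane Y \<alpha> y) (\<tau> y) w))"

section \<open>The Ruelle invariant\<close>

text \<open>An element of the universal cover of \<open>Sp(2)\<close> is represented by a path \<open>A\<close> of symplectic
  matrices on \<open>[0,T]\<close> starting at the identity. \<open>2 \<pi> rho A T v\<close> is the angle by which \<open>A t v\<close>
  rotates.\<close>

definition rho :: "(real \<Rightarrow> real^2^2) \<Rightarrow> real \<Rightarrow> real^2 \<Rightarrow> real" where
  "rho A T v = (THE r. \<exists>\<theta>. continuous_on {0..T} \<theta> \<and>
     (\<forall>t\<in>{0..T}. A t *v v =
        norm (A t *v v) *\<^sub>R vector [cos (2 * pi * \<theta> t), sin (2 * pi * \<theta> t)]) \<and>
     r = \<theta> T - \<theta> 0)"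

text \<open>Powers of the matrix \<open>A T\<close> are written as iterates, since \<open>(^)\<close> on vectors is
  componentwise. The limit is independent of \<open>v\<close>.\<close>

definition rot :: "(real \<Rightarrow> real^2^2) \<Rightarrow> real \<Rightarrow> real" where
  "rot A T = (THE r. \<forall>v. v \<noteq> 0 \<longrightarrow>
     (\<lambda>n. 1 / real n * (\<Sum>k=1..n. rho A T (((\<lambda>w. A T *v w) ^^ (k - 1)) v))) \<longlonglongrightarrow> r)"

definition linearized_flow ::
    "'a::euclidean_space set \<Rightarrow> 'a one_form \<Rightarrow> ('a \<Rightarrow> 'a \<Rightarrow> real^2) \<Rightarrow> 'a \<Rightarrow> real \<Rightarrow> real^2^2" where
  "linearized_flow Y \<alpha> \<tau> y t = matrix (\<lambda>w. \<tau> (reeb_flow Y \<alpha> t y)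
     (reeb_flow_deriv Y \<alpha> t y (inv_into (contact_plane Y \<alpha> y) (\<tau> y) w)))"

text \<open>The limit is independent of the trivialization \<open>\<tau>\<close> and exists for almost every \<open>y\<close>.\<close>

definition rotation_number :: "'a::euclidean_space set \<Rightarrow> 'a one_form \<Rightarrow> 'a \<Rightarrow> real" where
  "rotation_number Y \<alpha> y = (THE r. \<forall>\<tau>. symplectic_trivialization Y \<alpha> \<tau> \<longrightarrow>
     ((\<lambda>T. 1 / T * rot (linearized_flow Y \<alpha> \<tau> y) T) \<longlongrightarrow> r) at_top)"

text \<open>The completion is taken because \<open>rotation_number\<close> is meaningful only almost everywhere.\<close>

definition ruelle_invariant :: "'a::euclidean_space set \<Rightarrow> 'a one_form \<Rightarrow> real" where
  "ruelle_invariant Y \<alpha> =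
     (\<integral>y. rotation_number Y \<alpha> y \<partial>completion (contact_measure Y \<alpha>))"

section \<open>Star-shaped and toric domains\<close>

definition liouville_form :: "(complex \<times> complex) one_form" where
  "liouville_form = (\<lambda>(z\<^sub>1, z\<^sub>2) (v\<^sub>1, v\<^sub>2).
     1 / 2 * ((Re z\<^sub>1 * Im v\<^sub>1 - Im z\<^sub>1 * Re v\<^sub>1) + (Re z\<^sub>2 * Im v\<^sub>2 - Im z\<^sub>2 * Re v\<^sub>2)))"

definition smooth_boundary :: "'a::euclidean_space set \<Rightarrow> bool" where
  "smooth_boundary X \<longleftrightarrow> (\<forall>p\<in>frontier X. \<exists>U (f::'a \<Rightarrow> real).
     open U \<and> p \<in> U \<and> smooth_on U f \<and> (\<forall>x\<in>U. frechet_derivative f (at x) \<noteq> (\<lambda>_. 0)) \<and>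
     X \<inter> U = {x\<in>U. f x \<le> 0})"

text \<open>Star-shaped means star-shaped about the origin; this excludes shells such as
  \<open>1 \<le> |z| \<le> 2\<close>, whose boundary is also transverse to the radial vector field \<open>p \<mapsto> p\<close>.\<close>

definition nice_star_shaped :: "(complex \<times> complex) set \<Rightarrow> bool" where
  "nice_star_shaped X \<longleftrightarrow>
     compact X \<and> X \<noteq> {} \<and> (\<forall>x\<in>X. closed_segment 0 x \<subseteq> X) \<and> smooth_boundary X \<and>
     (\<forall>p\<in>frontier X. p \<notin> tangent_space (frontier X) p)"

definition Ru :: "(complex \<times> complex) set \<Rightarrow> real" where
  "Ru X = ruelle_invariant (frontier X) liouville_form"

definition toric_domain :: "(real \<times> real) set \<Rightarrow> (complex \<times> complex) set" where
  "toric_domain \<Omega> = {(z\<^sub>1, z\<^sub>2). (pi * (cmod z\<^sub>1)\<^sup>2, pi * (cmod z\<^sub>2)\<^sup>2) \<in> \<Omega>}"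

definition nice_toric :: "(real \<times> real) set \<Rightarrow> bool" where
  "nice_toric \<Omega> \<longleftrightarrow> \<Omega> \<subseteq> {0..} \<times> {0..} \<and> nice_star_shaped (toric_domain \<Omega>)"

text \<open>For a nice toric domain, \<open>\<Omega>\<close> meets the axes exactly in the segments from the origin to
  \<open>(a_of \<Omega>, 0)\<close> and to \<open>(0, b_of \<Omega>)\<close>.\<close>

definition a_of :: "(real \<times> real) set \<Rightarrow> real" where
  "a_of \<Omega> = Sup {x. (x, 0) \<in> \<Omega>}"

definition b_of :: "(real \<times> real) set \<Rightarrow> real" where
  "b_of \<Omega> = Sup {y. (0, y) \<in> \<Omega>}"

text \<open>The part of the boundary off the axes, together with its endpoints
  \<open>(0, b_of \<Omega>)\<close> and \<open>(a_of \<Omega>, 0)\<close>.\<close>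

definition boundary_plus :: "(real \<times> real) set \<Rightarrow> (real \<times> real) set" where
  "boundary_plus \<Omega> = closure {p \<in> frontier \<Omega>. fst p > 0 \<and> snd p > 0}"

text \<open>The slope of a curve at \<open>p\<close>, as the limit of slopes of secants (one-sided at an endpoint).\<close>

definition has_slope :: "(real \<times> real) set \<Rightarrow> real \<times> real \<Rightarrow> real \<Rightarrow> bool" where
  "has_slope C p m \<longleftrightarrow>
     ((\<lambda>q. (snd q - snd p) / (fst q - fst p)) \<longlongrightarrow> m) (at p within C)"

end

theory Submission
  imports Defs
begin

text \<open>
  The boundary \<open>Y\<close> of a nice star-shaped domain is the level set \<open>G = 1\<close> of a gauge \<open>G\<close> that is
  positively homogeneous of degree one and differentiable away from the origin
  (\<open>star_shaped_gauge\<close>). Its gradient field \<open>N\<close> satisfies \<open>N y \<bullet> y = 1\<close> on \<open>Y\<close>, and it makes the contact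
  geometry of \<open>Y\<close> explicit: the tangent space is the orthogonal complement of \<open>N\<close>, the Reeb field is
  \<open>2 \<i> N\<close>, and the contact planes are trivialized by quaternionic multiples of \<open>N\<close>, corrected along
  the Reeb direction.

  For a toric domain, \<open>N z = (\<nu>1 z\<^sub>1, \<nu>2 z\<^sub>2)\<close> with real, torus-invariant functions \<open>\<nu>1\<close> and \<open>\<nu>2\<close>. Off
  the coordinate axes the Reeb flow therefore rotates the two coordinates with the constant speeds
  \<open>2 \<nu>1\<close> and \<open>2 \<nu>2\<close>. The torus direction that lies in the contact plane is carried along by
  the flow, and in the quaternionic frame it is a positive multiple of \<open>- \<i> z\<^sub>1 z\<^sub>2\<close>, which turns with
  speed \<open>2 (\<nu>1 + \<nu>2)\<close>. Since \<open>Y\<close> is simply connected and compact, passing from this frame to any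
  symplectic trivialization changes the total angle only by a bounded amount (\<open>frame_winding\<close>), and
  \<open>rot\<close> differs by at most one turn from the rotation of a single vector (\<open>rot_close_to_rho\<close>). Hence
  the rotation number is \<open>(\<nu>1 + \<nu>2) / pi\<close> almost everywhere (\<open>rotation_number_eq\<close>).

  The contact volume of a subset of \<open>Y\<close> is twice the Lebesgue measure of the cone over it
  (\<open>contact_measure_eq_cone_measure\<close>). So the Ruelle invariant is twice the integral over the domain
  of the rotation number, extended to be constant along rays. The moment map
  \<open>z \<mapsto> (pi |z\<^sub>1|\<^sup>2, pi |z\<^sub>2|\<^sup>2)\<close> sends Lebesgue measure to Lebesgue measure on the quadrant, and it turns
  the integrand into \<open>\<partial>\<^sub>1 g + \<partial>\<^sub>2 g\<close>, where \<open>g\<close> is the gauge of \<open>\<Omega>\<close>. Negative slope of the boundary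
  curve makes both partial derivatives positive. A line parallel to the first axis, at height \<open>x\<^sub>2\<close>
  below \<open>b\<close>, then meets \<open>\<Omega>\<close> in an interval on which \<open>g\<close> grows from \<open>x\<^sub>2 / b\<close> to \<open>1\<close>, so \<open>\<partial>\<^sub>1 g\<close>
  contributes the integral of \<open>1 - x\<^sub>2 / b\<close>, which is \<open>b / 2\<close>. Likewise \<open>\<partial>\<^sub>2 g\<close> contributes \<open>a / 2\<close>,
  and doubling the sum gives \<open>a + b\<close> (\<open>ruelle_invariant_eq\<close>).
\<close>

section \<open>Calculus of \<open>C\<^sup>k\<close> maps on open sets\<close>

lemma frechet_derivative_eqI:
  "(f has_derivative f') (at x) \<Longrightarrow> frechet_derivative f (at x) = f'"
  by (metis frechet_derivative_at)

lemma Ck_on_cong: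
  assumes "open S" "\<And>x. x \<in> S \<Longrightarrow> f x = g x" "Ck_on k S f"
  shows "Ck_on k S g"
  using assms(2,3)
proof (induction k arbitrary: f g)
  case 0
  then show ?case by (simp cong: continuous_on_cong)
next
  case (Suc k)
  have d: "(g has_derivative frechet_derivative f (at x)) (at x)" if "x \<in> S" for x
    using Suc.prems that assms(1)
    by (auto intro!: has_derivative_transform_within_open[of f _ x UNIV S g]
        simp: frechet_derivative_works)
  show ?case
  proof (simp, intro conjI allI ballI)
    fix x assume "x \<in> S"
    then show "g differentiable at x" using d by (auto simp: differentiable_def)
  next
    fix v
    show "Ck_on k S (\<lambda>x. frechet_derivative g (at x) v)"
      by (rule Suc.IH[of "\<lambda>x. frechet_derivative f (at x) v"])
         (use Suc.prems in \<open>auto simp: frechet_derivative_eqI[OF d]\<close>)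
  qed
qed

text \<open>Closure properties of \<open>Ck_on\<close> are inductions on the order in which some derivative is exhibited
  and its values in a fixed direction are treated by the induction hypothesis. This rule allows any
  derivative in place of \<open>frechet_derivative\<close>.\<close>

lemma Ck_on_SucI:
  assumes "open S" "\<And>x. x \<in> S \<Longrightarrow> (f has_derivative f' x) (at x)"
    and "\<And>v. Ck_on k S (\<lambda>x. f' x v)"
  shows "Ck_on (Suc k) S f"
proof (simp, intro conjI allI ballI)
  fix x assume "x \<in> S"
  then show "f differentiable at x" using assms by (auto simp: differentiable_def)
next
  fix v
  show "Ck_on k S (\<lambda>x. frechet_derivative f (at x) v)"
    by (rule Ck_on_cong[OF assms(1) _ assms(3)[of v]]) (metis assms(2) frechet_derivative_at)
qed

lemma Ck_on_SucD: "Ck_on (Suc k) S f \<Longrightarrow> Ck_on k S f"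
proof (induction k arbitrary: f)
  case 0
  then show ?case
    by (auto intro!: continuous_at_imp_continuous_on differentiable_imp_continuous_within)
next
  case (Suc k)
  then show ?case by (metis Ck_on.simps(2))
qed

lemma Ck_on_const: "open S \<Longrightarrow> Ck_on k S (\<lambda>x. c)"
proof (induction k arbitrary: c)
  case (Suc k)
  show ?case
    by (rule Ck_on_SucI[where f' = "\<lambda>_ _. 0"]) (auto simp: Suc)
qed simp

lemma Ck_on_linear:
  assumes "open S" "bounded_linear h" "Ck_on k S f"
  shows "Ck_on k S (\<lambda>x. h (f x))"
  using assms(3)
proof (induction k arbitrary: f)
  case 0
  then show ?case using assms(2) by (auto intro: bounded_linear.continuous_on)
next
  case (Suc k)
  show ?case
    by (rule Ck_on_SucI[where f' = "\<lambda>x v. h (frechet_derivative f (at x) v)", OF assms(1)])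
       (use Suc in \<open>auto simp: frechet_derivative_works
          intro!: bounded_linear.has_derivative[OF assms(2)]\<close>)
qed

lemma Ck_on_ident: assumes "open S" shows "Ck_on k S (\<lambda>x. x)"
proof (cases k)
  case (Suc j)
  show ?thesis unfolding Suc
    by (rule Ck_on_SucI[where f' = "\<lambda>_ v. v"]) (use assms Ck_on_const in auto)
qed simp

lemma Ck_on_add:
  assumes "open S" "Ck_on k S f" "Ck_on k S g"
  shows "Ck_on k S (\<lambda>x. f x + g x)"
  using assms(2,3)
proof (induction k arbitrary: f g)
  case 0
  then show ?case by (auto intro: continuous_intros)
next
  case (Suc k)
  show ?case
    by (rule Ck_on_SucI[where f' = "\<lambda>x v. frechet_derivative f (at x) v + frechet_derivative g (at x) v",
          OF assms(1)])
       (use Suc in \<open>auto simp: frechet_derivative_works intro!: has_derivative_add\<close>)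
qed

lemma Ck_on_bilinear:
  assumes "open S" "bounded_bilinear h" "Ck_on k S f" "Ck_on k S g"
  shows "Ck_on k S (\<lambda>x. h (f x) (g x))"
  using assms(3,4)
proof (induction k arbitrary: f g)
  case 0
  then show ?case using assms(2) by (auto intro: bounded_bilinear.continuous_on)
next
  case (Suc k)
  show ?case
  proof (rule Ck_on_SucI[where f' = "\<lambda>x v. h (f x) (frechet_derivative g (at x) v)
        + h (frechet_derivative f (at x) v) (g x)", OF assms(1)])
    fix x assume "x \<in> S"
    then show "((\<lambda>x. h (f x) (g x)) has_derivative
          (\<lambda>v. h (f x) (frechet_derivative g (at x) v) + h (frechet_derivative f (at x) v) (g x))) (at x)"
      using Suc.prems
      by (auto simp: frechet_derivative_works intro!: bounded_bilinear.FDERIV[OF assms(2)])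
  next
    fix v
    have "Ck_on k S f" "Ck_on k S g" using Suc.prems Ck_on_SucD by blast+
    then show "Ck_on k S (\<lambda>x. h (f x) (frechet_derivative g (at x) v)
        + h (frechet_derivative f (at x) v) (g x))"
      using Suc by (intro Ck_on_add assms(1) Suc.IH) auto
  qed
qed

lemma Ck_on_inverse:
  fixes f :: "'a::euclidean_space \<Rightarrow> real"
  assumes "open S" "Ck_on k S f" "\<And>x. x \<in> S \<Longrightarrow> f x \<noteq> 0"
  shows "Ck_on k S (\<lambda>x. inverse (f x))"
  using assms(2)
proof (induction k)
  case 0
  then show ?case using assms(3) by (auto intro!: continuous_intros)
next
  case (Suc k)
  show ?case
  proof (rule Ck_on_SucI[where f' = "\<lambda>x v. - (inverse (f x) * frechet_derivative f (at x) v * inverse (f x))", OF assms(1)])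
    fix x assume "x \<in> S"
    then show "((\<lambda>x. inverse (f x)) has_derivative
          (\<lambda>v. - (inverse (f x) * frechet_derivative f (at x) v * inverse (f x)))) (at x)"
      using Suc.prems assms(3)
      by (auto simp: frechet_derivative_works intro!: Deriv.has_derivative_inverse)
  next
    fix v
    have "Ck_on k S f" using Suc.prems Ck_on_SucD by blast
    then have "Ck_on k S (\<lambda>x. inverse (f x))" by (rule Suc.IH)
    then have "Ck_on k S (\<lambda>x. inverse (f x) * frechet_derivative f (at x) v * inverse (f x))"
      using Suc.prems by (intro Ck_on_bilinear[OF assms(1) bounded_bilinear_mult]) auto
    then show "Ck_on k S (\<lambda>x. - (inverse (f x) * frechet_derivative f (at x) v * inverse (f x)))"
      using Ck_on_linear[OF assms(1), of uminus] bounded_linear_minus[OF bounded_linear_ident] by auto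
  qed
qed

lemma Ck_on_sum:
  assumes "open S" "finite I" "\<And>i. i \<in> I \<Longrightarrow> Ck_on k S (f i)"
  shows "Ck_on k S (\<lambda>x. \<Sum>i\<in>I. f i x)"
  using assms(2,3) by (induction rule: finite_induct) (auto intro!: Ck_on_add Ck_on_const assms(1))

lemma Ck_on_subset: "Ck_on k S f \<Longrightarrow> T \<subseteq> S \<Longrightarrow> Ck_on k T f"
  by (induction k arbitrary: f) (auto intro: continuous_on_subset)

lemma smooth_on_linear:
  "open S \<Longrightarrow> bounded_linear h \<Longrightarrow> smooth_on S f \<Longrightarrow> smooth_on S (\<lambda>x. h (f x))"
  by (simp add: smooth_on_def Ck_on_linear)

lemma smooth_on_bilinear:
  "open S \<Longrightarrow> bounded_bilinear h \<Longrightarrow> smooth_on S f \<Longrightarrow> smooth_on S g \<Longrightarrow>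
    smooth_on S (\<lambda>x. h (f x) (g x))"
  by (simp add: smooth_on_def Ck_on_bilinear)

lemma smooth_on_add:
  "open S \<Longrightarrow> smooth_on S f \<Longrightarrow> smooth_on S g \<Longrightarrow> smooth_on S (\<lambda>x. f x + g x)"
  by (simp add: smooth_on_def Ck_on_add)

lemma smooth_on_inverse:
  fixes f :: "'a::euclidean_space \<Rightarrow> real"
  shows "open S \<Longrightarrow> smooth_on S f \<Longrightarrow> (\<And>x. x \<in> S \<Longrightarrow> f x \<noteq> 0) \<Longrightarrow> smooth_on S (\<lambda>x. inverse (f x))"
  by (simp add: smooth_on_def Ck_on_inverse)

lemma smooth_on_subset: "smooth_on S f \<Longrightarrow> T \<subseteq> S \<Longrightarrow> smooth_on T f"
  by (auto simp: smooth_on_def intro: Ck_on_subset)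

lemma smooth_on_imp_differentiable: "smooth_on S f \<Longrightarrow> x \<in> S \<Longrightarrow> f differentiable (at x)"
  unfolding smooth_on_def by (metis Ck_on.simps(2))

lemma smooth_on_imp_continuous: "smooth_on S f \<Longrightarrow> continuous_on S f"
  unfolding smooth_on_def by (metis Ck_on.simps(1))

lemma smooth_along_imp_continuous:
  assumes "smooth_along Y f" shows "continuous_on Y f"
  unfolding continuous_on_eq_continuous_within
proof
  fix p assume "p \<in> Y"
  then obtain U g where U: "open U" "p \<in> U" "smooth_on U g" "\<forall>x\<in>U \<inter> Y. g x = f x"
    using assms by (auto simp: smooth_along_def)
  have "continuous (at p within Y) g"
    using U smooth_on_imp_continuous continuous_on_eq_continuous_at continuous_at_imp_continuous_at_within
    by blast
  then have "(g \<longlongrightarrow> f p) (at p within Y)"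
    using U \<open>p \<in> Y\<close> by (auto simp: continuous_within)
  moreover have "\<forall>\<^sub>F x in at p within Y. g x = f x"
    unfolding eventually_at_topological using U by auto
  ultimately show "continuous (at p within Y) f"
    unfolding continuous_within by (rule Lim_transform_eventually)
qed

definition gradient :: "('a::euclidean_space \<Rightarrow> real) \<Rightarrow> 'a \<Rightarrow> 'a" where
  "gradient f x = (\<Sum>b\<in>Basis. frechet_derivative f (at x) b *\<^sub>R b)"

lemma has_derivative_gradient:
  assumes "f differentiable (at x)"
  shows "(f has_derivative (\<lambda>v. gradient f x \<bullet> v)) (at x)"
proof -
  have d: "(f has_derivative frechet_derivative f (at x)) (at x)"
    using assms by (simp add: frechet_derivative_works)
  have "frechet_derivative f (at x) v = gradient f x \<bullet> v" for v
  proof -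
    interpret linear "frechet_derivative f (at x)" using d has_derivative_linear by blast
    have "frechet_derivative f (at x) v = frechet_derivative f (at x) (\<Sum>b\<in>Basis. (v \<bullet> b) *\<^sub>R b)"
      by (simp add: euclidean_representation)
    also have "\<dots> = (\<Sum>b\<in>Basis. (v \<bullet> b) * frechet_derivative f (at x) b)" by (simp add: sum scale)
    also have "\<dots> = gradient f x \<bullet> v"
      by (auto simp: gradient_def inner_sum_left inner_commute[of v] intro!: sum.cong)
    finally show ?thesis .
  qed
  then have "frechet_derivative f (at x) = (\<lambda>v. gradient f x \<bullet> v)" by auto
  with d show ?thesis by simp
qed

lemma smooth_on_gradient:
  assumes "open S" "smooth_on S f" shows "smooth_on S (gradient f)"
proof -
  have "Ck_on k S (\<lambda>x. frechet_derivative f (at x) b)" for k b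
    using assms(2) unfolding smooth_on_def by (metis Ck_on.simps(2))
  then have "Ck_on k S (\<lambda>x. frechet_derivative f (at x) b *\<^sub>R b)" for k b
    by (intro Ck_on_linear[OF assms(1) bounded_linear_scaleR_left])
  then have "Ck_on k S (\<lambda>x. \<Sum>b\<in>Basis. frechet_derivative f (at x) b *\<^sub>R b)" for k
    by (intro Ck_on_sum assms(1)) auto
  then show ?thesis unfolding smooth_on_def gradient_def by blast
qed

lemma gradient_eqI:
  assumes "(f has_derivative (\<lambda>v. n \<bullet> v)) (at x)" shows "gradient f x = n"
  by (simp add: gradient_def frechet_derivative_eqI[OF assms] euclidean_representation)

section \<open>Star-shaped domains and their gauge\<close>

text \<open>This replaces the implicit function theorem. As \<open>f'\<close> vanishes on \<open>v\<close> but not on \<open>w\<close>, for small \<open>t\<close>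
  the intermediate value theorem finds a zero of \<open>f\<close> on the segment
  \<open>p + t v + s w\<close>, \<open>|s| \<le> \<epsilon> |t|\<close>. Always taking an almost minimal \<open>|s|\<close> gives a single curve
  that works for all \<open>\<epsilon>\<close> at once.\<close>

lemma tangent_space_zero_set:
  fixes f :: "'a::euclidean_space \<Rightarrow> real"
  assumes U: "open U" "p \<in> U" and cont: "continuous_on U f"
    and der: "(f has_derivative f') (at p)" and p: "f p = 0" and v: "f' v = 0" and w: "f' w \<noteq> 0"
  shows "v \<in> tangent_space {x\<in>U. f x = 0} p"
proof -
  interpret f': bounded_linear f' using der by (rule has_derivative_bounded_linear)
  define R where "R t s \<longleftrightarrow> p + t *\<^sub>R v + s *\<^sub>R w \<in> U \<and> f (p + t *\<^sub>R v + s *\<^sub>R w) = 0" for t s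
  have key: "\<exists>\<delta>>0. \<forall>t. \<bar>t\<bar> < \<delta> \<longrightarrow> (\<exists>s. \<bar>s\<bar> \<le> \<epsilon> * \<bar>t\<bar> \<and> R t s)" if "\<epsilon> > 0" for \<epsilon>
  proof -
    (* the segment stays within distance M |t| of p, where f differs from its linear part by at most half of what s w contributes at the ends *)
    define M where "M = norm v + \<epsilon> * norm w + 1"
    have M: "M > 0" using that by (simp add: M_def add_nonneg_pos)
    define \<eta> where "\<eta> = \<epsilon> * \<bar>f' w\<bar> / (2 * M)"
    have \<eta>: "\<eta> > 0" using M w that by (simp add: \<eta>_def)
    obtain \<delta>1 where \<delta>1: "\<delta>1 > 0" "\<And>y. norm (y - p) < \<delta>1 \<Longrightarrow> norm (f y - f p - f' (y - p)) \<le> \<eta> * norm (y - p)"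
      using der \<eta> unfolding has_derivative_at_alt by blast
    obtain \<delta>2 where \<delta>2: "\<delta>2 > 0" "ball p \<delta>2 \<subseteq> U" using U open_contains_ball by blast
    define \<delta> where "\<delta> = min \<delta>1 \<delta>2 / M"
    have "\<delta> > 0" using \<delta>1 \<delta>2 M by (simp add: \<delta>_def)
    moreover have "\<exists>s. \<bar>s\<bar> \<le> \<epsilon> * \<bar>t\<bar> \<and> R t s" if t: "\<bar>t\<bar> < \<delta>" for t
    proof (cases "t = 0")
      case True
      then show ?thesis using p U by (intro exI[of _ 0]) (auto simp: R_def)
    next
      case False
      let ?q = "\<lambda>s. p + t *\<^sub>R v + s *\<^sub>R w"
      have bd: "norm (?q s - p) \<le> M * \<bar>t\<bar>" if "\<bar>s\<bar> \<le> \<epsilon> * \<bar>t\<bar>" for s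
      proof -
        have "norm (?q s - p) \<le> \<bar>t\<bar> * norm v + \<bar>s\<bar> * norm w"
          by (metis (no_types, opaque_lifting) add.assoc add_diff_cancel_left' norm_scaleR norm_triangle_ineq)
        also have "\<dots> \<le> \<bar>t\<bar> * norm v + (\<epsilon> * \<bar>t\<bar>) * norm w"
          using that by (intro add_left_mono mult_right_mono) auto
        also have "\<dots> \<le> M * \<bar>t\<bar>" by (simp add: M_def algebra_simps)
        finally show ?thesis .
      qed
      have small: "M * \<bar>t\<bar> < min \<delta>1 \<delta>2" using t M by (simp add: \<delta>_def field_simps)
      have inU: "?q s \<in> U" if "\<bar>s\<bar> \<le> \<epsilon> * \<bar>t\<bar>" for s
        using bd[OF that] small \<delta>2 by (auto simp: subset_iff dist_norm norm_minus_commute)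
      have est: "\<bar>f (?q s) - s * f' w\<bar> \<le> \<epsilon> * \<bar>t\<bar> * \<bar>f' w\<bar> / 2" if "\<bar>s\<bar> \<le> \<epsilon> * \<bar>t\<bar>" for s
      proof -
        have "f' (?q s - p) = s * f' w" using v by (simp add: f'.add f'.scale add.assoc)
        then have "\<bar>f (?q s) - s * f' w\<bar> \<le> \<eta> * norm (?q s - p)"
          using \<delta>1(2)[of "?q s"] bd[OF that] small p by auto
        also have "\<dots> \<le> \<eta> * (M * \<bar>t\<bar>)" using bd[OF that] \<eta> by (intro mult_left_mono) auto
        also have "\<dots> = \<epsilon> * \<bar>t\<bar> * \<bar>f' w\<bar> / 2" using M by (simp add: \<eta>_def)
        finally show ?thesis .
      qed
      define e where "e = \<epsilon> * \<bar>t\<bar>"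
      have e: "e > 0" using \<open>\<epsilon> > 0\<close> False by (simp add: e_def)
      have cq: "continuous_on {-e..e} (\<lambda>s. sgn (f' w) * f (?q s))"
        using inU by (intro continuous_intros continuous_on_compose2[OF cont]) (auto simp: e_def)
      have "e * \<bar>f' w\<bar> > 0" using e w by simp
      have "\<bar>f (?q (-e)) + e * f' w\<bar> \<le> e * \<bar>f' w\<bar> / 2" "\<bar>f (?q e) - e * f' w\<bar> \<le> e * \<bar>f' w\<bar> / 2"
        using est[of "-e"] est[of e] e unfolding e_def[symmetric] by simp_all
      then have "sgn (f' w) * f (?q (-e)) \<le> 0" "sgn (f' w) * f (?q e) \<ge> 0"
        using \<open>e * \<bar>f' w\<bar> > 0\<close> w by (auto simp: sgn_if abs_if split: if_splits)
      then obtain s where "-e \<le> s" "s \<le> e" "sgn (f' w) * f (?q s) = 0"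
        using IVT'[where f = "\<lambda>s. sgn (f' w) * f (?q s)" and a = "-e" and b = e and y = 0, OF _ _ _ cq] e
        by auto
      then show ?thesis using w inU by (intro exI[of _ s]) (auto simp: R_def e_def sgn_if split: if_splits)
    qed
    ultimately show ?thesis by blast
  qed
  (* t^2 is the slack that makes an almost minimal correction exist and is negligible against any multiple of |t| *)
  define m where "m t = Inf {\<bar>s\<bar> |s. R t s}" for t
  obtain \<delta>0 where \<delta>0: "\<delta>0 > 0" "\<And>t. \<bar>t\<bar> < \<delta>0 \<Longrightarrow> \<exists>s. R t s"
    using key[OF zero_less_one] by metis
  have ex: "\<exists>s. R t s \<and> \<bar>s\<bar> \<le> m t + t\<^sup>2" if "\<bar>t\<bar> < \<delta>0" "t \<noteq> 0" for t
  proof -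
    have "{\<bar>s\<bar> |s. R t s} \<noteq> {}" using \<delta>0(2)[OF that(1)] by auto
    then have "\<exists>x\<in>{\<bar>s\<bar> |s. R t s}. x < m t + t\<^sup>2"
      using cInf_lessD[of "{\<bar>s\<bar> |s. R t s}" "m t + t\<^sup>2"] that by (auto simp: m_def)
    then show ?thesis by force
  qed
  have mle: "m t \<le> \<bar>s\<bar>" if "R t s" for t s
    unfolding m_def by (rule cInf_lower) (use that in \<open>auto intro!: bdd_belowI[of _ 0]\<close>)
  define \<sigma> where "\<sigma> t = (if \<bar>t\<bar> < \<delta>0 \<and> t \<noteq> 0 then SOME s. R t s \<and> \<bar>s\<bar> \<le> m t + t\<^sup>2 else 0)" for t
  have \<sigma>: "R t (\<sigma> t) \<and> \<bar>\<sigma> t\<bar> \<le> m t + t\<^sup>2" if "\<bar>t\<bar> < \<delta>0" "t \<noteq> 0" for t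
    using someI_ex[OF ex[OF that]] that by (simp add: \<sigma>_def)
  define c where "c t = (if \<bar>t\<bar> < \<delta>0 \<and> t \<noteq> 0 then p + t *\<^sub>R v + \<sigma> t *\<^sub>R w else p)" for t
  have cin: "c t \<in> {x\<in>U. f x = 0}" for t
    using \<sigma>[of t] U p by (auto simp: c_def R_def)
  have "(c has_derivative (\<lambda>t. t *\<^sub>R v)) (at 0)"
    unfolding has_derivative_at_alt
  proof (intro conjI allI impI)
    show "bounded_linear (\<lambda>t. t *\<^sub>R v)" by (rule bounded_linear_scaleR_left)
  next
    fix e :: real assume e: "e > 0"
    define \<epsilon> where "\<epsilon> = e / (2 * (norm w + 1))"
    have W: "norm w + 1 > 0" by (simp add: add_nonneg_pos)
    have \<epsilon>: "\<epsilon> > 0" using e W by (simp add: \<epsilon>_def)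
    have \<epsilon>e: "\<epsilon> * (2 * (norm w + 1)) = e"
      by (rule nonzero_eq_divide_eq[THEN iffD1]) (use W in \<open>auto simp: \<epsilon>_def\<close>)
    obtain \<delta> where \<delta>: "\<delta> > 0" "\<And>t. \<bar>t\<bar> < \<delta> \<Longrightarrow> \<exists>s. \<bar>s\<bar> \<le> \<epsilon> * \<bar>t\<bar> \<and> R t s" using key[OF \<epsilon>] by auto
    show "\<exists>d>0. \<forall>y. norm (y - 0) < d \<longrightarrow> norm (c y - c 0 - (y - 0) *\<^sub>R v) \<le> e * norm (y - 0)"
    proof (intro exI[of _ "min (min \<delta> \<delta>0) \<epsilon>"] conjI allI impI)
      show "0 < min (min \<delta> \<delta>0) \<epsilon>" using \<delta> \<delta>0 \<epsilon> by simp
      fix t :: real assume t: "norm (t - 0) < min (min \<delta> \<delta>0) \<epsilon>"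
      show "norm (c t - c 0 - (t - 0) *\<^sub>R v) \<le> e * norm (t - 0)"
      proof (cases "t = 0")
        case False
        have t': "\<bar>t\<bar> < \<delta>" "\<bar>t\<bar> < \<delta>0" "\<bar>t\<bar> < \<epsilon>" using t by auto
        obtain s where "\<bar>s\<bar> \<le> \<epsilon> * \<bar>t\<bar>" "R t s" using \<delta>(2) t' by blast
        then have "m t \<le> \<epsilon> * \<bar>t\<bar>" using mle by fastforce
        moreover have "t\<^sup>2 \<le> \<epsilon> * \<bar>t\<bar>"
          using mult_right_mono[of "\<bar>t\<bar>" \<epsilon> "\<bar>t\<bar>"] t' by (simp add: power2_eq_square)
        ultimately have "\<bar>\<sigma> t\<bar> \<le> 2 * \<epsilon> * \<bar>t\<bar>" using \<sigma>[OF t'(2) False] by linarith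
        then have "\<bar>\<sigma> t\<bar> * norm w \<le> 2 * \<epsilon> * \<bar>t\<bar> * (norm w + 1)"
          by (intro mult_mono) auto
        also have "\<dots> = e * \<bar>t\<bar>" using \<epsilon>e by (metis mult.assoc mult.commute)
        finally show ?thesis using False t' by (simp add: c_def)
      qed (simp add: c_def)
    qed
  qed
  then have "(c has_vector_derivative v) (at 0)" by (simp add: has_vector_derivative_def)
  with cin show ?thesis unfolding tangent_space_def by (auto simp: c_def intro!: exI[of _ c])
qed

lemma tangent_space_mono: "A \<subseteq> B \<Longrightarrow> tangent_space A p \<subseteq> tangent_space B p"
  unfolding tangent_space_def by (rule Collect_mono) (metis subsetD)

text \<open>The factor \<open>k\<close> scales \<open>z\<close> to the zero set of \<open>f\<close>; it is the reciprocal of a gauge. Expanding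
  \<open>f (k z *\<^sub>R z) = 0\<close> to first order at \<open>p\<close> gives
  \<open>(k z - 1) f' p + f' (z - p) = o(|z - p| + |k z - 1|)\<close>. This first forces \<open>k z - 1 = O(|z - p|)\<close> and
  then identifies the derivative; continuity of \<open>k\<close> is all that has to be known beforehand.\<close>

lemma has_derivative_implicit_scaling:
  fixes f :: "'a::euclidean_space \<Rightarrow> real" and k :: "'a \<Rightarrow> real"
  assumes der: "(f has_derivative f') (at p)" and p: "f p = 0" and d: "f' p \<noteq> 0"
    and k: "isCont k p" "k p = 1" and ev: "\<forall>\<^sub>F z in nhds p. f (k z *\<^sub>R z) = 0"
  shows "(k has_derivative (\<lambda>v. - f' v / f' p)) (at p)"
proof -
  interpret f': bounded_linear f' using der by (rule has_derivative_bounded_linear)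
  obtain B where B: "B > 0" "\<And>v. norm (f' v) \<le> norm v * B" using f'.pos_bounded by blast
  define D where "D = \<bar>f' p\<bar>"
  have D: "D > 0" using d by (simp add: D_def)
  (* the Lipschitz constant of k at p that the first-order expansion yields *)
  define C where "C = (4 * B + 4) / D"
  have C: "C > 0" using B D by (simp add: C_def)
  define P where "P = norm p + 1"
  have P: "P > 0" by (simp add: P_def add_nonneg_pos)
  have kt: "(k \<longlongrightarrow> 1) (nhds p)" using k unfolding isCont_def by (metis tendsto_at_iff_tendsto_nhds)
  have kz: "((\<lambda>z. k z *\<^sub>R z) \<longlongrightarrow> p) (nhds p)"
    using tendsto_scaleR[OF kt, of "\<lambda>z. z" p] by (simp add: filterlim_ident)
  show ?thesis
    unfolding has_derivative_at_alt
  proof (intro conjI allI impI)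
    show "bounded_linear (\<lambda>v. - f' v / f' p)"
    proof -
      have "(\<lambda>v. - f' v / f' p) = (\<lambda>v. (- 1 / f' p) * f' v)" by (rule ext) simp
      then show ?thesis
        using bounded_linear_compose[OF bounded_linear_mult_right[of "- 1 / f' p"] f'.bounded_linear_axioms] by metis
    qed
  next
    fix e :: real assume e: "e > 0"
    define \<epsilon> where "\<epsilon> = min (min 1 (D / (2 * P))) (e * D / (2 * (2 + C * P)))"
    have q: "2 + C * P > 0" using C P by (simp add: add_pos_pos)
    have \<epsilon>: "\<epsilon> > 0" using D P e q by (simp add: \<epsilon>_def)
    have \<epsilon>1: "\<epsilon> \<le> 1" "\<epsilon> \<le> D / (2 * P)" "\<epsilon> \<le> e * D / (2 * (2 + C * P))" unfolding \<epsilon>_def by linarith+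
    have \<epsilon>2: "\<epsilon> * P \<le> D / 2" "\<epsilon> * (2 + C * P) \<le> e * D / 2"
    proof -
      have "\<epsilon> * (2 * P) \<le> D" using \<epsilon>1(2) P by (subst (asm) pos_le_divide_eq) auto
      moreover have "\<epsilon> * (2 * (2 + C * P)) \<le> e * D" using \<epsilon>1(3) q by (subst (asm) pos_le_divide_eq) auto
      ultimately show "\<epsilon> * P \<le> D / 2" "\<epsilon> * (2 + C * P) \<le> e * D / 2" by linarith+
    qed
    obtain \<delta>1 where \<delta>1: "\<delta>1 > 0" "\<And>y. norm (y - p) < \<delta>1 \<Longrightarrow> norm (f y - f p - f' (y - p)) \<le> \<epsilon> * norm (y - p)"
      using der \<epsilon> unfolding has_derivative_at_alt by blast
    define \<mu> where "\<mu> = min 1 (e * D / (2 * B))"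
    have \<mu>: "\<mu> > 0" "\<mu> \<le> 1" "\<mu> * B \<le> e * D / 2"
    proof -
      show "\<mu> > 0" "\<mu> \<le> 1" using e D B by (auto simp: \<mu>_def)
      have "\<mu> \<le> e * D / (2 * B)" by (simp add: \<mu>_def)
      then show "\<mu> * B \<le> e * D / 2" using B by (simp add: field_simps)
    qed
    have "\<forall>\<^sub>F z in nhds p. f (k z *\<^sub>R z) = 0 \<and> dist (k z) 1 < \<mu> \<and> dist (k z *\<^sub>R z) p < \<delta>1"
      using ev tendstoD[OF kt \<mu>(1)] tendstoD[OF kz \<delta>1(1)] by eventually_elim auto
    then obtain \<delta> where \<delta>: "\<delta> > 0" "\<And>z. dist z p < \<delta> \<Longrightarrow>
        f (k z *\<^sub>R z) = 0 \<and> dist (k z) 1 < \<mu> \<and> dist (k z *\<^sub>R z) p < \<delta>1"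
      unfolding eventually_nhds_metric by blast
    show "\<exists>d>0. \<forall>y. norm (y - p) < d \<longrightarrow> norm (k y - k p - - f' (y - p) / f' p) \<le> e * norm (y - p)"
    proof (intro exI[of _ \<delta>] conjI allI impI \<delta>(1))
      fix z assume "norm (z - p) < \<delta>"
      then have z: "f (k z *\<^sub>R z) = 0" "\<bar>k z - 1\<bar> < \<mu>" "norm (k z *\<^sub>R z - p) < \<delta>1"
        using \<delta>(2)[of z] by (auto simp: dist_norm)
      define h where "h = norm (z - p)"
      define r where "r = f' (k z *\<^sub>R z - p)"
      have kk: "\<bar>k z\<bar> \<le> 2" using z(2) \<mu>(2) by linarith
      have split: "k z *\<^sub>R z - p = k z *\<^sub>R (z - p) + (k z - 1) *\<^sub>R p" by (simp add: algebra_simps)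
      have "norm (k z *\<^sub>R z - p) \<le> \<bar>k z\<bar> * norm (z - p) + \<bar>k z - 1\<bar> * norm p"
        unfolding split by (metis norm_scaleR norm_triangle_ineq)
      also have "\<dots> \<le> 2 * h + \<bar>k z - 1\<bar> * P"
      proof -
        have "\<bar>k z\<bar> * norm (z - p) \<le> 2 * h" unfolding h_def using kk by (rule mult_right_mono) simp
        moreover have "\<bar>k z - 1\<bar> * norm p \<le> \<bar>k z - 1\<bar> * P" by (rule mult_left_mono) (auto simp: P_def)
        ultimately show ?thesis by linarith
      qed
      finally have nw: "norm (k z *\<^sub>R z - p) \<le> 2 * h + \<bar>k z - 1\<bar> * P" .
      have "\<bar>r\<bar> \<le> \<epsilon> * norm (k z *\<^sub>R z - p)" using \<delta>1(2)[OF z(3)] z(1) p by (simp add: r_def)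
      also have "\<dots> \<le> \<epsilon> * (2 * h + \<bar>k z - 1\<bar> * P)" using nw \<epsilon> by (intro mult_left_mono) auto
      finally have r: "\<bar>r\<bar> \<le> \<epsilon> * (2 * h + \<bar>k z - 1\<bar> * P)" .
      have req: "r = k z * f' (z - p) + (k z - 1) * f' p" unfolding r_def split by (simp add: f'.add f'.scale)
      have fb: "\<bar>f' (z - p)\<bar> \<le> B * h" using B(2)[of "z - p"] by (simp add: h_def mult.commute)
      have "\<bar>k z - 1\<bar> * D = \<bar>r - k z * f' (z - p)\<bar>" by (simp add: req D_def abs_mult)
      also have "\<dots> \<le> \<bar>r\<bar> + \<bar>k z\<bar> * \<bar>f' (z - p)\<bar>" by (metis abs_mult abs_triangle_ineq4)
      also have "\<dots> \<le> \<epsilon> * (2 * h + \<bar>k z - 1\<bar> * P) + 2 * (B * h)"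
      proof -
        have "\<bar>k z\<bar> * \<bar>f' (z - p)\<bar> \<le> 2 * (B * h)" by (rule mult_mono) (use kk fb in auto)
        then show ?thesis using r by linarith
      qed
      also have "\<dots> = 2 * (\<epsilon> * h) + (\<epsilon> * P) * \<bar>k z - 1\<bar> + 2 * (B * h)" by (simp add: algebra_simps)
      also have "\<dots> \<le> 2 * h + D / 2 * \<bar>k z - 1\<bar> + 2 * (B * h)"
      proof -
        have "\<epsilon> * h \<le> h" using mult_right_mono[OF \<epsilon>1(1), of h] by (simp add: h_def)
        moreover have "(\<epsilon> * P) * \<bar>k z - 1\<bar> \<le> D / 2 * \<bar>k z - 1\<bar>" using \<epsilon>2(1) by (rule mult_right_mono) simp
        ultimately show ?thesis by linarith
      qed
      finally have "\<bar>k z - 1\<bar> * D \<le> (4 + 4 * B) * h" by (simp add: algebra_simps)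
      then have kC: "\<bar>k z - 1\<bar> \<le> C * h" using D by (simp add: C_def field_simps)
      have "\<bar>(k z - 1) * f' p + f' (z - p)\<bar> = \<bar>r - (k z - 1) * f' (z - p)\<bar>" by (simp add: req algebra_simps)
      also have "\<dots> \<le> \<bar>r\<bar> + \<bar>k z - 1\<bar> * \<bar>f' (z - p)\<bar>" by (metis abs_mult abs_triangle_ineq4)
      also have "\<dots> \<le> \<epsilon> * (2 * h + (C * h) * P) + \<mu> * (B * h)"
      proof -
        have "\<epsilon> * (2 * h + \<bar>k z - 1\<bar> * P) \<le> \<epsilon> * (2 * h + (C * h) * P)"
          using kC \<epsilon> P by (intro mult_left_mono add_left_mono mult_right_mono) auto
        moreover have "\<bar>k z - 1\<bar> * \<bar>f' (z - p)\<bar> \<le> \<mu> * (B * h)"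
          by (rule mult_mono) (use z(2) fb \<mu>(1) in auto)
        ultimately show ?thesis using r by linarith
      qed
      also have "\<dots> = (\<epsilon> * (2 + C * P) + \<mu> * B) * h" by (simp add: algebra_simps)
      also have "\<dots> \<le> (e * D) * h" using \<epsilon>2(2) \<mu>(3) by (intro mult_right_mono) (auto simp: h_def)
      finally have fin: "\<bar>(k z - 1) * f' p + f' (z - p)\<bar> \<le> e * h * D" by (simp add: algebra_simps)
      have "(k z - k p - - f' (z - p) / f' p) = ((k z - 1) * f' p + f' (z - p)) / f' p"
        using d k(2) by (simp add: add_divide_distrib)
      then have "norm (k z - k p - - f' (z - p) / f' p) = \<bar>(k z - 1) * f' p + f' (z - p)\<bar> / D"
        by (simp add: D_def)
      also have "\<dots> \<le> e * h" using fin D by (simp add: pos_divide_le_eq)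
      finally show "norm (k z - k p - - f' (z - p) / f' p) \<le> e * norm (z - p)" by (simp add: h_def)
    qed
  qed
qed

text \<open>Think of \<open>G\<close> as the gauge of the star-shaped domain \<open>{z. G z \<le> 1}\<close>. The regularity of its boundary is
  recorded as smoothness of the gradient field \<open>N\<close> along the boundary.\<close>

locale star_gauge =
  fixes G :: "'a::euclidean_space \<Rightarrow> real" and N :: "'a \<Rightarrow> 'a"
  assumes cont: "continuous_on UNIV G"
    and homog: "s \<ge> 0 \<Longrightarrow> G (s *\<^sub>R z) = s * G z"
    and pos: "z \<noteq> 0 \<Longrightarrow> G z > 0"
    and deriv: "z \<noteq> 0 \<Longrightarrow> (G has_derivative (\<lambda>v. N z \<bullet> v)) (at z)"
    and smooth: "smooth_along {z. G z = 1} N"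

text \<open>Transversality says that a local defining function has a nonzero derivative in the radial direction,
  since otherwise the position vector would be the velocity of a curve in the boundary. Therefore no
  ray can run inside the domain past a boundary point, each ray meets the boundary exactly once, and
  the gauge exists. The same nonvanishing derivative makes the gauge differentiable.\<close>

theorem star_shaped_gauge:
  fixes X :: "'a::euclidean_space set"
  assumes comp: "compact X" and ne: "X \<noteq> {}" and star: "\<And>x. x \<in> X \<Longrightarrow> closed_segment 0 x \<subseteq> X"
    and sm: "smooth_boundary X" and transv: "\<And>p. p \<in> frontier X \<Longrightarrow> p \<notin> tangent_space (frontier X) p"
  shows "\<exists>G N. star_gauge G N \<and> X = {z. G z \<le> 1} \<and> frontier X = {z. G z = 1}"
proof -
  have clX: "closed X" and bdX: "bounded X" using comp by (auto simp: compact_eq_bounded_closed)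
  have "0 \<in> X" using ne star by fastforce
  have Y0: "0 \<notin> frontier X"
  proof
    assume 0: "0 \<in> frontier X"
    then have "0 \<in> tangent_space (frontier X) 0"
      unfolding tangent_space_def mem_Collect_eq by (intro exI[of _ "\<lambda>_. 0"]) auto
    then show False using transv[OF 0] by simp
  qed
  then have int0: "0 \<in> interior X" using \<open>0 \<in> X\<close> closure_subset by (auto simp: frontier_def)
  have YX: "frontier X \<subseteq> X" using clX by (simp add: frontier_subset_eq)
  (* near a boundary point the boundary is a regular level set whose defining function has nonzero radial derivative *)
  have local: "\<exists>U f. open U \<and> p \<in> U \<and> smooth_on U f \<and> X \<inter> U = {x\<in>U. f x \<le> 0} \<and>
      frontier X \<inter> U = {x\<in>U. f x = 0} \<and> gradient f p \<bullet> p \<noteq> 0" if p: "p \<in> frontier X" for p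
  proof -
    obtain U f where U: "open U" "p \<in> U" and f: "smooth_on U (f :: 'a \<Rightarrow> real)"
      "\<And>x. x \<in> U \<Longrightarrow> frechet_derivative f (at x) \<noteq> (\<lambda>_. 0)" "X \<inter> U = {x\<in>U. f x \<le> 0}"
      using bspec[OF sm[unfolded smooth_boundary_def] p] by auto
    have der: "(f has_derivative frechet_derivative f (at x)) (at x)" if "x \<in> U" for x
      using smooth_on_imp_differentiable[OF f(1) that] by (simp add: frechet_derivative_works)
    have f3: "x \<in> X \<longleftrightarrow> f x \<le> 0" if "x \<in> U" for x using f(3) that by blast
    have fr: "frontier X \<inter> U = {x\<in>U. f x = 0}"
    proof (intro set_eqI iffI)
      fix x assume x: "x \<in> frontier X \<inter> U"
      then have "f x \<le> 0" using f3 YX by blast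
      moreover have "\<not> f x < 0"
      proof
        assume "f x < 0"
        have "open {y\<in>U. f y < 0}"
        proof -
          have "{y\<in>U. f y < 0} = U \<inter> f -` {..<0}" by auto
          then show ?thesis
            using continuous_open_preimage[OF smooth_on_imp_continuous[OF f(1)] U(1) open_lessThan] by simp
        qed
        moreover have "{y\<in>U. f y < 0} \<subseteq> X" using f3 by auto
        ultimately have "{y\<in>U. f y < 0} \<subseteq> interior X" by (intro interior_maximal)
        then have "x \<in> interior X" using \<open>f x < 0\<close> x by auto
        then show False using x by (auto simp: frontier_def)
      qed
      ultimately show "x \<in> {x\<in>U. f x = 0}" using x by auto
    next
      fix x assume x: "x \<in> {x\<in>U. f x = 0}"
      then have "x \<in> X" using f3 by auto
      have "x \<notin> interior X"
      proof
        assume "x \<in> interior X"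
        then have "x \<in> interior X \<inter> U" "open (interior X \<inter> U)" using x U by auto
        moreover have "\<forall>y\<in>interior X \<inter> U. f y \<le> f x"
          using f3 x subsetD[OF interior_subset, of _ X] by auto
        moreover have "x \<in> U" using x by simp
        ultimately have "frechet_derivative f (at x) = (\<lambda>v. 0)"
          by (intro differential_zero_maxmin[OF _ _ der]) auto
        then show False using f(2)[OF \<open>x \<in> U\<close>] by simp
      qed
      then show "x \<in> frontier X \<inter> U" using x \<open>x \<in> X\<close> closure_subset by (auto simp: frontier_def)
    qed
    have gr: "(f has_derivative (\<lambda>v. gradient f p \<bullet> v)) (at p)"
      using smooth_on_imp_differentiable[OF f(1) U(2)] by (rule has_derivative_gradient)
    have p0: "f p = 0" using fr p U by blast
    have "gradient f p \<bullet> p \<noteq> 0"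
    proof
      assume z: "gradient f p \<bullet> p = 0"
      obtain w where w: "gradient f p \<bullet> w \<noteq> 0"
        using f(2)[OF U(2)] frechet_derivative_eqI[OF gr] by fastforce
      have "p \<in> tangent_space {x\<in>U. f x = 0} p"
        by (rule tangent_space_zero_set[OF U smooth_on_imp_continuous[OF f(1)] gr p0 z w])
      then have "p \<in> tangent_space (frontier X) p"
        using tangent_space_mono[of "{x\<in>U. f x = 0}" "frontier X"] fr by blast
      then show False using transv p by blast
    qed
    then show ?thesis using U f fr by blast
  qed
  (* past a boundary point p the defining function would have a maximum along the ray at p *)
  have noext: "t \<le> 1" if p: "p \<in> frontier X" and t: "t *\<^sub>R p \<in> X" for p t
  proof (rule ccontr)
    assume "\<not> t \<le> 1"
    then have t1: "t > 1" by simp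
    obtain U f where U: "open U" "p \<in> U" and f: "smooth_on U f" "X \<inter> U = {x\<in>U. f x \<le> 0}"
      "frontier X \<inter> U = {x\<in>U. f x = 0}" "gradient f p \<bullet> p \<noteq> 0" using local[OF p] by blast
    have gr: "(f has_derivative (\<lambda>v. gradient f p \<bullet> v)) (at (1 *\<^sub>R p))"
      using has_derivative_gradient[OF smooth_on_imp_differentiable[OF f(1) U(2)]] by simp
    have "((\<lambda>r. f (r *\<^sub>R p)) has_derivative (\<lambda>r. gradient f p \<bullet> (r *\<^sub>R p))) (at 1)"
      by (rule has_derivative_compose[of "\<lambda>r. r *\<^sub>R p" "\<lambda>r. r *\<^sub>R p" 1 UNIV f "\<lambda>v. gradient f p \<bullet> v"])
         (use gr in \<open>auto intro!: derivative_eq_intros\<close>)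
    moreover have "open ({r. r *\<^sub>R p \<in> U} \<inter> {0<..<t})"
      using U(1) by (intro open_Int) (auto intro!: open_vimage[unfolded vimage_def] continuous_intros)
    moreover have "f (r *\<^sub>R p) \<le> f (1 *\<^sub>R p)" if r: "r \<in> {r. r *\<^sub>R p \<in> U} \<inter> {0<..<t}" for r
    proof -
      have "r *\<^sub>R p \<in> closed_segment 0 (t *\<^sub>R p)"
        unfolding in_segment using r t1 by (intro exI[of _ "r / t"]) auto
      then have "r *\<^sub>R p \<in> X" using star t by blast
      then have "r *\<^sub>R p \<in> {x\<in>U. f x \<le> 0}" using f(2) r by blast
      moreover have "p \<in> {x\<in>U. f x = 0}" using f(3) p U by blast
      ultimately show ?thesis by simp
    qed
    ultimately have "(\<lambda>r. gradient f p \<bullet> (r *\<^sub>R p)) = (\<lambda>r. 0)"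
      using differential_zero_maxmin[of 1 "{r. r *\<^sub>R p \<in> U} \<inter> {0<..<t}"] U t1 by auto
    then have "gradient f p \<bullet> (1 *\<^sub>R p) = 0" by (rule fun_cong)
    then show False using f(4) by simp
  qed
  have ray: "\<exists>d>0. d *\<^sub>R z \<in> frontier X \<and> (\<forall>e. 0 \<le> e \<and> e < d \<longrightarrow> e *\<^sub>R z \<in> interior X)" if "z \<noteq> 0" for z
    using ray_to_frontier[OF bdX int0 that] by (metis add_0)
  have uniq: "d = d'" if "d > 0" "d' > 0" "d *\<^sub>R z \<in> frontier X" "d' *\<^sub>R z \<in> frontier X" for d d' z
  proof -
    have "d' / d \<le> 1" using noext[OF that(3), of "d' / d"] that YX by auto
    moreover have "d / d' \<le> 1" using noext[OF that(4), of "d / d'"] that YX by auto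
    ultimately show ?thesis using that by (simp add: field_simps)
  qed
  (* R z scales z onto the boundary; the gauge is its reciprocal *)
  define R where "R z = (THE d. d > 0 \<and> d *\<^sub>R z \<in> frontier X)" for z
  have R: "R z > 0" "R z *\<^sub>R z \<in> frontier X" and Rint: "\<And>e. 0 \<le> e \<Longrightarrow> e < R z \<Longrightarrow> e *\<^sub>R z \<in> interior X"
    if nz: "z \<noteq> 0" for z
  proof -
    obtain d where d: "d > 0" "d *\<^sub>R z \<in> frontier X" "\<forall>e. 0 \<le> e \<and> e < d \<longrightarrow> e *\<^sub>R z \<in> interior X"
      using ray[OF nz] by blast
    then have "R z = d" unfolding R_def using uniq by (intro the_equality) blast+
    then show "R z > 0" "R z *\<^sub>R z \<in> frontier X" "\<And>e. 0 \<le> e \<Longrightarrow> e < R z \<Longrightarrow> e *\<^sub>R z \<in> interior X"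
      using d by auto
  qed
  have Req: "R z = d" if "d > 0" "d *\<^sub>R z \<in> frontier X" for d z
    unfolding R_def using that uniq by (intro the_equality) blast+
  define G where "G z = (if z = 0 then 0 else 1 / R z)" for z
  have Gpos: "G z > 0" if "z \<noteq> 0" for z using R[OF that] that by (simp add: G_def)
  have Gh: "G (s *\<^sub>R z) = s * G z" if "s \<ge> 0" for s z
  proof (cases "s = 0 \<or> z = 0")
    case False
    then have "R (s *\<^sub>R z) = R z / s" using that R[of z] by (intro Req) auto
    then show ?thesis using False by (simp add: G_def)
  qed (auto simp: G_def)
  have G1: "G z = 1 \<longleftrightarrow> z \<in> frontier X" for z
  proof (cases "z = 0")
    case False
    show ?thesis
    proof
      assume "G z = 1"
      then have "R z = 1" using False R[of z] by (simp add: G_def)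
      then show "z \<in> frontier X" using R(2)[OF False] by simp
    next
      assume "z \<in> frontier X"
      then have "R z = 1" using Req[of 1 z] by simp
      then show "G z = 1" using False by (simp add: G_def)
    qed
  qed (use Y0 in \<open>auto simp: G_def\<close>)
  have Glt: "G z < 1 \<longleftrightarrow> z \<in> interior X" for z
  proof (cases "z = 0")
    case False
    have "R z > 1" if "z \<in> interior X"
    proof (rule ccontr)
      assume "\<not> R z > 1"
      then consider "R z = 1" | "R z < 1" by linarith
      then show False
      proof cases
        case 1
        then show False using R(2)[OF False] that by (auto simp: frontier_def)
      next
        case 2
        have "z \<in> X" using that interior_subset by blast
        then have "1 / R z \<le> 1" using noext[OF R(2)[OF False], of "1 / R z"] R(1)[OF False] by auto
        then show False using 2 R(1)[OF False] by (simp add: field_simps)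
      qed
    qed
    moreover have "z \<in> interior X" if "R z > 1" using Rint[OF False, of 1] that by simp
    ultimately show ?thesis using False R(1)[OF False] by (auto simp: G_def field_simps)
  qed (use int0 in \<open>auto simp: G_def\<close>)
  have Gle: "G z \<le> 1 \<longleftrightarrow> z \<in> X" for z
    using Glt[of z] G1[of z] YX interior_subset clX closure_subset
    by (smt (verit) Diff_iff closure_closed frontier_def subsetD)
  (* strict sublevel sets are scaled copies of the open set interior X, sublevel sets of the closed set X *)
  have cont: "continuous_on UNIV G"
  proof -
    have o: "open {x. G x < a}" for a
    proof (cases "a > 0")
      case True
      have "G x < a \<longleftrightarrow> (1 / a) *\<^sub>R x \<in> interior X" for x
        using Glt[of "(1 / a) *\<^sub>R x"] Gh[of "1 / a" x] True by (simp add: field_simps)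
      then have "{x. G x < a} = (\<lambda>x. (1 / a) *\<^sub>R x) -` interior X" by auto
      then show ?thesis by (auto intro!: open_vimage continuous_intros)
    next
      case False
      have "G x \<ge> 0" for x using Gpos[of x] by (cases "x = 0") (auto simp: G_def)
      then have "{x. G x < a} = {}" using False by (force simp: not_less intro: order_trans)
      then show ?thesis by simp
    qed
    have c: "open {x. G x > a}" for a
    proof (cases "a > 0")
      case True
      have "G x \<le> a \<longleftrightarrow> (1 / a) *\<^sub>R x \<in> X" for x
        using Gle[of "(1 / a) *\<^sub>R x"] Gh[of "1 / a" x] True by (simp add: field_simps)
      then have "{x. G x > a} = - ((\<lambda>x. (1 / a) *\<^sub>R x) -` X)" by (auto simp: not_le[symmetric])
      then show ?thesis using clX by (auto intro!: closed_vimage continuous_intros)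
    next
      case False
      show ?thesis
      proof (cases "a = 0")
        case True
        have "{x. G x > a} = - {0}" using True Gpos by (auto simp: G_def)
        then show ?thesis by auto
      next
        case False
        have "G x \<ge> 0" for x using Gpos[of x] by (cases "x = 0") (auto simp: G_def)
        then have "{x. G x > a} = UNIV" using False \<open>\<not> a > 0\<close>
          by (metis (mono_tags, lifting) UNIV_eq_I linorder_neqE_linordered_idom mem_Collect_eq order_less_le_trans)
        then show ?thesis by simp
      qed
    qed
    have "(G \<longlongrightarrow> G x) (at x)" for x
    proof (rule order_tendstoI)
      fix a assume "a < G x"
      then show "\<forall>\<^sub>F y in at x. a < G y"
        unfolding eventually_at_topological using c[of a] by auto
    next
      fix a assume "G x < a"
      then show "\<forall>\<^sub>F y in at x. G y < a"
        unfolding eventually_at_topological using o[of a] by auto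
    qed
    then show ?thesis by (simp add: continuous_on_eq_continuous_at isCont_def)
  qed
  have Gnh: "G z = 1 \<Longrightarrow> z \<noteq> 0" for z by (auto simp: G_def)
  have derY: "(G has_derivative (\<lambda>v. ((1 / (gradient f p \<bullet> p)) *\<^sub>R gradient f p) \<bullet> v)) (at p)"
    if p: "p \<in> frontier X" and U: "open U" "p \<in> U" "smooth_on U f" "frontier X \<inter> U = {x\<in>U. f x = 0}"
      "gradient f p \<bullet> p \<noteq> 0" for p U f
  proof -
    have p1: "G p = 1" and pn: "p \<noteq> 0" using p G1 Gnh by auto
    have cG: "isCont G z" for z using cont by (simp add: continuous_on_eq_continuous_at)
    have gr: "(f has_derivative (\<lambda>v. gradient f p \<bullet> v)) (at p)"
      by (rule has_derivative_gradient[OF smooth_on_imp_differentiable[OF U(3,2)]])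
    have cp: "isCont (\<lambda>z. (1 / G z) *\<^sub>R z) p"
      using cG p1 by (intro continuous_intros) auto
    have "((\<lambda>z. (1 / G z) *\<^sub>R z) \<longlongrightarrow> p) (nhds p)"
      using cp p1 tendsto_at_iff_tendsto_nhds[of "\<lambda>z. (1 / G z) *\<^sub>R z" p] by (simp add: isCont_def)
    then have "\<forall>\<^sub>F z in nhds p. (1 / G z) *\<^sub>R z \<in> U" using U(1,2) by (rule topological_tendstoD)
    moreover have "\<forall>\<^sub>F z in nhds p. z \<noteq> 0"
      using pn by (intro eventually_nhds_in_open[of "-{0}" p, simplified]) auto
    ultimately have ev: "\<forall>\<^sub>F z in nhds p. f ((1 / G z) *\<^sub>R z) = 0"
    proof eventually_elim
      case (elim z)
      have "G ((1 / G z) *\<^sub>R z) = 1" using Gh[of "1 / G z" z] Gpos[OF elim(2)] by simp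
      then show ?case using elim U(4) G1 by blast
    qed
    have k: "((\<lambda>z. 1 / G z) has_derivative (\<lambda>v. - (gradient f p \<bullet> v) / (gradient f p \<bullet> p))) (at p)"
      by (rule has_derivative_implicit_scaling[OF gr _ U(5) _ _ ev])
         (use p U cG p1 in \<open>auto intro!: continuous_intros\<close>)
    have "((\<lambda>z. inverse (1 / G z)) has_derivative
        (\<lambda>v. - (inverse (1 / G p) * (- (gradient f p \<bullet> v) / (gradient f p \<bullet> p)) * inverse (1 / G p)))) (at p)"
      by (rule Deriv.has_derivative_inverse[OF _ k]) (use p1 in auto)
    then show ?thesis by (simp add: p1)
  qed
  (* on the boundary this is the gradient of f, scaled so that its inner product with the position is 1 *)
  define N where "N z = gradient G z" for z
  have derN: "(G has_derivative (\<lambda>v. N z \<bullet> v)) (at z)" if z: "z \<noteq> 0" for z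
  proof -
    define p where "p = (1 / G z) *\<^sub>R z"
    have "G p = 1" using Gh[of "1 / G z" z] Gpos[OF z] by (simp add: p_def)
    then have pY: "p \<in> frontier X" using G1 by blast
    obtain U f where U: "open U" "p \<in> U" "smooth_on U f" 
      "frontier X \<inter> U = {x\<in>U. f x = 0}" "gradient f p \<bullet> p \<noteq> 0" using local[OF pY] by blast
    from derY[OF pY U] obtain n where n: "(G has_derivative (\<lambda>v. n \<bullet> v)) (at p)" ..
    have "((\<lambda>y. G z * G ((1 / G z) *\<^sub>R y)) has_derivative (\<lambda>v. G z * (n \<bullet> ((1 / G z) *\<^sub>R v)))) (at z)"
      using n unfolding p_def
      by (intro has_derivative_mult_right has_derivative_compose[of "\<lambda>y. (1 / G z) *\<^sub>R y" _ _ _ G])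
         (auto intro!: derivative_eq_intros)
    moreover have "(\<lambda>y. G z * G ((1 / G z) *\<^sub>R y)) = G" using Gh[of "1 / G z"] Gpos[OF z] by auto
    ultimately have "(G has_derivative (\<lambda>v. n \<bullet> v)) (at z)" using Gpos[OF z] by simp
    then show ?thesis by (metis N_def gradient_eqI)
  qed
  have "smooth_along {z. G z = 1} N"
    unfolding smooth_along_def
  proof
    fix p assume "p \<in> {z. G z = 1}"
    then have p: "p \<in> frontier X" using G1 by blast
    obtain U f where U: "open U" "p \<in> U" "smooth_on U f" 
      "frontier X \<inter> U = {x\<in>U. f x = 0}" "gradient f p \<bullet> p \<noteq> 0" using local[OF p] by blast
    define V where "V = {x\<in>U. gradient f x \<bullet> x \<noteq> 0}"
    have sg: "smooth_on U (gradient f)" using U by (simp add: smooth_on_gradient)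
    have "continuous_on U (\<lambda>x. gradient f x \<bullet> x)"
      by (intro continuous_intros smooth_on_imp_continuous[OF sg])
    then have "open (U \<inter> (\<lambda>x. gradient f x \<bullet> x) -` (-{0}))"
      by (rule continuous_open_preimage[OF _ U(1)]) auto
    moreover have "V = U \<inter> (\<lambda>x. gradient f x \<bullet> x) -` (-{0})" by (auto simp: V_def)
    ultimately have "open V" by simp
    have VU: "V \<subseteq> U" by (auto simp: V_def)
    define g where "g x = inverse (gradient f x \<bullet> x) *\<^sub>R gradient f x" for x
    have id: "smooth_on V (\<lambda>x. x)" using \<open>open V\<close> by (simp add: smooth_on_def Ck_on_ident)
    have sgV: "smooth_on V (gradient f)" using smooth_on_subset[OF sg VU] .
    have "smooth_on V g" unfolding g_def
      by (intro smooth_on_bilinear[OF \<open>open V\<close> bounded_bilinear_scaleR] smooth_on_inverse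
          smooth_on_bilinear[OF \<open>open V\<close> bounded_bilinear_inner] \<open>open V\<close> sgV id) (auto simp: V_def)
    moreover have "g x = N x" if x: "x \<in> V \<inter> {z. G z = 1}" for x
    proof -
      have "(G has_derivative (\<lambda>v. ((1 / (gradient f x \<bullet> x)) *\<^sub>R gradient f x) \<bullet> v)) (at x)"
        by (rule derY[of x U]) (use x U G1 in \<open>auto simp: V_def\<close>)
      from gradient_eqI[OF this] show ?thesis by (simp add: N_def g_def divide_inverse)
    qed
    ultimately show "\<exists>U g. open U \<and> p \<in> U \<and> smooth_on U g \<and> (\<forall>x\<in>U \<inter> {z. G z = 1}. g x = N x)"
      using \<open>open V\<close> U by (intro exI[of _ V] exI[of _ g]) (auto simp: V_def)
  qed
  then have "star_gauge G N"
    using cont Gh Gpos derN by unfold_locales auto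
  moreover have "X = {z. G z \<le> 1}" "frontier X = {z. G z = 1}" using Gle G1 by auto
  ultimately show ?thesis by blast
qed

context star_gauge
begin

abbreviation "Y \<equiv> {z. G z = 1}"

abbreviation "proj z \<equiv> (1 / G z) *\<^sub>R z"

lemma G_0 [simp]: "G 0 = 0"
  using homog[of 0 0] by simp

lemma G_nonneg: "G z \<ge> 0"
  using pos[of z] by (cases "z = 0") auto

lemma Y_nonzero: "z \<in> Y \<Longrightarrow> z \<noteq> 0"
  by auto

lemma proj_in_Y: "z \<noteq> 0 \<Longrightarrow> proj z \<in> Y"
  using homog[of "1 / G z" z] pos[of z] by simp

lemma isCont_G: "isCont G z"
  using cont by (simp add: continuous_on_eq_continuous_at)

lemma gradient_unique: "z \<noteq> 0 \<Longrightarrow> (G has_derivative (\<lambda>v. n \<bullet> v)) (at z) \<Longrightarrow> n = N z"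
  by (metis deriv gradient_eqI)

lemma N_scale: assumes "s > 0" "z \<noteq> 0" shows "N (s *\<^sub>R z) = N z"
proof -
  have "(G has_derivative (\<lambda>v. N (s *\<^sub>R z) \<bullet> v)) (at (s *\<^sub>R z))" using assms by (intro deriv) auto
  then have "((\<lambda>y. (1 / s) * G (s *\<^sub>R y)) has_derivative (\<lambda>v. (1 / s) * (N (s *\<^sub>R z) \<bullet> (s *\<^sub>R v)))) (at z)"
    by (intro has_derivative_mult_right has_derivative_compose[of "\<lambda>y. s *\<^sub>R y" _ _ _ G])
       (auto intro!: derivative_eq_intros)
  moreover have "(\<lambda>y. (1 / s) * G (s *\<^sub>R y)) = G" using homog[of s] assms by auto
  ultimately have "(G has_derivative (\<lambda>v. N (s *\<^sub>R z) \<bullet> v)) (at z)" using assms by simp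
  then show ?thesis using gradient_unique assms by blast
qed

lemma euler: assumes "z \<noteq> 0" shows "N z \<bullet> z = G z"
proof -
  have "((\<lambda>s. G (s *\<^sub>R z)) has_derivative (\<lambda>s. N z \<bullet> (s *\<^sub>R z))) (at 1)"
    using deriv[OF assms]
    by (intro has_derivative_compose[of "\<lambda>s. s *\<^sub>R z" _ _ _ G]) (auto intro!: derivative_eq_intros)
  then have 1: "((\<lambda>s. G (s *\<^sub>R z)) has_real_derivative (N z \<bullet> z)) (at 1)"
    by (simp add: has_field_derivative_def mult_commute_abs)
  have "((\<lambda>s. s * G z) has_real_derivative (G z)) (at 1)"
    by (auto intro!: derivative_eq_intros)
  then have "((\<lambda>s. G (s *\<^sub>R z)) has_real_derivative (G z)) (at 1)"
  proof (rule has_field_derivative_transform_within_open[where S = "{0<..}"])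
  qed (use homog in auto)
  with 1 show ?thesis by (rule DERIV_unique)
qed

lemma N_nonzero: "z \<noteq> 0 \<Longrightarrow> N z \<noteq> 0"
  using euler[of z] pos[of z] by auto

lemma isCont_proj: "z \<noteq> 0 \<Longrightarrow> isCont (\<lambda>z. proj z) z"
  using isCont_G pos[of z] by (intro continuous_intros) auto

lemma N_proj: "z \<noteq> 0 \<Longrightarrow> N (proj z) = N z"
  using N_scale[of "1 / G z" z] pos[of z] by simp

lemma continuous_on_proj: "continuous_on (-{0}) (\<lambda>z. proj z)"
  by (rule continuous_at_imp_continuous_on) (use isCont_proj in auto)

lemma continuous_on_N: "continuous_on (-{0}) N"
proof -
  have "continuous_on (-{0}) (\<lambda>z. N (proj z))"
    by (rule continuous_on_compose2[OF smooth_along_imp_continuous[OF smooth] continuous_on_proj])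
       (use proj_in_Y in auto)
  then show ?thesis by (rule continuous_on_eq) (use N_proj in auto)
qed

text \<open>Smoothness of \<open>N\<close> is given along \<open>Y\<close> only; as \<open>N\<close> is constant along rays, it is the composition of a
  local extension with the radial projection.\<close>

lemma differentiable_N: assumes z: "z \<noteq> 0" shows "N differentiable (at z)"
proof -
  have pY: "proj z \<in> Y" using proj_in_Y[OF z] .
  then obtain U g where U: "open U" "proj z \<in> U" "smooth_on U g" "\<forall>x\<in>U \<inter> Y. g x = N x"
    using smooth unfolding smooth_along_def by meson
  have "(\<lambda>z. 1 / G z) differentiable (at z)"
    using deriv[OF z] pos[OF z] by (intro differentiable_divide) (auto simp: differentiable_def)
  then have "(\<lambda>z. proj z) differentiable (at z)" by (intro differentiable_scaleR) auto
  moreover have "g differentiable (at (proj z))" using smooth_on_imp_differentiable U by blast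
  ultimately have "(\<lambda>z. g (proj z)) differentiable (at z)"
    using differentiable_chain_at[of "\<lambda>z. proj z" z g] by (simp add: o_def)
  then obtain D where D: "((\<lambda>z. g (proj z)) has_derivative D) (at z)" by (auto simp: differentiable_def)
  have "\<forall>\<^sub>F x in at z. proj x \<in> U"
    using isCont_proj[OF z] U(1,2) unfolding isCont_def by (rule topological_tendstoD)
  moreover have "\<forall>\<^sub>F x in at z. x \<noteq> 0"
    using z tendsto_imp_eventually_ne[OF tendsto_ident_at] by blast
  ultimately have ev: "\<forall>\<^sub>F x in at z. g (proj x) = N x"
    by eventually_elim (use U(4) proj_in_Y N_proj in auto)
  have "g (proj z) = N z" using U pY N_proj[OF z] by auto
  then have "(N has_derivative D) (at z)"
    using has_derivative_transform_eventually[OF D ev] by simp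
  then show ?thesis by (auto simp: differentiable_def)
qed

text \<open>A vector orthogonal to \<open>N p\<close> is the velocity of the radial projection of the straight line
  \<open>p + t v\<close>. The line avoids the origin for all \<open>t\<close> because \<open>N p \<bullet> (p + t v) = 1\<close>.\<close>

lemma tangent_space_Y: assumes p: "p \<in> Y" shows "tangent_space Y p = {v. N p \<bullet> v = 0}"
proof (intro set_eqI iffI)
  fix v assume "v \<in> tangent_space Y p"
  then obtain c :: "real \<Rightarrow> 'a" where c: "\<And>t. c t \<in> Y" "c 0 = p" "(c has_vector_derivative v) (at 0)"
    unfolding tangent_space_def by blast
  have "((\<lambda>t. G (c t)) has_derivative (\<lambda>t. N p \<bullet> (t *\<^sub>R v))) (at 0)"
    using c(3) deriv[OF Y_nonzero[OF p]] unfolding c(2)[symmetric] has_vector_derivative_def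
    by (rule has_derivative_compose[of c _ _ _ G])
  moreover have "(\<lambda>t. G (c t)) = (\<lambda>_. 1)" using c(1) by auto
  ultimately have "((\<lambda>_. 1) has_derivative (\<lambda>t. N p \<bullet> (t *\<^sub>R v))) (at (0::real))" by simp
  then have "(\<lambda>t. N p \<bullet> (t *\<^sub>R v)) = (\<lambda>_. 0)" using has_derivative_const by (rule has_derivative_unique)
  then have "N p \<bullet> (1 *\<^sub>R v) = 0" by (rule fun_cong)
  then show "v \<in> {v. N p \<bullet> v = 0}" by simp
next
  fix v assume v: "v \<in> {v. N p \<bullet> v = 0}"
  have p0: "p \<noteq> 0" and p1: "G p = 1" using p by auto
  have nz: "p + t *\<^sub>R v \<noteq> 0" for t
  proof
    assume "p + t *\<^sub>R v = 0"
    then have "N p \<bullet> (p + t *\<^sub>R v) = 0" by simp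
    then show False using v euler[OF p0] p1 by (simp add: inner_add_right)
  qed
  define c where "c t = proj (p + t *\<^sub>R v)" for t
  have q: "((\<lambda>t. p + t *\<^sub>R v) has_derivative (\<lambda>t. t *\<^sub>R v)) (at 0)" by (auto intro!: derivative_eq_intros)
  have g: "((\<lambda>t. G (p + t *\<^sub>R v)) has_derivative (\<lambda>t. N p \<bullet> (t *\<^sub>R v))) (at 0)"
    using has_derivative_compose[OF q, of G "\<lambda>v. N p \<bullet> v"] deriv[OF p0] by simp
  have "((\<lambda>t. inverse (G (p + t *\<^sub>R v))) has_derivative
       (\<lambda>t. - (inverse (G (p + 0 *\<^sub>R v)) * (N p \<bullet> (t *\<^sub>R v)) * inverse (G (p + 0 *\<^sub>R v))))) (at 0)"
    by (rule Deriv.has_derivative_inverse[OF _ g]) (use p1 in auto)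
  then have "((\<lambda>t. inverse (G (p + t *\<^sub>R v))) has_derivative (\<lambda>t. 0)) (at 0)" using v by simp
  from has_derivative_scaleR[OF this q]
  have "(c has_vector_derivative v) (at 0)"
    by (simp add: c_def[abs_def] has_vector_derivative_def p1 divide_inverse)
  moreover have "c t \<in> Y" for t using proj_in_Y[OF nz[of t]] by (simp add: c_def)
  moreover have "c 0 = p" using p1 by (simp add: c_def)
  ultimately show "v \<in> tangent_space Y p"
    unfolding tangent_space_def mem_Collect_eq by (intro exI[of _ c]) auto
qed

lemma norm_bounds: obtains K where "K > 0" "\<And>z. norm z \<le> K * G z"
proof -
  let ?S = "sphere (0::'a) 1"
  have "compact ?S" "?S \<noteq> {}" by simp_all
  then obtain m where m: "m \<in> ?S" "\<And>x. x \<in> ?S \<Longrightarrow> G m \<le> G x"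
    using continuous_attains_inf[OF _ _ continuous_on_subset[OF cont subset_UNIV], of ?S] by auto
  have Gm: "G m > 0" using m(1) by (intro pos) auto
  have "norm z \<le> (1 / G m) * G z" for z
  proof (cases "z = 0")
    case False
    have "G m \<le> G ((1 / norm z) *\<^sub>R z)" using False by (intro m(2)) (auto simp: dist_norm)
    then show ?thesis using homog[of "1 / norm z" z] False Gm by (simp add: field_simps)
  qed simp
  then show ?thesis using that[of "1 / G m"] Gm by auto
qed

lemma compact_sublevel: "compact {z. G z \<le> r}"
proof -
  obtain K where K: "K > 0" "\<And>z. norm z \<le> K * G z" using norm_bounds by blast
  have "norm z \<le> K * r" if "G z \<le> r" for z
    using K(2)[of z] mult_left_mono[OF that, of K] K(1) by linarith
  then have "bounded {z. G z \<le> r}" by (auto simp: bounded_iff)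
  moreover have "closed {z. G z \<le> r}"
    using cont by (intro closed_Collect_le) (auto intro: continuous_intros)
  ultimately show ?thesis by (simp add: compact_eq_bounded_closed)
qed

lemma closed_Y: "closed Y"
  using cont by (intro closed_Collect_eq) (auto intro: continuous_intros)

lemma compact_Y: "compact Y"
proof -
  have "Y = {z. G z \<le> 1} \<inter> Y" by auto
  then show ?thesis using compact_Int_closed[OF compact_sublevel closed_Y] by metis
qed

end

section \<open>Rotation numbers of paths of matrices\<close>

definition to_complex :: "real^2 \<Rightarrow> complex" where
  "to_complex v = Complex (v $ 1) (v $ 2)"

text \<open>Angles are measured in full turns.\<close>

abbreviation has_angle :: "real^2 \<Rightarrow> real \<Rightarrow> bool" where
  "has_angle v \<alpha> \<equiv> v = norm v *\<^sub>R vector [cos (2 * pi * \<alpha>), sin (2 * pi * \<alpha>)]"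

lemma norm_to_complex [simp]: "cmod (to_complex v) = norm v"
  by (simp add: to_complex_def cmod_def norm_eq_sqrt_inner[of v] inner_vec_def sum_2 power2_eq_square)

lemma to_complex_eq_iff [simp]: "to_complex v = to_complex w \<longleftrightarrow> v = w"
  by (auto simp: to_complex_def vec_eq_iff forall_2)

lemma to_complex_add: "to_complex (v + w) = to_complex v + to_complex w"
  by (simp add: to_complex_def complex_eq_iff)

lemma to_complex_scaleR: "to_complex (r *\<^sub>R v) = of_real r * to_complex v"
  by (simp add: to_complex_def complex_eq_iff)

lemma continuous_on_to_complex [continuous_intros]:
  "continuous_on S f \<Longrightarrow> continuous_on S (\<lambda>x. to_complex (f x))"
  unfolding to_complex_def Complex_eq by (intro continuous_intros)

lemma has_angle_iff: "has_angle v \<alpha> \<longleftrightarrow> to_complex v = of_real (norm v) * cis (2 * pi * \<alpha>)"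
proof -
  have "to_complex (vector [cos (2 * pi * \<alpha>), sin (2 * pi * \<alpha>)]) = cis (2 * pi * \<alpha>)"
    by (simp add: to_complex_def complex_eq_iff)
  then show ?thesis by (metis to_complex_eq_iff to_complex_scaleR)
qed

lemma has_angleI: assumes "to_complex v = of_real r * cis (2 * pi * \<alpha>)" "r \<ge> 0" shows "has_angle v \<alpha>"
proof -
  have "norm v = r" using arg_cong[OF assms(1), of cmod] assms(2) by (simp add: norm_mult)
  then show ?thesis unfolding has_angle_iff using assms by simp
qed

lemma has_angle_exists: "\<exists>\<alpha>. has_angle v \<alpha>"
proof -
  have "to_complex v = of_real (norm v) * cis (2 * pi * (Arg (to_complex v) / (2 * pi)))"
    using rcis_cmod_Arg[of "to_complex v"] by (simp add: rcis_def)
  then show ?thesis unfolding has_angle_iff by blast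
qed

lemma cis_2pi_eq_1_iff: "cis (2 * pi * d) = 1 \<longleftrightarrow> d \<in> \<int>"
proof -
  have "cis (2 * pi * d) = 1 \<longleftrightarrow> cos (2 * pi * d) = 1"
    by (auto simp: complex_eq_iff cos_one_sin_zero)
  also have "\<dots> \<longleftrightarrow> d \<in> \<int>"
    unfolding cos_one_2pi_int by (auto simp: Ints_def mult.commute)
  finally show ?thesis .
qed

lemma has_angle_unique:
  assumes "has_angle v \<alpha>" "has_angle v \<beta>" "v \<noteq> 0" shows "\<alpha> - \<beta> \<in> \<int>"
proof -
  have "cis (2 * pi * \<alpha>) = cis (2 * pi * \<beta>)"
    using assms unfolding has_angle_iff by (metis mult_left_cancel norm_eq_zero of_real_eq_0_iff)
  then have "cis (2 * pi * (\<alpha> - \<beta>)) = 1"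
    by (metis cis_divide divide_self_if cis_neq_zero right_diff_distrib)
  then show ?thesis by (simp add: cis_2pi_eq_1_iff)
qed

lemma has_angle_shift: assumes "has_angle v \<alpha>" "\<beta> - \<alpha> \<in> \<int>" shows "has_angle v \<beta>"
proof -
  have "cis (2 * pi * \<beta>) = cis (2 * pi * \<alpha>) * cis (2 * pi * (\<beta> - \<alpha>))"
    by (simp add: cis_mult algebra_simps)
  then show ?thesis using assms cis_2pi_eq_1_iff unfolding has_angle_iff by simp
qed

lemma omega_std_angles:
  assumes "has_angle v \<alpha>" "has_angle w \<beta>"
  shows "omega_std v w = norm v * norm w * sin (2 * pi * (\<beta> - \<alpha>))"
proof -
  have "v $ 1 = norm v * cos (2 * pi * \<alpha>)" "v $ 2 = norm v * sin (2 * pi * \<alpha>)"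
    "w $ 1 = norm w * cos (2 * pi * \<beta>)" "w $ 2 = norm w * sin (2 * pi * \<beta>)"
    using assms by (metis vector_2 vector_scaleR_component real_scaleR_def)+
  then show ?thesis
    by (simp add: omega_std_def right_diff_distrib sin_diff algebra_simps)
qed

lemma omega_std_eq_0:
  assumes "omega_std x y = 0" "x \<noteq> 0" shows "\<exists>c. y = c *\<^sub>R x"
proof -
  have n: "x \<bullet> x \<noteq> 0" using assms by simp
  have xx: "x \<bullet> x = x $ 1 * x $ 1 + x $ 2 * x $ 2" "x \<bullet> y = x $ 1 * y $ 1 + x $ 2 * y $ 2"
    by (simp_all add: inner_vec_def sum_2)
  have o: "x $ 1 * y $ 2 = x $ 2 * y $ 1" using assms by (simp add: omega_std_def)
  have "(x \<bullet> x) * y $ 1 = (x \<bullet> y) * x $ 1" "(x \<bullet> x) * y $ 2 = (x \<bullet> y) * x $ 2"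
    unfolding xx using o by algebra+
  then have "(x \<bullet> x) *\<^sub>R y = (x \<bullet> y) *\<^sub>R x" by (auto simp: vec_eq_iff forall_2)
  then have "y = ((x \<bullet> y) / (x \<bullet> x)) *\<^sub>R x" using n
    by (metis divide_inverse_commute scaleR_scaleR scaleR_one left_inverse)
  then show ?thesis by blast
qed

lemma sin_half_turn: "sin (2 * pi * (1/2)) = 0"
  by simp

lemma continuous_trapped:
  fixes d :: "real \<Rightarrow> real"
  assumes "continuous_on {0..T} d" "T \<ge> 0" "\<And>t. t \<in> {0..T} \<Longrightarrow> d t \<noteq> a \<and> d t \<noteq> b" "a < d 0" "d 0 < b"
  shows "a < d T \<and> d T < b"
proof (rule ccontr)
  assume "\<not> (a < d T \<and> d T < b)"
  then consider "d T \<le> a" | "b \<le> d T" by linarith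
  then show False
  proof cases
    case 1
    then obtain t where "0 \<le> t" "t \<le> T" "d t = a" using IVT2'[of d T a 0] assms by auto
    then show False using assms(3)[of t] by simp
  next
    case 2
    then obtain t where "0 \<le> t" "t \<le> T" "d t = b" using IVT'[of d 0 b T] assms by auto
    then show False using assms(3)[of t] by simp
  qed
qed

definition angle_lift :: "(real \<Rightarrow> real^2) \<Rightarrow> real \<Rightarrow> (real \<Rightarrow> real) \<Rightarrow> bool" where
  "angle_lift P T \<theta> \<longleftrightarrow> continuous_on {0..T} \<theta> \<and> (\<forall>t\<in>{0..T}. has_angle (P t) (\<theta> t))"

lemma angle_lift_unique:
  assumes "angle_lift P T \<theta>" "angle_lift P T \<theta>'" "T \<ge> 0" "\<And>t. t \<in> {0..T} \<Longrightarrow> P t \<noteq> 0"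
  shows "\<theta> T - \<theta> 0 = \<theta>' T - \<theta>' 0"
proof -
  define d where "d t = \<theta> t - \<theta>' t" for t
  have int: "d t \<in> \<int>" if "t \<in> {0..T}" for t
    using assms that unfolding d_def angle_lift_def by (intro has_angle_unique[of "P t"]) blast+
  have "d 0 - 1/2 < d T \<and> d T < d 0 + 1/2"
  proof (rule continuous_trapped[of T d])
    show "continuous_on {0..T} d"
      using assms unfolding angle_lift_def d_def by (intro continuous_intros) auto
    fix t assume "t \<in> {0..T}"
    then have "d t - d 0 \<in> \<int>" using int assms(3) by (intro Ints_diff) auto
    then obtain k :: int where k: "d t - d 0 = of_int k" by (auto elim: Ints_cases)
    show "d t \<noteq> d 0 - 1/2 \<and> d t \<noteq> d 0 + 1/2"
    proof (intro conjI notI)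
      assume "d t = d 0 - 1/2" then have "real_of_int (2 * k + 1) = 0" using k by simp
      then show False by presburger
    next
      assume "d t = d 0 + 1/2" then have "real_of_int (2 * k - 1) = 0" using k by simp
      then show False by presburger
    qed
  qed (use assms in auto)
  moreover have "d T - d 0 \<in> \<int>" using int assms(3) by (intro Ints_diff) auto
  then obtain k :: int where k: "d T - d 0 = of_int k" by (auto elim: Ints_cases)
  ultimately have "k = 0" by linarith
  then show ?thesis using k by (simp add: d_def)
qed

lemma rho_eq:
  assumes "angle_lift (\<lambda>t. A t *v v) T \<theta>" "T \<ge> 0" "\<And>t. t \<in> {0..T} \<Longrightarrow> A t *v v \<noteq> 0"
  shows "rho A T v = \<theta> T - \<theta> 0"
  unfolding rho_def
proof (rule the_equality)
  show "\<exists>\<theta>'. continuous_on {0..T} \<theta>' \<and> (\<forall>t\<in>{0..T}. has_angle (A t *v v) (\<theta>' t)) \<and> \<theta> T - \<theta> 0 = \<theta>' T - \<theta>' 0"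
    using assms(1) unfolding angle_lift_def by blast
next
  fix r assume "\<exists>\<theta>'. continuous_on {0..T} \<theta>' \<and> (\<forall>t\<in>{0..T}. has_angle (A t *v v) (\<theta>' t)) \<and> r = \<theta>' T - \<theta>' 0"
  then obtain \<theta>' where "angle_lift (\<lambda>t. A t *v v) T \<theta>'" "r = \<theta>' T - \<theta>' 0" unfolding angle_lift_def by blast
  then show "r = \<theta> T - \<theta> 0" using angle_lift_unique[OF _ assms(1,2,3)] by simp
qed

lemma angle_lift_exists:
  assumes "continuous_on {0..T} P" "T \<ge> 0" "\<And>t. t \<in> {0..T} \<Longrightarrow> P t \<noteq> 0" "has_angle (P 0) \<alpha>"
  shows "\<exists>\<theta>. angle_lift P T \<theta> \<and> \<theta> 0 = \<alpha>"
proof -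
  have "continuous_on {0..T} (\<lambda>t. to_complex (P t))" using assms by (intro continuous_intros)
  moreover have "contractible {0..T}" by (intro convex_imp_contractible) auto
  moreover have "to_complex (P t) \<noteq> 0" if "t \<in> {0..T}" for t
    using assms(3)[OF that] norm_to_complex[of "P t"] by fastforce
  ultimately obtain g where g: "continuous_on {0..T} g" "\<And>t. t \<in> {0..T} \<Longrightarrow> to_complex (P t) = exp (g t)"
    using continuous_logarithm_on_contractible by metis
  define \<theta>1 where "\<theta>1 t = Im (g t) / (2 * pi)" for t
  have a1: "has_angle (P t) (\<theta>1 t)" if "t \<in> {0..T}" for t
    by (rule has_angleI[of _ "exp (Re (g t))"])
       (use g(2)[OF that] in \<open>auto simp: \<theta>1_def exp_eq_polar\<close>)
  define \<theta> where "\<theta> t = \<theta>1 t + (\<alpha> - \<theta>1 0)" for t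
  have "\<alpha> - \<theta>1 0 \<in> \<int>" using assms a1[of 0] by (intro has_angle_unique[of "P 0"]) auto
  then have "has_angle (P t) (\<theta> t)" if "t \<in> {0..T}" for t
    by (intro has_angle_shift[OF a1[OF that]]) (simp add: \<theta>_def)
  moreover have "continuous_on {0..T} \<theta>"
    unfolding \<theta>_def \<theta>1_def using g(1) by (intro continuous_intros) auto
  ultimately show ?thesis unfolding angle_lift_def by (auto intro!: exI[of _ \<theta>] simp: \<theta>_def)
qed

text \<open>Injectivity keeps independent vectors independent along the path. This is what prevents their angles
  from drifting apart.\<close>

locale matrix_path =
  fixes A :: "real \<Rightarrow> real^2^2" and T :: real
  assumes T: "T \<ge> 0" and cont: "continuous_on {0..T} (\<lambda>t. A t *v v)"
    and start: "A 0 *v v = v" and inj: "t \<in> {0..T} \<Longrightarrow> v \<noteq> 0 \<Longrightarrow> A t *v v \<noteq> 0"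
begin

lemma lift_from:
  assumes "v \<noteq> 0" "has_angle v \<alpha>"
  obtains \<theta> where "angle_lift (\<lambda>t. A t *v v) T \<theta>" "\<theta> 0 = \<alpha>" "\<theta> T = \<alpha> + rho A T v"
proof -
  obtain \<theta> where \<theta>: "angle_lift (\<lambda>t. A t *v v) T \<theta>" "\<theta> 0 = \<alpha>"
    using angle_lift_exists[OF cont T inj[OF _ assms(1)], of \<alpha>] assms(2) start by auto
  then show ?thesis using rho_eq[OF \<theta>(1) T inj[OF _ assms(1)]] that[of \<theta>] by simp
qed

lemma angle_step:
  assumes "v \<noteq> 0" "has_angle v \<alpha>" shows "has_angle (A T *v v) (\<alpha> + rho A T v)"
proof -
  obtain \<theta> where "angle_lift (\<lambda>t. A t *v v) T \<theta>" "\<theta> T = \<alpha> + rho A T v" using lift_from[OF assms] .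
  then show ?thesis using T unfolding angle_lift_def by (metis atLeastAtMost_iff order_refl)
qed

lemma independence_preserved:
  assumes "omega_std v w \<noteq> 0" "t \<in> {0..T}" shows "omega_std (A t *v v) (A t *v w) \<noteq> 0"
proof
  assume 0: "omega_std (A t *v v) (A t *v w) = 0"
  have "v \<noteq> 0" using assms by (auto simp: omega_std_def)
  then obtain c where "A t *v w = c *\<^sub>R (A t *v v)" using omega_std_eq_0[OF 0 inj] assms by blast
  then have "A t *v (w - c *\<^sub>R v) = 0"
    by (simp add: matrix_vector_mult_diff_distrib matrix_vector_mult_scaleR)
  then have "w = c *\<^sub>R v" using inj[OF assms(2), of "w - c *\<^sub>R v"] by auto
  then show False using assms by (simp add: omega_std_def)
qed

text \<open>The angle from \<open>A t v\<close> to \<open>A t w\<close> never equals \<open>0\<close> or half a turn, as the two vectors stay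
  independent. So by continuity it remains in the interval in which it starts.\<close>

lemma angle_gap_step:
  assumes "v \<noteq> 0" "w \<noteq> 0" "has_angle v \<alpha>" "has_angle w \<beta>" "0 < \<beta> - \<alpha>" "\<beta> - \<alpha> < 1/2"
  shows "0 < (\<beta> + rho A T w) - (\<alpha> + rho A T v) \<and> (\<beta> + rho A T w) - (\<alpha> + rho A T v) < 1/2"
proof -
  obtain \<theta>v where v: "angle_lift (\<lambda>t. A t *v v) T \<theta>v" "\<theta>v 0 = \<alpha>" "\<theta>v T = \<alpha> + rho A T v"
    using lift_from[OF assms(1,3)] .
  obtain \<theta>w where w: "angle_lift (\<lambda>t. A t *v w) T \<theta>w" "\<theta>w 0 = \<beta>" "\<theta>w T = \<beta> + rho A T w"
    using lift_from[OF assms(2,4)] .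
  have "sin (2 * pi * (\<beta> - \<alpha>)) > 0" using assms by (intro sin_gt_zero) auto
  then have indep: "omega_std v w \<noteq> 0" using omega_std_angles[OF assms(3,4)] assms by simp
  have "0 < \<theta>w T - \<theta>v T \<and> \<theta>w T - \<theta>v T < 1/2"
  proof (rule continuous_trapped[of T "\<lambda>t. \<theta>w t - \<theta>v t"])
    show "continuous_on {0..T} (\<lambda>t. \<theta>w t - \<theta>v t)"
      using v w unfolding angle_lift_def by (intro continuous_intros) auto
    fix t assume t: "t \<in> {0..T}"
    have "omega_std (A t *v v) (A t *v w)
        = norm (A t *v v) * norm (A t *v w) * sin (2 * pi * (\<theta>w t - \<theta>v t))"
      using v w t unfolding angle_lift_def by (intro omega_std_angles) blast+
    then have "sin (2 * pi * (\<theta>w t - \<theta>v t)) \<noteq> 0" using independence_preserved[OF indep t] by auto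
    then show "\<theta>w t - \<theta>v t \<noteq> 0 \<and> \<theta>w t - \<theta>v t \<noteq> 1/2" 
      by (metis mult_zero_right sin_zero sin_half_turn)
  qed (use v w T assms in auto)
  then show ?thesis using v w by simp
qed

definition iter :: "nat \<Rightarrow> real^2 \<Rightarrow> real^2" where
  "iter n v = ((\<lambda>w. A T *v w) ^^ n) v"

definition turns :: "nat \<Rightarrow> real^2 \<Rightarrow> real" where
  "turns n v = (\<Sum>k=1..n. rho A T (iter (k - 1) v))"

lemma iter_0 [simp]: "iter 0 v = v" and iter_Suc: "iter (Suc n) v = A T *v iter n v"
  by (simp_all add: iter_def)

lemma iter_add: "iter (m + n) v = iter m (iter n v)"
  by (simp add: iter_def funpow_add)

lemma turns_0 [simp]: "turns 0 v = 0" and turns_Suc: "turns (Suc n) v = turns n v + rho A T (iter n v)"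
  by (simp_all add: turns_def)

lemma iter_nonzero: "v \<noteq> 0 \<Longrightarrow> iter n v \<noteq> 0"
  using T inj[of T] by (induction n) (auto simp: iter_Suc)

lemma turns_add: "turns (n + m) v = turns n v + turns m (iter n v)"
proof (induction m)
  case (Suc m)
  have "iter (n + m) v = iter m (iter n v)" using iter_add[of m n v] by (simp add: add.commute)
  then show ?case using Suc by (simp add: turns_Suc)
qed simp

lemma angle_iter: "v \<noteq> 0 \<Longrightarrow> has_angle v \<alpha> \<Longrightarrow> has_angle (iter n v) (\<alpha> + turns n v)"
proof (induction n)
  case (Suc n)
  then show ?case using angle_step[OF iter_nonzero[OF Suc.prems(1)] Suc.IH[OF Suc.prems]]
    by (simp only: iter_Suc turns_Suc add.assoc)
qed simp

lemma angle_gap_iter: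
  assumes "v \<noteq> 0" "w \<noteq> 0" "has_angle v \<alpha>" "has_angle w \<beta>" "0 < \<beta> - \<alpha>" "\<beta> - \<alpha> < 1/2"
  shows "0 < (\<beta> + turns n w) - (\<alpha> + turns n v) \<and> (\<beta> + turns n w) - (\<alpha> + turns n v) < 1/2"
proof (induction n)
  case (Suc n)
  show ?case
    using angle_gap_step[OF iter_nonzero[OF assms(1)] iter_nonzero[OF assms(2)]
        angle_iter[OF assms(1,3)] angle_iter[OF assms(2,4)], of n n] Suc
    by (simp add: turns_Suc add.assoc)
qed (use assms in simp)

lemma turns_close_independent:
  assumes "omega_std v w \<noteq> 0" shows "\<bar>turns n v - turns n w\<bar> \<le> 1/2"
proof -
  have nz: "v \<noteq> 0" "w \<noteq> 0" using assms by (auto simp: omega_std_def)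
  obtain \<alpha> where \<alpha>: "has_angle v \<alpha>" using has_angle_exists by blast
  obtain \<beta>0 where \<beta>0: "has_angle w \<beta>0" using has_angle_exists by blast
  define \<beta> where "\<beta> = \<beta>0 - of_int \<lfloor>\<beta>0 - \<alpha>\<rfloor>"
  have \<beta>: "has_angle w \<beta>" by (rule has_angle_shift[OF \<beta>0]) (simp add: \<beta>_def)
  have "sin (2 * pi * (\<beta> - \<alpha>)) \<noteq> 0" using omega_std_angles[OF \<alpha> \<beta>] assms by auto
  then have "\<beta> - \<alpha> \<noteq> 0" "\<beta> - \<alpha> \<noteq> 1/2" by (metis mult_zero_right sin_zero, metis sin_half_turn)
  moreover have "0 \<le> \<beta> - \<alpha>" "\<beta> - \<alpha> < 1" unfolding \<beta>_def by linarith+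
  ultimately consider "0 < \<beta> - \<alpha>" "\<beta> - \<alpha> < 1/2" | "0 < (\<alpha> + 1) - \<beta>" "(\<alpha> + 1) - \<beta> < 1/2" by linarith
  then show ?thesis
  proof cases
    case 1
    then show ?thesis using angle_gap_iter[OF nz \<alpha> \<beta> 1, of n] by linarith
  next
    case 2
    have "has_angle v (\<alpha> + 1)" by (rule has_angle_shift[OF \<alpha>]) simp
    then show ?thesis using angle_gap_iter[OF nz(2,1) \<beta> _ 2, of n] 2 by linarith
  qed
qed

text \<open>If \<open>v\<close> and \<open>w\<close> are parallel, both are compared with a vector perpendicular to them.\<close>

lemma turns_close:
  assumes "v \<noteq> 0" "w \<noteq> 0" shows "\<bar>turns n v - turns n w\<bar> \<le> 1"
proof (cases "omega_std v w = 0")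
  case True
  then obtain c where c: "w = c *\<^sub>R v" using omega_std_eq_0 assms by blast
  define u :: "real^2" where "u = vector [- (v $ 2), v $ 1]"
  have "omega_std v u = v \<bullet> v" by (simp add: u_def omega_std_def inner_vec_def sum_2)
  then have 1: "omega_std v u \<noteq> 0" using assms by simp
  have "omega_std w u = c * omega_std v u" by (simp add: c omega_std_def algebra_simps)
  then have 2: "omega_std w u \<noteq> 0" using 1 c assms by auto
  show ?thesis using turns_close_independent[OF 1, of n] turns_close_independent[OF 2, of n] by linarith
next
  case False
  then show ?thesis using turns_close_independent[of v w n] by linarith
qed

lemma turns_mult:
  assumes "v \<noteq> 0" shows "\<bar>turns (k * n) v - real k * turns n v\<bar> \<le> real k"
proof (induction k)
  case (Suc k)
  have "turns (Suc k * n) v = turns n v + turns (k * n) (iter n v)" by (simp add: turns_add)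
  moreover have "\<bar>turns (k * n) (iter n v) - turns (k * n) v\<bar> \<le> 1"
    by (rule turns_close[OF iter_nonzero[OF assms] assms])
  ultimately show ?case using Suc by (simp add: algebra_simps)
qed simp

lemma turns_average_close:
  assumes "v \<noteq> 0" "m > 0" "n > 0"
  shows "\<bar>turns n v / n - turns m v / m\<bar> \<le> 1 / n + 1 / m"
proof -
  have "\<bar>real m * turns n v - real n * turns m v\<bar> \<le> real m + real n"
    using turns_mult[OF assms(1), of m n] turns_mult[OF assms(1), of n m] by (simp add: mult.commute)
  then have "\<bar>real m * turns n v - real n * turns m v\<bar> / (real n * real m) \<le> (real m + real n) / (real n * real m)"
    by (rule divide_right_mono) simp
  moreover have "(real m + real n) / (real n * real m) = 1 / n + 1 / m"
    "\<bar>real m * turns n v - real n * turns m v\<bar> / (real n * real m) = \<bar>turns n v / n - turns m v / m\<bar>"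
  proof -
    show "(real m + real n) / (real n * real m) = 1 / n + 1 / m" using assms by (simp add: add_divide_distrib)
    have "turns n v / n - turns m v / m = (real m * turns n v - real n * turns m v) / (real n * real m)"
      using assms by (simp add: diff_divide_distrib)
    then show "\<bar>real m * turns n v - real n * turns m v\<bar> / (real n * real m) = \<bar>turns n v / n - turns m v / m\<bar>"
      by (simp add: abs_mult)
  qed
  ultimately show ?thesis by simp
qed

text \<open>Changing the starting vector changes \<open>turns n\<close> by at most one, so \<open>turns\<close> is additive in \<open>n\<close> up to
  errors of at most one. Hence the averages form a Cauchy sequence with rate \<open>1 / n + 1 / m\<close>, their
  limit \<open>rot\<close> is the same for all starting vectors, and the very first average is within one of it.\<close>

theorem rot_close_to_rho:
  assumes v: "v \<noteq> 0" shows "\<bar>rot A T - rho A T v\<bar> \<le> 1"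
proof -
  let ?X = "\<lambda>v n. turns n v / real n"
  have "Cauchy (?X v)"
  proof (rule metric_CauchyI)
    fix e :: real assume e: "e > 0"
    obtain M :: nat where M: "M > 0" "1 / real M < e / 2"
      using ex_inverse_of_nat_less[of "e / 2"] e by (auto simp: inverse_eq_divide)
    show "\<exists>M. \<forall>m\<ge>M. \<forall>n\<ge>M. dist (?X v m) (?X v n) < e"
    proof (intro exI[of _ M] allI impI)
      fix m n assume mn: "M \<le> m" "M \<le> n"
      have "1 / real m \<le> 1 / real M" "1 / real n \<le> 1 / real M"
        using mn M(1) by (auto intro!: divide_left_mono)
      moreover have "m > 0" "n > 0" using mn M(1) by auto
      ultimately show "dist (?X v m) (?X v n) < e"
        using turns_average_close[OF v, of n m] M(2) by (simp add: dist_real_def)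
    qed
  qed
  then obtain L where L: "?X v \<longlonglongrightarrow> L" by (auto simp: Cauchy_convergent_iff convergent_def)
  have all: "?X w \<longlonglongrightarrow> L" if "w \<noteq> 0" for w
  proof -
    have "(\<lambda>n. ?X w n - ?X v n) \<longlonglongrightarrow> 0"
    proof (rule Lim_null_comparison)
      show "\<forall>\<^sub>F n in sequentially. norm (?X w n - ?X v n) \<le> 1 / real n"
        using turns_close[OF that v]
        by (intro always_eventually allI) (simp add: diff_divide_distrib[symmetric] divide_right_mono)
      show "(\<lambda>n. 1 / real n) \<longlonglongrightarrow> 0" by (rule lim_1_over_n)
    qed
    from tendsto_add[OF this L] show ?thesis by simp
  qed
  have "rot A T = L"
    unfolding rot_def
  proof (rule the_equality)
    show "\<forall>v. v \<noteq> 0 \<longrightarrow> (\<lambda>n. 1 / real n * (\<Sum>k = 1..n. rho A T (((*v) (A T) ^^ (k - 1)) v))) \<longlonglongrightarrow> L"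
      using all by (simp add: turns_def iter_def)
  next
    fix r assume "\<forall>v. v \<noteq> 0 \<longrightarrow> (\<lambda>n. 1 / real n * (\<Sum>k = 1..n. rho A T (((*v) (A T) ^^ (k - 1)) v))) \<longlonglongrightarrow> r"
    then have "?X v \<longlonglongrightarrow> r" using v by (simp add: turns_def iter_def)
    then show "r = L" using L LIMSEQ_unique by blast
  qed
  moreover have "\<bar>L - ?X v 1\<bar> \<le> 1 + 0"
  proof (rule tendsto_le[OF trivial_limit_sequentially])
    show "(\<lambda>n. \<bar>?X v n - ?X v 1\<bar>) \<longlonglongrightarrow> \<bar>L - ?X v 1\<bar>" by (intro tendsto_intros L)
    show "(\<lambda>n. 1 + 1 / real n) \<longlonglongrightarrow> 1 + 0" by (intro tendsto_intros lim_1_over_n)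
    show "\<forall>\<^sub>F n in sequentially. \<bar>?X v n - ?X v 1\<bar> \<le> 1 + 1 / real n"
      using eventually_gt_at_top[of 0]
    proof eventually_elim
      case (elim n)
      then show ?case using turns_average_close[OF v, of 1 n] by simp
    qed
  qed
  moreover have "?X v 1 = rho A T v" by (simp add: turns_def)
  ultimately show ?thesis by simp
qed

end

section \<open>The contact measure as a cone measure\<close>

type_synonym c2 = "complex \<times> complex"

text \<open>The standard complex structure; \<open>J u \<bullet> v\<close> is the standard symplectic form.\<close>

definition J :: "c2 \<Rightarrow> c2" where
  "J p = (\<i> * fst p, \<i> * snd p)"

lemma inner_J: "J p \<bullet> v = (Re (fst p) * Im (fst v) - Im (fst p) * Re (fst v))
    + (Re (snd p) * Im (snd v) - Im (snd p) * Re (snd v))"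
  by (simp add: J_def inner_prod_def inner_complex_def)

lemma liouville_form_eq: "liouville_form p v = (J p \<bullet> v) / 2"
  by (cases p; cases v) (simp add: liouville_form_def inner_J)

lemma J_add: "J (u + v) = J u + J v"
  by (simp add: J_def algebra_simps)

lemma J_scaleR: "J (r *\<^sub>R u) = r *\<^sub>R J u"
  by (simp add: J_def)

lemma J_J [simp]: "J (J u) = - u"
  by (simp add: J_def prod_eq_iff complex_eq_iff)

lemma J_inner_self [simp]: "J u \<bullet> u = 0"
  by (simp add: inner_J)

lemma J_inner_J [simp]: "J u \<bullet> J v = u \<bullet> v"
  by (simp add: J_def inner_prod_def inner_complex_def)

lemma J_antisym: "J u \<bullet> v = - (J v \<bullet> u)"
  by (simp add: inner_J)

lemma bounded_linear_J: "bounded_linear J"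
  by (rule linear_conv_bounded_linear[THEN iffD1], rule linearI) (simp_all add: J_add J_scaleR)

lemma ext_deriv_liouville: "ext_deriv liouville_form p u v = J u \<bullet> v"
proof -
  have d: "((\<lambda>q. liouville_form q w) has_derivative (\<lambda>h. (J h \<bullet> w) / 2)) (at p)" for w
  proof -
    have "(J has_derivative J) (at p)"
      by (rule bounded_linear.has_derivative[OF bounded_linear_J has_derivative_ident])
    then show ?thesis unfolding liouville_form_eq by (auto intro!: derivative_eq_intros)
  qed
  then show ?thesis unfolding ext_deriv_def
    using J_antisym[of v u] by (simp add: frechet_derivative_eqI[OF d])
qed

text \<open>Change of variables is carried out in \<open>\<real>\<^sup>4\<close>, with points split into the three parameters of a chart and
  a radial parameter. The isomorphisms \<open>of_real4\<close> and \<open>split4\<close> map standard bases to standard bases, hence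
  preserve Lebesgue measure.\<close>

definition to_real4 :: "c2 \<Rightarrow> real^4" where
  "to_real4 p = vector [Re (fst p), Im (fst p), Re (snd p), Im (snd p)]"

definition of_real4 :: "real^4 \<Rightarrow> c2" where
  "of_real4 u = (Complex (u $ 1) (u $ 2), Complex (u $ 3) (u $ 4))"

lemma vector_4 [simp]:
  "(vector [a, b, c, d] :: 'a::zero^4) $ 1 = a" "(vector [a, b, c, d] :: 'a^4) $ 2 = b"
  "(vector [a, b, c, d] :: 'a^4) $ 3 = c" "(vector [a, b, c, d] :: 'a^4) $ 4 = d"
  by (simp_all add: vector_def)

lemma to_real4_nth: "to_real4 p $ 1 = Re (fst p)" "to_real4 p $ 2 = Im (fst p)" "to_real4 p $ 3 = Re (snd p)" "to_real4 p $ 4 = Im (snd p)"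
  by (simp_all add: to_real4_def)

lemma of_real4_to_real4 [simp]: "of_real4 (to_real4 p) = p"
  by (simp add: of_real4_def to_real4_nth prod_eq_iff complex_eq_iff)

lemma to_real4_of_real4 [simp]: "to_real4 (of_real4 u) = u"
  by (simp add: of_real4_def to_real4_nth vec_eq_iff forall_4)

lemma linear_to_real4: "linear to_real4"
  by (intro linearI) (simp_all add: vec_eq_iff forall_4 to_real4_nth)

lemma linear_of_real4: "linear of_real4"
  by (intro linearI) (simp_all add: of_real4_def complex_eq_iff)

lemma Basis_real4: "(Basis :: (real^4) set) = {axis 1 1, axis 2 1, axis 3 1, axis 4 1}"
  by (auto simp: Basis_vec_def UNIV_4)

lemma lborel_distr_basis_bij:
  fixes f :: "'a::euclidean_space \<Rightarrow> 'b::euclidean_space"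
  assumes lin: "linear f" and bij: "bij_betw f Basis Basis"
  shows "distr lborel borel f = lborel"
proof (rule lborel_eqI[symmetric])
  interpret linear f by fact
  have inj: "inj_on f Basis" and im: "f ` Basis = Basis" using bij by (auto simp: bij_betw_def)
  have fb: "f x \<bullet> f b = x \<bullet> b" if b: "b \<in> Basis" for x b
  proof -
    have "f x \<bullet> f b = f (\<Sum>a\<in>Basis. (x \<bullet> a) *\<^sub>R a) \<bullet> f b" by (simp add: euclidean_representation)
    also have "\<dots> = (\<Sum>a\<in>Basis. (x \<bullet> a) * (f a \<bullet> f b))" by (simp add: sum scale inner_sum_left)
    also have "\<dots> = (\<Sum>a\<in>Basis. if a = b then x \<bullet> a else 0)"
    proof (rule sum.cong)
      fix a :: 'a assume a: "a \<in> Basis"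
      have "f a \<in> Basis" "f b \<in> Basis" using im a b by auto
      then show "(x \<bullet> a) * (f a \<bullet> f b) = (if a = b then x \<bullet> a else 0)"
        using inj a b by (auto simp: inner_Basis inj_on_def)
    qed simp
    finally show ?thesis using b by simp
  qed
  show "sets (distr lborel borel f) = sets borel" by simp
  fix l u :: 'b assume lu: "\<And>b. b \<in> Basis \<Longrightarrow> l \<bullet> b \<le> u \<bullet> b"
  have meas: "f \<in> borel_measurable borel"
    by (rule borel_measurable_continuous_onI) (rule linear_continuous_on[OF lin[unfolded linear_conv_bounded_linear]])
  define l' u' where "l' = (\<Sum>a\<in>Basis. (l \<bullet> f a) *\<^sub>R a)" and "u' = (\<Sum>a\<in>Basis. (u \<bullet> f a) *\<^sub>R a)"
  have l': "l' \<bullet> a = l \<bullet> f a" and u': "u' \<bullet> a = u \<bullet> f a" if "a \<in> Basis" for a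
    using that by (simp_all add: l'_def u'_def)
  have "f -` box l u = box l' u'"
  proof -
    have "f x \<in> box l u \<longleftrightarrow> x \<in> box l' u'" for x
    proof -
      have "f x \<in> box l u \<longleftrightarrow> (\<forall>c\<in>f ` Basis. l \<bullet> c < f x \<bullet> c \<and> f x \<bullet> c < u \<bullet> c)"
        unfolding im by (simp add: mem_box)
      also have "\<dots> \<longleftrightarrow> x \<in> box l' u'" by (simp add: mem_box l' u' fb)
      finally show ?thesis .
    qed
    then show ?thesis by auto
  qed
  then have "emeasure (distr lborel borel f) (box l u) = emeasure lborel (box l' u')"
    using meas by (simp add: emeasure_distr)
  also have "\<dots> = (\<Prod>a\<in>Basis. (u' - l') \<bullet> a)"
    using lu im by (intro emeasure_lborel_box) (auto simp: l' u')
  also have "\<dots> = (\<Prod>a\<in>Basis. (u - l) \<bullet> f a)"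
    by (simp add: l' u' inner_diff_left)
  also have "\<dots> = (\<Prod>b\<in>Basis. (u - l) \<bullet> b)"
    using prod.reindex_bij_betw[OF bij, of "\<lambda>b. (u - l) \<bullet> b"] by simp
  finally show "emeasure (distr lborel borel f) (box l u) = ennreal (\<Prod>b\<in>Basis. (u - l) \<bullet> b)" .
qed

lemma of_real4_axis: "of_real4 (axis 1 1) = (1, 0)" "of_real4 (axis 2 1) = (\<i>, 0)" "of_real4 (axis 3 1) = (0, 1)" "of_real4 (axis 4 1) = (0, \<i>)"
  by (simp_all add: of_real4_def axis_def complex_eq_iff)

lemma lborel_distr_of_real4: "distr lborel borel of_real4 = lborel"
proof (rule lborel_distr_basis_bij[OF linear_of_real4])
  have "inj of_real4" by (metis to_real4_of_real4 injI)
  moreover have "of_real4 ` Basis = Basis"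
    by (auto simp: Basis_real4 of_real4_axis Basis_prod_def Basis_complex_def)
  ultimately show "bij_betw of_real4 Basis Basis" by (auto simp: bij_betw_def intro: inj_on_subset)
qed

definition first3 :: "real^4 \<Rightarrow> real^3" where
  "first3 u = vector [u $ 1, u $ 2, u $ 3]"

definition split4 :: "real^4 \<Rightarrow> (real^3) \<times> real" where
  "split4 u = (first3 u, u $ 4)"

lemma first3_nth: "first3 u $ 1 = u $ 1" "first3 u $ 2 = u $ 2" "first3 u $ 3 = u $ 3"
  by (simp_all add: first3_def)

lemma linear_first3: "linear first3"
  by (intro linearI) (simp_all add: vec_eq_iff forall_3 first3_nth)

lemma first3_axis: "first3 (axis 1 1) = axis 1 1" "first3 (axis 2 1) = axis 2 1" "first3 (axis 3 1) = axis 3 1" "first3 (axis 4 1) = 0"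
  by (simp_all add: vec_eq_iff forall_3 first3_nth axis_def)

lemma Basis_real3: "(Basis :: (real^3) set) = {axis 1 1, axis 2 1, axis 3 1}"
  by (auto simp: Basis_vec_def UNIV_3)

lemma linear_split4: "linear split4"
  by (intro linearI) (simp_all add: split4_def linear_add[OF linear_first3] linear_scale[OF linear_first3])

lemma inj_split4: "inj split4"
  by (intro injI) (auto simp: split4_def vec_eq_iff forall_3 forall_4 first3_nth)

lemma lborel_distr_split4: "distr lborel borel split4 = lborel"
proof (rule lborel_distr_basis_bij[OF linear_split4])
  have "split4 ` Basis = Basis"
    by (auto simp: Basis_real4 Basis_real3 split4_def first3_axis Basis_prod_def axis_def[of _ 1] first3_axis[unfolded axis_def])
  then show "bij_betw split4 Basis Basis" using inj_split4 by (auto simp: bij_betw_def intro: inj_on_subset)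
qed

lemma det_4:
  "det (A::real^4^4) =
    A$1$1 * (A$2$2 * (A$3$3 * A$4$4 - A$3$4 * A$4$3) - A$2$3 * (A$3$2 * A$4$4 - A$3$4 * A$4$2) + A$2$4 * (A$3$2 * A$4$3 - A$3$3 * A$4$2))
  - A$1$2 * (A$2$1 * (A$3$3 * A$4$4 - A$3$4 * A$4$3) - A$2$3 * (A$3$1 * A$4$4 - A$3$4 * A$4$1) + A$2$4 * (A$3$1 * A$4$3 - A$3$3 * A$4$1))
  + A$1$3 * (A$2$1 * (A$3$2 * A$4$4 - A$3$4 * A$4$2) - A$2$2 * (A$3$1 * A$4$4 - A$3$4 * A$4$1) + A$2$4 * (A$3$1 * A$4$2 - A$3$2 * A$4$1))
  - A$1$4 * (A$2$1 * (A$3$2 * A$4$3 - A$3$3 * A$4$2) - A$2$2 * (A$3$1 * A$4$3 - A$3$3 * A$4$1) + A$2$3 * (A$3$1 * A$4$2 - A$3$2 * A$4$1))"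
proof -
  have f1: "finite {2::4, 3, 4}" "1 \<notin> {2::4, 3, 4}" and f2: "finite {3::4, 4}" "2 \<notin> {3::4, 4}"
    and f3: "finite {4::4}" "3 \<notin> {4::4}"
    by auto
  show ?thesis
    unfolding det_def UNIV_4
    unfolding sum_over_permutations_insert[OF f1]
    unfolding sum_over_permutations_insert[OF f2]
    unfolding sum_over_permutations_insert[OF f3]
    unfolding permutes_sing
    by (simp add: sign_swap_id permutation_swap_id permutation_compose sign_compose sign_id swap_id_eq algebra_simps)
qed

text \<open>On \<open>\<complex>\<^sup>2\<close> the square of the symplectic form is twice the volume form, and \<open>liouville_form\<close> is half the
  contraction of the symplectic form with the position vector. So the contact volume is half the
  contraction of the Euclidean volume with the position vector. The sign arises because the position
  vector is the last column.\<close>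

lemma det_contact_volume:
  fixes M :: "real^4^4"
  assumes "\<And>i. M $ i $ 1 = to_real4 (s *\<^sub>R a) $ i" "\<And>i. M $ i $ 2 = to_real4 (s *\<^sub>R b) $ i"
    "\<And>i. M $ i $ 3 = to_real4 (s *\<^sub>R c) $ i" "\<And>i. M $ i $ 4 = to_real4 p $ i"
  shows "det M = - 2 * s^3 * contact_volume liouville_form p a b c"
  unfolding det_4 assms to_real4_nth contact_volume_def ext_deriv_liouville liouville_form_eq inner_J
  by (simp add: power3_eq_cube field_simps)

lemma nn_integral_abs_det:
  fixes f :: "real^'n::{finite,wellorder} \<Rightarrow> real^'n::{finite,wellorder}"
  assumes S: "S \<in> sets lebesgue" and der: "\<And>x. x \<in> S \<Longrightarrow> (f has_derivative f' x) (at x within S)"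
    and inj: "inj_on f S" and fS: "f ` S \<in> lmeasurable"
  shows "(\<integral>\<^sup>+x\<in>S. ennreal \<bar>det (matrix (f' x))\<bar> \<partial>lborel) = emeasure lebesgue (f ` S)"
proof -
  have int: "(\<lambda>x. \<bar>det (matrix (f' x))\<bar>) integrable_on S"
    using measurable_differentiable_image_eq[OF S der inj] fS by blast
  then have "((\<lambda>x. \<bar>det (matrix (f' x))\<bar>) has_integral measure lebesgue (f ` S)) S"
    using measure_differentiable_image_eq[OF S der inj int] by (simp add: has_integral_iff)
  from nn_integral_has_integral_lebesgue'[OF _ this]
  show ?thesis using fS by (simp add: emeasure_eq_measure2)
qed

locale star_gauge_c2 = star_gauge G N for G :: "c2 \<Rightarrow> real" and N
begin

text \<open>The value at the origin is an arbitrary point of \<open>Y\<close>, so that this is a measurable map into \<open>Y\<close>.\<close>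

definition projt :: "c2 \<Rightarrow> c2" where
  "projt z = (if z = 0 then proj (1, 0) else proj z)"

definition punctured_domain :: "c2 set" where
  "punctured_domain = {z. z \<noteq> 0 \<and> G z \<le> 1}"

text \<open>Twice the Lebesgue measure of the cone over a set. The factor is \<open>4 \<cdot> 1/2\<close>: the radial
  integral of \<open>s\<^sup>3\<close> over the cone is \<open>1/4\<close>, and the contact volume is half the contraction of the
  Euclidean volume with the position vector.\<close>

definition cone_measure :: "c2 measure" where
  "cone_measure = distr (density lborel (\<lambda>z. 2 * indicator punctured_domain z)) (restrict_space borel Y) projt"

lemma measurable_G [measurable]: "G \<in> borel_measurable borel"
  by (rule borel_measurable_continuous_onI[OF cont])

lemma punctured_domain_borel [measurable]: "punctured_domain \<in> sets borel"
proof -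
  have "punctured_domain = {z \<in> space borel. z \<noteq> 0 \<and> G z \<le> 1}" by (auto simp: punctured_domain_def)
  also have "\<dots> \<in> sets borel" by measurable
  finally show ?thesis .
qed

lemma Y_borel: "Y \<in> sets borel"
  using closed_Y by (rule borel_closed)

lemma sets_Y: "A \<in> sets (restrict_space borel Y) \<longleftrightarrow> A \<in> sets borel \<and> A \<subseteq> Y"
  using sets_restrict_space_iff[of Y borel A] Y_borel by auto

lemma projt_in_Y: "projt z \<in> Y"
proof -
  have "(1, 0) \<noteq> (0 :: c2)" by (simp add: zero_prod_def)
  from proj_in_Y[OF this] show ?thesis
    using proj_in_Y[of z] unfolding projt_def by (split if_split) blast
qed

lemma measurable_projt: "projt \<in> measurable borel (restrict_space borel Y)"
proof (rule measurable_restrict_space2)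
  show "projt \<in> space borel \<rightarrow> Y" using projt_in_Y by blast
  show "projt \<in> measurable borel borel"
    unfolding projt_def by measurable
qed

lemma emeasure_cone:
  assumes A: "A \<in> sets (restrict_space borel Y)"
  shows "emeasure cone_measure A = 2 * emeasure lborel {z. z \<noteq> 0 \<and> G z \<le> 1 \<and> proj z \<in> A}"
proof -
  have m: "projt -` A \<in> sets borel"
    using measurable_sets[OF measurable_projt A] by simp
  have "emeasure cone_measure A = (\<integral>\<^sup>+z. 2 * indicator punctured_domain z * indicator (projt -` A) z \<partial>lborel)"
    unfolding cone_measure_def using A measurable_projt m
    by (subst emeasure_distr) (auto simp: emeasure_density)
  also have "\<dots> = (\<integral>\<^sup>+z. 2 * indicator (punctured_domain \<inter> projt -` A) z \<partial>lborel)"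
    by (rule nn_integral_cong) (simp split: split_indicator)
  also have "\<dots> = 2 * emeasure lborel (punctured_domain \<inter> projt -` A)"
    using m by (subst nn_integral_cmult_indicator) auto
  also have "punctured_domain \<inter> projt -` A = {z. z \<noteq> 0 \<and> G z \<le> 1 \<and> proj z \<in> A}"
    by (auto simp: punctured_domain_def projt_def)
  finally show ?thesis .
qed

lemma nn_integral_cone:
  assumes f: "f \<in> borel_measurable (restrict_space borel Y)"
  shows "(\<integral>\<^sup>+y. f y \<partial>cone_measure) = 2 * (\<integral>\<^sup>+z\<in>punctured_domain. f (proj z) \<partial>lborel)"
proof -
  have m: "(\<lambda>z. f (projt z)) \<in> borel_measurable borel"
    using measurable_compose[OF measurable_projt f] .
  have "(\<integral>\<^sup>+y. f y \<partial>cone_measure) = (\<integral>\<^sup>+z. 2 * indicator punctured_domain z * f (projt z) \<partial>lborel)"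
  proof -
    have "(indicator punctured_domain :: c2 \<Rightarrow> ennreal) \<in> borel_measurable lborel"
      by (rule borel_measurable_indicator) simp
    then show ?thesis
      unfolding cone_measure_def using measurable_projt f m
      by (subst nn_integral_distr) (auto simp: nn_integral_density)
  qed
  also have "\<dots> = (\<integral>\<^sup>+z. 2 * (f (projt z) * indicator punctured_domain z) \<partial>lborel)"
    by (rule nn_integral_cong) (simp add: mult_ac)
  also have "\<dots> = 2 * (\<integral>\<^sup>+z. f (projt z) * indicator punctured_domain z \<partial>lborel)"
    using m borel_measurable_indicator[of punctured_domain lborel]
    by (intro nn_integral_cmult borel_measurable_times) auto
  also have "(\<integral>\<^sup>+z. f (projt z) * indicator punctured_domain z \<partial>lborel) = (\<integral>\<^sup>+z\<in>punctured_domain. f (proj z) \<partial>lborel)"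
    by (rule nn_integral_cong) (auto simp: projt_def punctured_domain_def split: split_indicator)
  finally show ?thesis .
qed

lemma sets_cone_measure: "sets cone_measure = sets (restrict_space borel Y)"
  by (simp add: cone_measure_def)

lemma parametrization_image_borel:
  assumes par: "parametrization Y U \<psi>" and B: "B \<in> sets borel" "B \<subseteq> U"
  shows "\<psi> ` B \<in> sets (restrict_space borel Y)"
proof -
  obtain g where g: "homeomorphism U (\<psi> ` U) \<psi> g" and op: "openin (top_of_set Y) (\<psi> ` U)"
    using par unfolding parametrization_def by blast
  obtain W where W: "open W" "\<psi> ` U = Y \<inter> W" using op by (auto simp: openin_open)
  have UY: "\<psi> ` U \<in> sets borel" using W Y_borel by auto
  have "g -` B \<inter> \<psi> ` U \<in> sets (restrict_space borel (\<psi> ` U))"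
    using measurable_sets[OF borel_measurable_continuous_on_restrict B(1), of "\<psi> ` U" g] g
    by (simp add: homeomorphism_def space_restrict_space)
  moreover have "\<psi> ` B = g -` B \<inter> \<psi> ` U"
    using g B(2) by (auto simp: homeomorphism_def subset_iff image_iff)
  ultimately have "\<psi> ` B \<in> sets borel"
    using sets_restrict_space_iff[of "\<psi> ` U" borel] UY by auto
  then show ?thesis using W B(2) by (auto simp: sets_Y)
qed

abbreviation "chart_density \<psi> x \<equiv> \<bar>contact_volume liouville_form (\<psi> x)
             (frechet_derivative \<psi> (at x) (axis 1 1))
             (frechet_derivative \<psi> (at x) (axis 2 1))
             (frechet_derivative \<psi> (at x) (axis 3 1))\<bar>"

text \<open>Change of variables along \<open>(x, s) \<mapsto> s \<psi>(x)\<close>, which parametrizes the cone over \<open>\<psi> ` B\<close>. Its Jacobian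
  determinant has absolute value \<open>2 s\<^sup>3\<close> times the contact density of the chart at \<open>x\<close>.\<close>

lemma cone_measure_parametrization:
  assumes par: "parametrization Y U \<psi>" and B: "B \<in> sets borel" "B \<subseteq> U"
  shows "emeasure cone_measure (\<psi> ` B) = (\<integral>\<^sup>+x\<in>B. ennreal (chart_density \<psi> x) \<partial>lborel)"
proof -
  have U: "open U" and C1: "Ck_on 1 U \<psi>" and op: "openin (top_of_set Y) (\<psi> ` U)"
    using par unfolding parametrization_def by auto
  have inj: "inj_on \<psi> U" using par unfolding parametrization_def homeomorphism_def by (metis inj_on_inverseI)
  have UY: "\<psi> x \<in> Y" if "x \<in> U" for x using openin_imp_subset[OF op] that by blast
  have der: "(\<psi> has_derivative frechet_derivative \<psi> (at x)) (at x)" if "x \<in> U" for x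
    using C1 that by (simp add: frechet_derivative_works)
  have c\<psi>: "continuous_on U \<psi>" using Ck_on_SucD[of 0 U \<psi>] C1 by simp
  have cd: "continuous_on U (\<lambda>x. frechet_derivative \<psi> (at x) v)" for v using C1 by simp
  have B': "\<psi> ` B \<in> sets (restrict_space borel Y)" by (rule parametrization_image_borel[OF par B])
  define K where "K = {z. z \<noteq> 0 \<and> G z \<le> 1 \<and> proj z \<in> \<psi> ` B}"
  have Keq: "K = punctured_domain \<inter> projt -` (\<psi> ` B)" by (auto simp: K_def punctured_domain_def projt_def)
  have Kb: "K \<in> sets borel"
    unfolding Keq using measurable_sets[OF measurable_projt B'] by simp
  (* the cone map, with the radial parameter s stored as the fourth coordinate *)
  define f where "f u = to_real4 (u $ 4 *\<^sub>R \<psi> (first3 u))" for u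
  define f' where "f' u h = to_real4 (u $ 4 *\<^sub>R frechet_derivative \<psi> (at (first3 u)) (first3 h) + h $ 4 *\<^sub>R \<psi> (first3 u))" for u h
  define S where "S = split4 -` (B \<times> {0<..1})"
  have mP3: "split4 \<in> borel_measurable borel"
    by (rule borel_measurable_continuous_onI) (rule linear_continuous_on[OF linear_split4[unfolded linear_conv_bounded_linear]])
  have mD4: "of_real4 \<in> borel_measurable borel"
    by (rule borel_measurable_continuous_onI) (rule linear_continuous_on[OF linear_of_real4[unfolded linear_conv_bounded_linear]])
  have BI: "B \<times> {0<..1::real} \<in> sets borel"
    using B(1) by (subst borel_prod[symmetric]) (intro pair_measureI; simp)
  have Sb: "S \<in> sets borel" unfolding S_def using measurable_sets[OF mP3 BI] by simp
  have Sin: "first3 u \<in> U" "first3 u \<in> B" "0 < u $ 4" "u $ 4 \<le> 1" if "u \<in> S" for u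
    using that B(2) by (auto simp: S_def split4_def)
  have fS: "f ` S = to_real4 ` K"
  proof
    show "f ` S \<subseteq> to_real4 ` K"
    proof
      fix w assume "w \<in> f ` S"
      then obtain u where u: "u \<in> S" "w = to_real4 (u $ 4 *\<^sub>R \<psi> (first3 u))" by (auto simp: f_def)
      have g: "G (u $ 4 *\<^sub>R \<psi> (first3 u)) = u $ 4"
        using homog[of "u $ 4" "\<psi> (first3 u)"] UY[OF Sin(1)[OF u(1)]] Sin(3)[OF u(1)] by simp
      have "u $ 4 *\<^sub>R \<psi> (first3 u) \<noteq> 0" using g Sin(3)[OF u(1)] G_0 by force
      then have "u $ 4 *\<^sub>R \<psi> (first3 u) \<in> K" using g Sin[OF u(1)] by (auto simp: K_def)
      then show "w \<in> to_real4 ` K" using u by blast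
    qed
    show "to_real4 ` K \<subseteq> f ` S"
    proof
      fix w assume "w \<in> to_real4 ` K"
      then obtain z where z: "z \<in> K" "w = to_real4 z" by blast
      then obtain x where x: "x \<in> B" "proj z = \<psi> x" by (auto simp: K_def)
      define u :: "real^4" where "u = vector [x $ 1, x $ 2, x $ 3, G z]"
      have Xu: "first3 u = x" by (simp add: u_def vec_eq_iff forall_3 first3_nth)
      have u4: "u $ 4 = G z" by (simp add: u_def)
      have gz: "0 < G z" "G z \<le> 1" using z(1) pos[of z] by (auto simp: K_def)
      have "u \<in> S" using x gz by (simp add: S_def split4_def Xu u4)
      moreover have "f u = w" using gz by (simp add: f_def Xu u4 x(2)[symmetric] z(2))
      ultimately show "w \<in> f ` S" by blast
    qed
  qed
  have E4K: "to_real4 ` K = of_real4 -` K" by (auto simp: image_iff) (metis to_real4_of_real4)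
  have E4Kb: "to_real4 ` K \<in> sets borel" unfolding E4K using measurable_sets[OF mD4 Kb] by simp
  have eK: "emeasure lebesgue (to_real4 ` K) = emeasure lborel K"
  proof -
    have "emeasure lborel K = emeasure (distr lborel borel of_real4) K" by (simp add: lborel_distr_of_real4)
    also have "\<dots> = emeasure lborel (to_real4 ` K)" using mD4 Kb by (simp add: emeasure_distr E4K)
    finally show ?thesis using E4Kb by (simp add: emeasure_completion)
  qed
  have "K \<subseteq> {z. G z \<le> 1}" by (auto simp: K_def)
  then have "emeasure lborel K < \<infinity>"
    using compact_imp_bounded[OF compact_sublevel] bounded_subset emeasure_bounded_finite by blast
  then have lm: "f ` S \<in> lmeasurable"
    unfolding fS using E4Kb eK by (auto simp: fmeasurable_def)
  have S_leb: "S \<in> sets lebesgue" using Sb by simp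
  have derf: "(f has_derivative f' u) (at u within S)" if u: "u \<in> S" for u
  proof -
    have X: "(first3 has_derivative first3) (at u within S)"
      by (rule bounded_linear.has_derivative[OF linear_first3[unfolded linear_conv_bounded_linear] has_derivative_ident])
    have 1: "((\<lambda>u. \<psi> (first3 u)) has_derivative (\<lambda>h. frechet_derivative \<psi> (at (first3 u)) (first3 h))) (at u within S)"
      by (rule has_derivative_compose[OF X der[OF Sin(1)[OF u]]])
    have 2: "((\<lambda>u::real^4. u $ 4) has_derivative (\<lambda>h. h $ 4)) (at u within S)"
      by (rule bounded_linear.has_derivative[OF bounded_linear_vec_nth has_derivative_ident])
    show ?thesis unfolding f_def f'_def
      by (rule bounded_linear.has_derivative[OF linear_to_real4[unfolded linear_conv_bounded_linear] has_derivative_scaleR[OF 2 1]])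
  qed
  have injf: "inj_on f S"
  proof (rule inj_onI)
    fix u v assume uv: "u \<in> S" "v \<in> S" "f u = f v"
    then have e: "u $ 4 *\<^sub>R \<psi> (first3 u) = v $ 4 *\<^sub>R \<psi> (first3 v)" unfolding f_def by (metis of_real4_to_real4)
    have g: "G (u $ 4 *\<^sub>R \<psi> (first3 u)) = u $ 4" if "u \<in> S" for u
      using homog[of "u $ 4" "\<psi> (first3 u)"] UY[OF Sin(1)[OF that]] Sin(3)[OF that] by simp
    have 4: "u $ 4 = v $ 4" using g[OF uv(1)] g[OF uv(2)] e by simp
    then have "\<psi> (first3 u) = \<psi> (first3 v)" using e Sin(3)[OF uv(2)] by simp
    then have "first3 u = first3 v" using inj Sin(1) uv by (auto dest: inj_onD)
    then have "split4 u = split4 v" using 4 by (simp add: split4_def)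
    then show "u = v" using inj_split4 by (simp add: inj_eq)
  qed
  have det: "\<bar>det (matrix (f' u))\<bar> = 2 * (u $ 4)^3 * chart_density \<psi> (first3 u)" if u: "u \<in> S" for u
  proof -
    have 0: "frechet_derivative \<psi> (at (first3 u)) 0 = 0"
      using der[OF Sin(1)[OF u]] by (metis has_derivative_linear linear_0)
    have "det (matrix (f' u)) = - 2 * (u $ 4)^3 * contact_volume liouville_form (\<psi> (first3 u))
        (frechet_derivative \<psi> (at (first3 u)) (axis 1 1)) (frechet_derivative \<psi> (at (first3 u)) (axis 2 1))
        (frechet_derivative \<psi> (at (first3 u)) (axis 3 1))"
      by (rule det_contact_volume) (simp_all add: matrix_def f'_def first3_axis 0, simp_all add: axis_def)
    then show ?thesis using Sin(3)[OF u] by (simp add: abs_mult)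
  qed
  define F where "F x = ennreal (chart_density \<psi> x) * indicator B x" for x
  have mF: "F \<in> borel_measurable borel"
  proof -
    have ic: "continuous_on U (\<lambda>x. J (f x) \<bullet> g x)" if "continuous_on U f" "continuous_on U g" for f g :: "real^3 \<Rightarrow> c2"
      using that bounded_linear.continuous_on[OF bounded_linear_J that(1)] by (intro continuous_intros)
    have "continuous_on U (\<lambda>x. chart_density \<psi> x)"
      unfolding contact_volume_def liouville_form_eq ext_deriv_liouville
      by (intro continuous_intros ic c\<psi> cd) auto
    then have "(\<lambda>x. indicator U x *\<^sub>R chart_density \<psi> x) \<in> borel_measurable borel"
      using U by (intro borel_measurable_continuous_on_indicator) auto
    then have "(\<lambda>x. ennreal (indicator U x *\<^sub>R chart_density \<psi> x) * indicator B x) \<in> borel_measurable borel"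
      using B(1) by measurable
    also have "(\<lambda>x. ennreal (indicator U x *\<^sub>R chart_density \<psi> x) * indicator B x) = F"
      using B(2) by (auto simp: F_def fun_eq_iff split: split_indicator)
    finally show ?thesis .
  qed
  (* the radial integral; with the factor 2 of cone_measure it gives 1 *)
  have cube: "(\<integral>\<^sup>+s. ennreal (2 * s^3) * indicator {0<..1} s \<partial>lborel) = ennreal (1/2)"
  proof -
    have "((\<lambda>s::real. 2 * s^3) has_integral (1^4 / 2 - 0^4 / 2)) {0..1}"
      by (rule fundamental_theorem_of_calculus)
         (auto intro!: derivative_eq_intros simp: has_real_derivative_iff_has_vector_derivative[symmetric])
    then have "(\<integral>\<^sup>+s. ennreal (2 * s^3) * indicator {0..1} s \<partial>lborel) = ennreal (1^4/2 - 0^4 / 2)"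
      by (intro nn_integral_has_integral_lebesgue') auto
    moreover have "(\<integral>\<^sup>+s. ennreal (2 * s^3) * indicator {0..1} s \<partial>lborel) = (\<integral>\<^sup>+s. ennreal (2 * s^3) * indicator {0<..1} s \<partial>lborel)"
      by (rule nn_integral_cong) (auto split: split_indicator)
    ultimately show ?thesis by simp
  qed
  have "emeasure lborel K = (\<integral>\<^sup>+u\<in>S. ennreal \<bar>det (matrix (f' u))\<bar> \<partial>lborel)"
    using nn_integral_abs_det[OF S_leb derf injf lm] by (simp add: fS eK)
  also have "\<dots> = (\<integral>\<^sup>+u. F (fst (split4 u)) * (ennreal (2 * (snd (split4 u))^3) * indicator {0<..1} (snd (split4 u))) \<partial>lborel)"
  proof (rule nn_integral_cong)
    fix u :: "real^4"
    show "ennreal \<bar>det (matrix (f' u))\<bar> * indicator S u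
        = F (fst (split4 u)) * (ennreal (2 * (snd (split4 u))^3) * indicator {0<..1} (snd (split4 u)))"
    proof (cases "u \<in> S")
      case True
      then show ?thesis using Sin[OF True]
        by (simp add: det[OF True] F_def split4_def ennreal_mult[symmetric] mult_ac)
    next
      case False
      then show ?thesis by (auto simp: S_def split4_def F_def split: split_indicator)
    qed
  qed
  also have "\<dots> = (\<integral>\<^sup>+q. F (fst q) * (ennreal (2 * (snd q)^3) * indicator {0<..1} (snd q)) \<partial>(distr lborel borel split4))"
    using mP3 mF by (subst nn_integral_distr) (auto simp: borel_prod[symmetric])
  also have "\<dots> = (\<integral>\<^sup>+q. F (fst q) * (ennreal (2 * (snd q)^3) * indicator {0<..1} (snd q)) \<partial>(lborel \<Otimes>\<^sub>M lborel))"
    by (simp add: lborel_distr_split4 lborel_prod)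
  also have "\<dots> = (\<integral>\<^sup>+x. (\<integral>\<^sup>+s. F x * (ennreal (2 * s^3) * indicator {0<..1} s) \<partial>lborel) \<partial>lborel)"
    using mF by (subst lborel.nn_integral_fst[symmetric]) auto
  also have "\<dots> = (\<integral>\<^sup>+x. F x * ennreal (1/2) \<partial>lborel)"
    by (subst nn_integral_cmult) (auto simp: cube)
  also have "\<dots> = (\<integral>\<^sup>+x. F x \<partial>lborel) * ennreal (1/2)"
    using mF by (intro nn_integral_multc) auto
  finally have "emeasure lborel K = (\<integral>\<^sup>+x. F x \<partial>lborel) * ennreal (1/2)" .
  then have "emeasure cone_measure (\<psi> ` B) = (\<integral>\<^sup>+x. F x \<partial>lborel) * (2 * ennreal (1/2))"
    using emeasure_cone[OF B'] by (simp add: K_def mult_ac)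
  also have "2 * ennreal (1/2) = 1"
  proof -
    have "2 * ennreal (1/2) = ennreal 2 * ennreal (1/2)" by simp
    also have "\<dots> = ennreal (2 * (1/2))" by (rule ennreal_mult[symmetric]) auto
    finally show ?thesis by simp
  qed
  finally show ?thesis by (simp add: F_def)
qed

end

text \<open>\<open>L\<close> parametrizes the hyperplane orthogonal to the unit vector \<open>b\<close>, and \<open>K\<close> reads off the parameters of
  the orthogonal projection of a point to it.\<close>

definition hyperplane_coords :: "c2 \<Rightarrow> (real^3 \<Rightarrow> c2) \<Rightarrow> (c2 \<Rightarrow> real^3) \<Rightarrow> bool" where
  "hyperplane_coords b L K \<longleftrightarrow> linear L \<and> linear K \<and> (\<forall>x. K (L x) = x) \<and> (\<forall>x. L x \<bullet> b = 0) \<and>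
     (\<forall>q. q = (q \<bullet> b) *\<^sub>R b + L (K q)) \<and> b \<bullet> b = 1"

lemma hyperplane_coords_exists:
  assumes "b \<in> Basis" shows "\<exists>L K. hyperplane_coords b L K"
proof -
  have *: "\<exists>L K. hyperplane_coords (1, 0) L K"
    by (rule exI[of _ "\<lambda>x. (Complex 0 (x $ 1), Complex (x $ 2) (x $ 3))"],
        rule exI[of _ "\<lambda>p. vector [Im (fst p), Re (snd p), Im (snd p)]"])
       (simp add: hyperplane_coords_def linear_iff complex_eq_iff vec_eq_iff forall_3 inner_prod_def
         inner_complex_def prod_eq_iff)
  moreover have "\<exists>L K. hyperplane_coords (\<i>, 0) L K"
    by (rule exI[of _ "\<lambda>x. (Complex (x $ 1) 0, Complex (x $ 2) (x $ 3))"],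
        rule exI[of _ "\<lambda>p. vector [Re (fst p), Re (snd p), Im (snd p)]"])
       (simp add: hyperplane_coords_def linear_iff complex_eq_iff vec_eq_iff forall_3 inner_prod_def
         inner_complex_def prod_eq_iff)
  moreover have "\<exists>L K. hyperplane_coords (0, 1) L K"
    by (rule exI[of _ "\<lambda>x. (Complex (x $ 1) (x $ 2), Complex 0 (x $ 3))"],
        rule exI[of _ "\<lambda>p. vector [Re (fst p), Im (fst p), Im (snd p)]"])
       (simp add: hyperplane_coords_def linear_iff complex_eq_iff vec_eq_iff forall_3 inner_prod_def
         inner_complex_def prod_eq_iff)
  moreover have "\<exists>L K. hyperplane_coords (0, \<i>) L K"
    by (rule exI[of _ "\<lambda>x. (Complex (x $ 1) (x $ 2), Complex (x $ 3) 0)"],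
        rule exI[of _ "\<lambda>p. vector [Re (fst p), Im (fst p), Re (snd p)]"])
       (simp add: hyperplane_coords_def linear_iff complex_eq_iff vec_eq_iff forall_3 inner_prod_def
         inner_complex_def prod_eq_iff)
  ultimately show ?thesis using assms by (auto simp: Basis_prod_def Basis_complex_def)
qed

context star_gauge_c2
begin

text \<open>The part of \<open>Y\<close> on one side of a coordinate hyperplane is the radial projection of a parallel affine
  hyperplane. Continuity of \<open>N\<close> makes this chart continuously differentiable.\<close>

lemma graph_chart:
  assumes hc: "hyperplane_coords b L K" and \<sigma>: "\<sigma> = 1 \<or> \<sigma> = -1"
  shows "\<exists>\<psi>. parametrization Y UNIV \<psi> \<and> range \<psi> = {q\<in>Y. \<sigma> * (q \<bullet> b) > 0}"
proof -
  have lin: "linear L" "linear K" and KL: "\<And>x. K (L x) = x" and Lb: "\<And>x. L x \<bullet> b = 0"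
    and dec: "\<And>q. q = (q \<bullet> b) *\<^sub>R b + L (K q)" and bb: "b \<bullet> b = 1"
    using hc unfolding hyperplane_coords_def by blast+
  interpret L: linear L by fact
  interpret K: linear K by fact
  have ss: "\<sigma> * \<sigma> = 1" using \<sigma> by auto
  have Kb: "K b = 0"
  proof -
    have "L (K b) = 0" using dec[of b] bb by simp
    then show ?thesis using KL[of "K b"] by (simp add: K.zero)
  qed
  define q where "q x = \<sigma> *\<^sub>R b + L x" for x
  have qb: "q x \<bullet> b = \<sigma>" for x by (simp add: q_def inner_add_left Lb bb)
  have q0: "q x \<noteq> 0" for x using qb[of x] \<sigma> by auto
  have Gq: "G (q x) > 0" for x using pos[OF q0] .
  have Kq: "K (q x) = x" for x by (simp add: q_def K.add K.scale Kb KL)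
  define \<psi> where "\<psi> x = proj (q x)" for x
  define V where "V = {q\<in>Y. \<sigma> * (q \<bullet> b) > 0}"
  define g where "g p = (1 / (\<sigma> * (p \<bullet> b))) *\<^sub>R K p" for p
  have \<psi>b: "\<sigma> * (\<psi> x \<bullet> b) = 1 / G (q x)" for x by (simp add: \<psi>_def qb ss)
  have \<psi>V: "\<psi> x \<in> V" for x using proj_in_Y[OF q0] \<psi>b[of x] Gq[of x] by (simp add: V_def \<psi>_def)
  have g\<psi>: "g (\<psi> x) = x" for x
    unfolding g_def \<psi>b using Gq[of x] by (simp add: \<psi>_def K.scale Kq)
  have \<psi>g: "\<psi> (g p) = p" if p: "p \<in> V" for p
  proof -
    define m where "m = \<sigma> * (p \<bullet> b)"
    have m: "m > 0" "G p = 1" using p by (auto simp: V_def m_def)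
    have "q (g p) = (1 / m) *\<^sub>R ((\<sigma> * m) *\<^sub>R b + L (K p))"
      using m by (simp add: q_def g_def L.scale m_def[symmetric] scaleR_right_distrib)
    also have "\<sigma> * m = p \<bullet> b" using ss by (simp add: m_def mult.assoc[symmetric])
    also have "(p \<bullet> b) *\<^sub>R b + L (K p) = p" using dec[of p] by simp
    finally have "q (g p) = (1 / m) *\<^sub>R p" .
    then show ?thesis using homog[of "1 / m" p] m by (simp add: \<psi>_def)
  qed
  have range: "range \<psi> = V"
  proof
    show "V \<subseteq> range \<psi>" using \<psi>g by (metis rangeI subsetI)
  qed (use \<psi>V in auto)
  define D where "D x h = (1 / G (q x)) *\<^sub>R L h - ((N (q x) \<bullet> L h) / (G (q x))\<^sup>2) *\<^sub>R q x" for x h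
  have derq: "(q has_derivative L) (at x)" for x
    using bounded_linear.has_derivative[OF lin(1)[unfolded linear_conv_bounded_linear] has_derivative_ident]
    unfolding q_def by (auto intro!: derivative_eq_intros)
  have der: "(\<psi> has_derivative D x) (at x)" for x
  proof -
    have 1: "((\<lambda>x. G (q x)) has_derivative (\<lambda>h. N (q x) \<bullet> L h)) (at x)"
      by (rule has_derivative_compose[OF derq deriv[OF q0]])
    have "((\<lambda>x. inverse (G (q x))) has_derivative
        (\<lambda>h. - (inverse (G (q x)) * (N (q x) \<bullet> L h) * inverse (G (q x))))) (at x)"
      by (rule Deriv.has_derivative_inverse[OF _ 1]) (use Gq[of x] in auto)
    from has_derivative_scaleR[OF this derq]
    show ?thesis
      unfolding \<psi>_def D_def by (simp add: divide_inverse power2_eq_square algebra_simps)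
  qed
  have fd: "frechet_derivative \<psi> (at x) = D x" for x using frechet_derivative_eqI[OF der] .
  have cq: "continuous_on UNIV q"
    using derq by (intro differentiable_imp_continuous_on) (auto simp: differentiable_on_def differentiable_def)
  have cG: "continuous_on UNIV (\<lambda>x. G (q x))"
    by (rule continuous_on_compose2[OF cont cq]) auto
  have cN: "continuous_on UNIV (\<lambda>x. N (q x))"
    by (rule continuous_on_compose2[OF continuous_on_N cq]) (use q0 in auto)
  have Gn: "G (q x) \<noteq> 0" for x using Gq[of x] by simp
  have "Ck_on (Suc 0) UNIV \<psi>"
    by (rule Ck_on_SucI[OF open_UNIV der]) (auto simp: D_def Gn intro!: continuous_intros cG cN cq)
  moreover have "inj (D x)" for x
  proof (rule linear_injective_0[THEN iffD2])
    show "linear (D x)" using has_derivative_linear[OF der] .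
    show "\<forall>h. D x h = 0 \<longrightarrow> h = 0"
    proof (intro allI impI)
      fix h assume h: "D x h = 0"
      have "D x h \<bullet> b = - ((N (q x) \<bullet> L h) / (G (q x))\<^sup>2) * \<sigma>" by (simp add: D_def inner_diff_left Lb qb)
      then have "N (q x) \<bullet> L h = 0" using h Gn \<sigma> by auto
      then have "L h = 0" using h Gn[of x] by (simp add: D_def)
      then show "h = 0" using KL[of h] by (simp add: K.zero)
    qed
  qed
  moreover have "openin (top_of_set Y) V"
  proof -
    have "open {q. \<sigma> * (q \<bullet> b) > 0}" by (intro open_Collect_less continuous_intros)
    then have "openin (top_of_set Y) (Y \<inter> {q. \<sigma> * (q \<bullet> b) > 0})" by (rule openin_open_Int)
    moreover have "V = Y \<inter> {q. \<sigma> * (q \<bullet> b) > 0}" by (auto simp: V_def)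
    ultimately show ?thesis by simp
  qed
  moreover have "homeomorphism UNIV V \<psi> g"
  proof (rule homeomorphismI)
    show "continuous_on UNIV \<psi>" unfolding \<psi>_def using Gn by (auto intro!: continuous_intros cG cq)
    have "continuous_on V K" using linear_continuous_on[OF lin(2)[unfolded linear_conv_bounded_linear]] .
    moreover have "\<sigma> * (p \<bullet> b) \<noteq> 0" if "p \<in> V" for p using that by (auto simp: V_def)
    ultimately show "continuous_on V g" unfolding g_def by (intro continuous_intros) auto
    show "\<psi> ` UNIV \<subseteq> V" using range by simp
  qed (use g\<psi> \<psi>g in auto)
  ultimately have "parametrization Y UNIV \<psi>"
    unfolding parametrization_def using range by (auto simp: fd)
  then show ?thesis using range by (auto simp: V_def)
qed

lemma chart_cover:
  obtains \<V> where "finite \<V>" "Y \<subseteq> \<Union>\<V>"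
    "\<And>V. V \<in> \<V> \<Longrightarrow> V \<in> sets (restrict_space borel Y) \<and> (\<exists>\<psi>. parametrization Y UNIV \<psi> \<and> range \<psi> = V)"
proof
  let ?V = "\<lambda>(b, \<sigma>). {q\<in>Y. \<sigma> * (q \<bullet> b) > 0}"
  let ?I = "(Basis :: c2 set) \<times> {1, -1 :: real}"
  show "finite (?V ` ?I)" by simp
  show "Y \<subseteq> \<Union>(?V ` ?I)"
  proof
    fix q assume q: "q \<in> Y"
    then obtain b where b: "b \<in> Basis" "q \<bullet> b \<noteq> 0" using Y_nonzero[OF q] euclidean_all_zero_iff[of q] by blast
    then have "q \<in> ?V (b, sgn (q \<bullet> b))" using q by (auto simp: sgn_mult_abs abs_sgn_eq sgn_if)
    moreover have "(b, sgn (q \<bullet> b)) \<in> ?I" using b by (auto simp: sgn_if)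
    ultimately show "q \<in> \<Union>(?V ` ?I)" by blast
  qed
  fix V assume "V \<in> ?V ` ?I"
  then obtain b \<sigma> where b: "b \<in> Basis" "\<sigma> = 1 \<or> \<sigma> = -1" "V = {q\<in>Y. \<sigma> * (q \<bullet> b) > 0}" by auto
  obtain L K where "hyperplane_coords b L K" using hyperplane_coords_exists[OF b(1)] by blast
  from graph_chart[OF this b(2)] obtain \<psi> where \<psi>: "parametrization Y UNIV \<psi>" "range \<psi> = V" using b(3) by auto
  then have "V \<in> sets (restrict_space borel Y)"
    using parametrization_image_borel[OF \<psi>(1), of UNIV] by simp
  then show "V \<in> sets (restrict_space borel Y) \<and> (\<exists>\<psi>. parametrization Y UNIV \<psi> \<and> range \<psi> = V)" using \<psi> by blast
qed

text \<open>Uniqueness holds because the prescription determines a measure on each chart domain and finitely many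
  charts cover \<open>Y\<close>.\<close>

theorem contact_measure_eq_cone_measure: "contact_measure Y liouville_form = cone_measure"
  unfolding contact_measure_def
proof (rule the_equality)
  show "sets cone_measure = sets (restrict_space borel Y) \<and>
     (\<forall>U \<psi>. parametrization Y U \<psi> \<longrightarrow> (\<forall>B\<in>sets borel. B \<subseteq> U \<longrightarrow>
         emeasure cone_measure (\<psi> ` B) = (\<integral>\<^sup>+x\<in>B. ennreal (chart_density \<psi> x) \<partial>lborel)))"
    using sets_cone_measure cone_measure_parametrization by blast
next
  fix \<mu> assume \<mu>: "sets \<mu> = sets (restrict_space borel Y) \<and>
     (\<forall>U \<psi>. parametrization Y U \<psi> \<longrightarrow> (\<forall>B\<in>sets borel. B \<subseteq> U \<longrightarrow>
         emeasure \<mu> (\<psi> ` B) = (\<integral>\<^sup>+x\<in>B. ennreal (chart_density \<psi> x) \<partial>lborel)))"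
  have chart_eq: "emeasure \<mu> A = emeasure cone_measure A"
    if \<psi>: "parametrization Y UNIV \<psi>" and A: "A \<in> sets (restrict_space borel Y)" "A \<subseteq> range \<psi>" for \<psi> A
  proof -
    have "continuous_on UNIV \<psi>" using \<psi> Ck_on_SucD[of 0 UNIV \<psi>] by (simp add: parametrization_def)
    then have "\<psi> \<in> borel_measurable borel" by (rule borel_measurable_continuous_onI)
    then have B: "\<psi> -` A \<in> sets borel" using measurable_sets[of \<psi> borel borel A] A(1) by (simp add: sets_Y)
    have im: "\<psi> ` (\<psi> -` A) = A" using A(2) by auto
    have "emeasure \<mu> (\<psi> ` (\<psi> -` A)) = (\<integral>\<^sup>+x\<in>\<psi> -` A. ennreal (chart_density \<psi> x) \<partial>lborel)"
      using conjunct2[OF \<mu>, rule_format, OF \<psi> B] by simp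
    also have "\<dots> = emeasure cone_measure (\<psi> ` (\<psi> -` A))"
      using cone_measure_parametrization[OF \<psi> B] by simp
    finally show ?thesis unfolding im .
  qed
  obtain \<V> where \<V>: "finite \<V>" "Y \<subseteq> \<Union>\<V>"
    "\<And>V. V \<in> \<V> \<Longrightarrow> V \<in> sets (restrict_space borel Y) \<and> (\<exists>\<psi>. parametrization Y UNIV \<psi> \<and> range \<psi> = V)"
    by (metis chart_cover)
  have ind: "\<forall>A\<in>sets (restrict_space borel Y). A \<subseteq> \<Union>\<W> \<longrightarrow> emeasure \<mu> A = emeasure cone_measure A"
    if "finite \<W>" "\<W> \<subseteq> \<V>" for \<W>
    using that
  proof (induction \<W> rule: finite_induct)
    case (insert V \<W>)
    show ?case
    proof (intro ballI impI)
      fix A assume A: "A \<in> sets (restrict_space borel Y)" "A \<subseteq> \<Union>(insert V \<W>)"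
      have V: "V \<in> sets (restrict_space borel Y)" using \<V>(3) insert.prems by blast
      obtain \<psi> where \<psi>: "parametrization Y UNIV \<psi>" "range \<psi> = V" using \<V>(3) insert.prems by blast
      have s: "A \<inter> V \<in> sets (restrict_space borel Y)" "A - V \<in> sets (restrict_space borel Y)" using A V by auto
      have 1: "emeasure \<mu> (A \<inter> V) = emeasure cone_measure (A \<inter> V)"
        by (rule chart_eq[OF \<psi>(1) s(1)]) (use \<psi>(2) in auto)
      have 2: "emeasure \<mu> (A - V) = emeasure cone_measure (A - V)"
        using insert.IH insert.prems s(2) A(2) by auto
      have split: "(A \<inter> V) \<union> (A - V) = A" and disj: "(A \<inter> V) \<inter> (A - V) = {}" by auto
      have "emeasure \<mu> A = emeasure \<mu> (A \<inter> V) + emeasure \<mu> (A - V)"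
        using s \<mu> plus_emeasure[OF _ _ disj, of \<mu>] by (simp add: split)
      also have "\<dots> = emeasure cone_measure (A \<inter> V) + emeasure cone_measure (A - V)" using 1 2 by simp
      also have "\<dots> = emeasure cone_measure A"
        using s sets_cone_measure plus_emeasure[OF _ _ disj, of cone_measure] by (simp add: split)
      finally show "emeasure \<mu> A = emeasure cone_measure A" .
    qed
  qed auto
  show "\<mu> = cone_measure"
  proof (rule measure_eqI)
    show "sets \<mu> = sets cone_measure" using \<mu> sets_cone_measure by simp
    fix A assume "A \<in> sets \<mu>"
    then have "A \<in> sets (restrict_space borel Y)" using \<mu> by simp
    moreover have "A \<subseteq> \<Union>\<V>" using calculation \<V>(2) by (auto simp: sets_Y)
    ultimately show "emeasure \<mu> A = emeasure cone_measure A" using ind[OF \<V>(1) order_refl] by blast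
  qed
qed

end

section \<open>The contact structure of a star-shaped hypersurface\<close>

text \<open>Multiplication by a second quaternion unit: \<open>n\<close>, \<open>J n\<close>, \<open>K n\<close>, \<open>J (K n)\<close> are orthogonal and of the
  same length.\<close>

definition K :: "c2 \<Rightarrow> c2" where
  "K n = (- cnj (snd n), cnj (fst n))"

lemma bounded_linear_K: "bounded_linear K"
  by (rule linear_conv_bounded_linear[THEN iffD1], rule linearI) (simp_all add: K_def algebra_simps complex_eq_iff)

lemma quaternion_orthogonal [simp]:
  "K n \<bullet> n = 0" "J (K n) \<bullet> n = 0" "K n \<bullet> J n = 0" "J (K n) \<bullet> J n = 0" "J (K n) \<bullet> K n = 0" "K n \<bullet> K n = n \<bullet> n"
  by (simp_all add: J_def K_def inner_prod_def inner_complex_def algebra_simps)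

lemma quaternion_expansion:
  "(n \<bullet> n) *\<^sub>R v = (v \<bullet> n) *\<^sub>R n + (v \<bullet> J n) *\<^sub>R J n + (v \<bullet> K n) *\<^sub>R K n + (v \<bullet> J (K n)) *\<^sub>R J (K n)"
  by (simp add: J_def K_def inner_prod_def inner_complex_def prod_eq_iff complex_eq_iff) (intro conjI; algebra)

context star_gauge_c2
begin

abbreviation "\<xi> \<equiv> contact_plane Y liouville_form"

lemma contact_plane_eq: "y \<in> Y \<Longrightarrow> \<xi> y = {v. N y \<bullet> v = 0 \<and> J y \<bullet> v = 0}"
  by (auto simp: contact_plane_def tangent_space_Y liouville_form_eq)

lemma N_inner_Y: "y \<in> Y \<Longrightarrow> N y \<bullet> y = 1"
  using euler[of y] Y_nonzero[of y] by simp

lemma N_norm_pos: "y \<in> Y \<Longrightarrow> N y \<bullet> N y > 0"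
  using N_nonzero[OF Y_nonzero[of y]] by simp

lemma reeb_field_eq:
  assumes y: "y \<in> Y" shows "reeb_field Y liouville_form y = 2 *\<^sub>R J (N y)"
  unfolding reeb_field_def
proof (rule the_equality)
  have "N y \<bullet> J (N y) = 0" by (metis J_inner_self inner_commute)
  moreover have "J y \<bullet> J (N y) = 1" using N_inner_Y[OF y] by (simp add: inner_commute)
  ultimately show "2 *\<^sub>R J (N y) \<in> tangent_space Y y \<and> liouville_form y (2 *\<^sub>R J (N y)) = 1 \<and>
     (\<forall>w\<in>tangent_space Y y. ext_deriv liouville_form y (2 *\<^sub>R J (N y)) w = 0)"
    using y by (simp add: tangent_space_Y liouville_form_eq ext_deriv_liouville J_scaleR)
next
  fix v assume v: "v \<in> tangent_space Y y \<and> liouville_form y v = 1 \<and>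
     (\<forall>w\<in>tangent_space Y y. ext_deriv liouville_form y v w = 0)"
  have NN: "N y \<bullet> N y \<noteq> 0" using N_norm_pos[OF y] by simp
  define c where "c = (J v \<bullet> N y) / (N y \<bullet> N y)"
  define w where "w = J v - c *\<^sub>R N y"
  have Nw: "N y \<bullet> w = 0" using NN by (simp add: w_def c_def inner_diff_right inner_commute)
  have "\<forall>w\<in>tangent_space Y y. J v \<bullet> w = 0" using v unfolding ext_deriv_liouville by blast
  moreover have "w \<in> tangent_space Y y" using Nw by (simp only: tangent_space_Y[OF y] mem_Collect_eq)
  ultimately have "J v \<bullet> w = 0" by (rule bspec)
  then have "w \<bullet> w = 0" using Nw by (simp add: w_def inner_diff_left)
  then have "J v = c *\<^sub>R N y" by (simp add: w_def)
  then have "J (J v) = c *\<^sub>R J (N y)" by (simp add: J_scaleR)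
  then have vc: "v = (- c) *\<^sub>R J (N y)" by (simp add: minus_equation_iff[of v])
  have "J y \<bullet> v = 2" using v by (simp add: liouville_form_eq)
  then have "- c = 2" using N_inner_Y[OF y] by (simp add: vc inner_commute)
  then show "v = 2 *\<^sub>R J (N y)" using vc by simp
qed

definition K_span :: "c2 \<Rightarrow> complex \<Rightarrow> c2" where
  "K_span n w = Re w *\<^sub>R K n + Im w *\<^sub>R J (K n)"

text \<open>Vectors in the span of \<open>K (N y)\<close> and \<open>J (K (N y))\<close> are tangent to \<open>Y\<close>. Subtracting a multiple of the
  Reeb direction makes the contact form vanish on them as well.\<close>

definition frame :: "c2 \<Rightarrow> complex \<Rightarrow> c2" where
  "frame y w = K_span (N y) w - (J y \<bullet> K_span (N y) w) *\<^sub>R J (N y)"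

lemma frame_in_plane: assumes y: "y \<in> Y" shows "frame y w \<in> \<xi> y"
proof -
  have "N y \<bullet> J (N y) = 0" "N y \<bullet> K (N y) = 0" "N y \<bullet> J (K (N y)) = 0"
    by (metis J_inner_self inner_commute, metis quaternion_orthogonal(1) inner_commute,
        metis quaternion_orthogonal(2) inner_commute)
  moreover have "J y \<bullet> J (N y) = 1" using N_inner_Y[OF y] by (simp add: inner_commute)
  ultimately show ?thesis
    using y by (simp add: contact_plane_eq frame_def K_span_def inner_diff_right inner_add_right)
qed

lemma frame_add: "frame y (v + w) = frame y v + frame y w"
  by (simp add: frame_def K_span_def algebra_simps inner_add_right)

lemma frame_scaleR: "frame y (of_real r * w) = r *\<^sub>R frame y w"
  by (simp add: frame_def K_span_def algebra_simps inner_add_right)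

lemma frame_omega: "J (frame y v) \<bullet> frame y w = (N y \<bullet> N y) * (Re v * Im w - Im v * Re w)"
proof -
  let ?n = "N y"
  have o: "J ?n \<bullet> K ?n = 0" "J ?n \<bullet> J (K ?n) = 0" "?n \<bullet> K ?n = 0" "?n \<bullet> J (K ?n) = 0" "?n \<bullet> J ?n = 0"
    "K ?n \<bullet> J (K ?n) = 0"
    using quaternion_orthogonal[of ?n] J_inner_self[of ?n] by (simp_all add: inner_commute)
  have J1: "J (K_span ?n v) = Re v *\<^sub>R J (K ?n) - Im v *\<^sub>R K ?n" by (simp add: K_span_def J_add J_scaleR)
  have J2: "J (frame y v) = J (K_span ?n v) + (J y \<bullet> K_span ?n v) *\<^sub>R ?n"
    using linear_diff[OF bounded_linear.linear[OF bounded_linear_J]] by (simp add: frame_def J_scaleR)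
  show ?thesis
    unfolding J2 J1 unfolding frame_def K_span_def
    by (simp add: inner_add_left inner_add_right inner_diff_left inner_diff_right o algebra_simps)
qed

lemma frame_coords:
  assumes y: "y \<in> Y" and v: "v \<in> \<xi> y"
  shows "v = frame y (Complex ((v \<bullet> K (N y)) / (N y \<bullet> N y)) ((v \<bullet> J (K (N y))) / (N y \<bullet> N y)))"
proof -
  let ?n = "N y"
  have NN: "?n \<bullet> ?n \<noteq> 0" using N_norm_pos[OF y] by simp
  define w where "w = Complex ((v \<bullet> K ?n) / (?n \<bullet> ?n)) ((v \<bullet> J (K ?n)) / (?n \<bullet> ?n))"
  define r where "r = (v \<bullet> J ?n) / (?n \<bullet> ?n)"
  have vn: "v \<bullet> ?n = 0" "J y \<bullet> v = 0" using v y by (simp_all add: contact_plane_eq inner_commute)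
  have "v = (1 / (?n \<bullet> ?n)) *\<^sub>R ((?n \<bullet> ?n) *\<^sub>R v)" using NN by simp
  also have "\<dots> = r *\<^sub>R J ?n + K_span ?n w"
    unfolding quaternion_expansion[of ?n v] by (simp add: vn r_def K_span_def w_def algebra_simps)
  finally have vr: "v = r *\<^sub>R J ?n + K_span ?n w" .
  have "J y \<bullet> J ?n = 1" using N_inner_Y[OF y] by (simp add: inner_commute)
  then have "r + J y \<bullet> K_span ?n w = 0" using vn(2) by (subst (asm) vr) (simp add: inner_add_right)
  then have "r = - (J y \<bullet> K_span ?n w)" by simp
  then show ?thesis unfolding w_def[symmetric] frame_def using vr by simp
qed

text \<open>By \<open>frame_omega\<close>, the frame scales areas by \<open>N y \<bullet> N y\<close>. Undoing this in the second coordinate alone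
  keeps the frame a rational expression in \<open>y\<close> and \<open>N y\<close>, for which smoothness is easy.\<close>

definition sframe :: "c2 \<Rightarrow> real^2 \<Rightarrow> c2" where
  "sframe y w = frame y (Complex (w $ 1) (w $ 2 / (N y \<bullet> N y)))"

definition triv :: "c2 \<Rightarrow> c2 \<Rightarrow> real^2" where
  "triv y = inv_into UNIV (sframe y)"

lemma sframe_add: "sframe y (v + w) = sframe y v + sframe y w"
  by (simp add: sframe_def frame_add[symmetric] add_divide_distrib complex_add)

lemma sframe_scaleR: "sframe y (r *\<^sub>R w) = r *\<^sub>R sframe y w"
  by (simp add: sframe_def frame_scaleR[symmetric] complex_of_real_mult_Complex)

lemma sframe_omega: "y \<in> Y \<Longrightarrow> J (sframe y v) \<bullet> sframe y w = omega_std v w"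
  using N_norm_pos[of y] by (simp add: sframe_def frame_omega omega_std_def field_simps)

lemma bij_sframe: assumes y: "y \<in> Y" shows "bij_betw (sframe y) UNIV (\<xi> y)"
proof -
  have NN: "N y \<bullet> N y \<noteq> 0" using N_norm_pos[OF y] by simp
  have "inj (sframe y)"
  proof (rule injI)
    fix v w assume e: "sframe y v = sframe y w"
    have "omega_std v u = omega_std w u" for u using e sframe_omega[OF y] by metis
    from this[of "vector [1, 0]"] this[of "vector [0, 1]"] show "v = w"
      by (simp add: omega_std_def vec_eq_iff forall_2)
  qed
  moreover have "range (sframe y) = \<xi> y"
  proof
    show "range (sframe y) \<subseteq> \<xi> y" using frame_in_plane[OF y] by (auto simp: sframe_def)
    show "\<xi> y \<subseteq> range (sframe y)"
    proof
      fix v assume "v \<in> \<xi> y"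
      then have "v = sframe y (vector [(v \<bullet> K (N y)) / (N y \<bullet> N y), v \<bullet> J (K (N y))])"
        using frame_coords[OF y] by (simp add: sframe_def)
      then show "v \<in> range (sframe y)" by blast
    qed
  qed
  ultimately show ?thesis by (simp add: bij_betw_def)
qed

lemma triv_sframe: "y \<in> Y \<Longrightarrow> triv y (sframe y w) = w"
  using bij_sframe[of y] by (simp add: triv_def bij_betw_def)

lemma sframe_triv: "y \<in> Y \<Longrightarrow> v \<in> \<xi> y \<Longrightarrow> sframe y (triv y v) = v"
  using bij_sframe[of y] by (auto simp: triv_def bij_betw_def f_inv_into_f)

lemma inv_triv: assumes y: "y \<in> Y" shows "inv_into (\<xi> y) (triv y) w = sframe y w"
proof -
  have b: "bij_betw (triv y) (\<xi> y) UNIV"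
    using bij_betw_inv_into[OF bij_sframe[OF y]] by (simp add: triv_def)
  have "sframe y w \<in> \<xi> y" using bij_sframe[OF y] by (auto simp: bij_betw_def)
  then have "inv_into (\<xi> y) (triv y) (triv y (sframe y w)) = sframe y w"
    using b by (intro inv_into_f_f) (auto simp: bij_betw_def)
  then show ?thesis using triv_sframe[OF y] by simp
qed

lemma smooth_sframe: "smooth_along Y (\<lambda>y. sframe y w)"
  unfolding smooth_along_def
proof
  fix p assume p: "p \<in> Y"
  then obtain U g where U: "open U" "p \<in> U" "smooth_on U g" "\<forall>x\<in>U \<inter> Y. g x = N x"
    using smooth unfolding smooth_along_def by meson
  define V where "V = {x\<in>U. g x \<bullet> g x \<noteq> 0}"
  have "continuous_on U (\<lambda>x. g x \<bullet> g x)"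
    by (intro continuous_intros smooth_on_imp_continuous[OF U(3)])
  then have "open (U \<inter> (\<lambda>x. g x \<bullet> g x) -` (-{0}))"
    by (rule continuous_open_preimage[OF _ U(1)]) auto
  moreover have "V = U \<inter> (\<lambda>x. g x \<bullet> g x) -` (-{0})" by (auto simp: V_def)
  ultimately have oV: "open V" by simp
  have gp: "g p = N p" using U p by blast
  have pV: "p \<in> V" using U gp N_norm_pos[OF p] by (simp add: V_def)
  have sg: "smooth_on V g" by (rule smooth_on_subset[OF U(3)]) (auto simp: V_def)
  have id: "smooth_on V (\<lambda>x. x)" using oV by (simp add: smooth_on_def Ck_on_ident)
  have const: "smooth_on V (\<lambda>x. c)" for c :: real using oV by (simp add: smooth_on_def Ck_on_const)
  have inn: "smooth_on V (\<lambda>x. f x \<bullet> h x)" if "smooth_on V f" "smooth_on V h" for f h :: "c2 \<Rightarrow> c2"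
    using smooth_on_bilinear[OF oV bounded_bilinear_inner that] .
  have sca: "smooth_on V (\<lambda>x. f x *\<^sub>R h x)" if "smooth_on V f" "smooth_on V h" for f and h :: "c2 \<Rightarrow> c2"
    using smooth_on_bilinear[OF oV bounded_bilinear_scaleR that] .
  have mul: "smooth_on V (\<lambda>x. f x * h x)" if "smooth_on V f" "smooth_on V h" for f h :: "c2 \<Rightarrow> real"
    using smooth_on_bilinear[OF oV bounded_bilinear_mult that] .
  have sJ: "smooth_on V (\<lambda>x. J (f x))" if "smooth_on V f" for f
    using smooth_on_linear[OF oV bounded_linear_J that] .
  have sK: "smooth_on V (\<lambda>x. K (f x))" if "smooth_on V f" for f
    using smooth_on_linear[OF oV bounded_linear_K that] .
  have inv: "smooth_on V (\<lambda>x. inverse (g x \<bullet> g x))"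
    by (intro smooth_on_inverse[OF oV] inn sg) (auto simp: V_def)
  define Wx where "Wx x = w $ 1 *\<^sub>R K (g x) + (w $ 2 * inverse (g x \<bullet> g x)) *\<^sub>R J (K (g x))" for x
  define e where "e x = Wx x + ((- 1) * (J x \<bullet> Wx x)) *\<^sub>R J (g x)" for x
  have sW: "smooth_on V Wx" unfolding Wx_def
    by (intro smooth_on_add[OF oV] sca mul const inv sJ sK sg)
  have "smooth_on V e" unfolding e_def
    by (intro smooth_on_add[OF oV] sca mul const inn sJ id sW sg)
  moreover have "e x = sframe x w" if "x \<in> V \<inter> Y" for x
  proof -
    have "g x = N x" using that U(4) by (auto simp: V_def)
    then show ?thesis by (simp add: e_def Wx_def sframe_def frame_def K_span_def divide_inverse)
  qed
  ultimately show "\<exists>U g. open U \<and> p \<in> U \<and> smooth_on U g \<and> (\<forall>x\<in>U \<inter> Y. g x = sframe x w)"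
    using oV pV by blast
qed

lemma smooth_along_cong: "(\<And>x. x \<in> A \<Longrightarrow> f x = g x) \<Longrightarrow> smooth_along A f \<Longrightarrow> smooth_along A g"
  unfolding smooth_along_def by fastforce

theorem symplectic_trivialization_triv: "symplectic_trivialization Y liouville_form triv"
proof -
  have "smooth_along Y (\<lambda>y. inv_into (\<xi> y) (triv y) w)" for w
    by (rule smooth_along_cong[OF _ smooth_sframe[of w]]) (simp add: inv_triv)
  moreover have "bij_betw (triv y) (\<xi> y) UNIV" if "y \<in> Y" for y
    using bij_betw_inv_into[OF bij_sframe[OF that]] by (simp add: triv_def)
  moreover have "triv y (u + v) = triv y u + triv y v \<and> omega_std (triv y u) (triv y v) = ext_deriv liouville_form y u v"
    if y: "y \<in> Y" and uv: "u \<in> \<xi> y" "v \<in> \<xi> y" for y u v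
  proof
    have "sframe y (triv y u + triv y v) = u + v" using sframe_triv[OF y] uv by (simp add: sframe_add)
    then show "triv y (u + v) = triv y u + triv y v" using triv_sframe[OF y] by metis
    show "omega_std (triv y u) (triv y v) = ext_deriv liouville_form y u v"
      using sframe_omega[OF y, of "triv y u" "triv y v"] sframe_triv[OF y] uv by (simp add: ext_deriv_liouville)
  qed
  moreover have "triv y (r *\<^sub>R u) = r *\<^sub>R triv y u" if y: "y \<in> Y" and u: "u \<in> \<xi> y" for y u r
  proof -
    have "sframe y (r *\<^sub>R triv y u) = r *\<^sub>R u" using sframe_triv[OF y u] by (simp add: sframe_scaleR)
    then show ?thesis using triv_sframe[OF y] by metis
  qed
  ultimately show ?thesis unfolding symplectic_trivialization_def by blast
qed

end

section \<open>The contact frame in an arbitrary trivialization\<close>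

text \<open>The rotation number quantifies over all trivializations, so from here on \<open>\<tau>\<close> is arbitrary.\<close>

locale trivialized = star_gauge_c2 +
  fixes \<tau> :: "c2 \<Rightarrow> c2 \<Rightarrow> real^2"
  assumes triv: "symplectic_trivialization Y liouville_form \<tau>"
begin

abbreviation "\<tau>inv y w \<equiv> inv_into (\<xi> y) (\<tau> y) w"

lemma \<tau>_add: "y \<in> Y \<Longrightarrow> u \<in> \<xi> y \<Longrightarrow> v \<in> \<xi> y \<Longrightarrow> \<tau> y (u + v) = \<tau> y u + \<tau> y v"
  and \<tau>_omega: "y \<in> Y \<Longrightarrow> u \<in> \<xi> y \<Longrightarrow> v \<in> \<xi> y \<Longrightarrow> omega_std (\<tau> y u) (\<tau> y v) = J u \<bullet> v"
  and \<tau>_scaleR: "y \<in> Y \<Longrightarrow> u \<in> \<xi> y \<Longrightarrow> \<tau> y (r *\<^sub>R u) = r *\<^sub>R \<tau> y u"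
  and \<tau>_bij: "y \<in> Y \<Longrightarrow> bij_betw (\<tau> y) (\<xi> y) UNIV"
  and \<tau>inv_smooth: "smooth_along Y (\<lambda>y. \<tau>inv y w)"
  using triv unfolding symplectic_trivialization_def ext_deriv_liouville by blast+

lemma \<tau>inv_in: "y \<in> Y \<Longrightarrow> \<tau>inv y w \<in> \<xi> y" and \<tau>_\<tau>inv: "y \<in> Y \<Longrightarrow> \<tau> y (\<tau>inv y w) = w"
  using \<tau>_bij[of y] by (auto simp: bij_betw_def inv_into_into f_inv_into_f)

lemma \<tau>inv_\<tau>: "y \<in> Y \<Longrightarrow> v \<in> \<xi> y \<Longrightarrow> \<tau>inv y (\<tau> y v) = v"
  using \<tau>_bij[of y] by (auto simp: bij_betw_def)

lemma plane_add: "y \<in> Y \<Longrightarrow> u \<in> \<xi> y \<Longrightarrow> v \<in> \<xi> y \<Longrightarrow> u + v \<in> \<xi> y"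
  and plane_scaleR: "y \<in> Y \<Longrightarrow> u \<in> \<xi> y \<Longrightarrow> r *\<^sub>R u \<in> \<xi> y"
  by (auto simp: contact_plane_eq inner_add_right)

lemma \<tau>inv_add: assumes y: "y \<in> Y" shows "\<tau>inv y (v + w) = \<tau>inv y v + \<tau>inv y w"
proof -
  have "\<tau> y (\<tau>inv y v + \<tau>inv y w) = v + w" using y by (simp add: \<tau>_add \<tau>inv_in \<tau>_\<tau>inv)
  then show ?thesis using \<tau>inv_\<tau>[OF y plane_add[OF y \<tau>inv_in[OF y] \<tau>inv_in[OF y]]] by metis
qed

lemma \<tau>inv_scaleR: assumes y: "y \<in> Y" shows "\<tau>inv y (r *\<^sub>R w) = r *\<^sub>R \<tau>inv y w"
proof -
  have "\<tau> y (r *\<^sub>R \<tau>inv y w) = r *\<^sub>R w" using y by (simp add: \<tau>_scaleR \<tau>inv_in \<tau>_\<tau>inv)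
  then show ?thesis using \<tau>inv_\<tau>[OF y plane_scaleR[OF y \<tau>inv_in[OF y]]] by metis
qed

text \<open>A trivialization is given as smooth through its inverse. Symplectic duality recovers \<open>\<tau>\<close> itself from
  the inverse images of the standard basis, which shows that it is continuous.\<close>

lemma \<tau>_formula:
  assumes y: "y \<in> Y" and v: "v \<in> \<xi> y"
  shows "\<tau> y v = vector [J v \<bullet> \<tau>inv y (vector [0, 1]), J (\<tau>inv y (vector [1, 0])) \<bullet> v]"
  using \<tau>_omega[OF y v \<tau>inv_in[OF y], of "vector [0, 1]"] \<tau>_omega[OF y \<tau>inv_in[OF y] v, of "vector [1, 0]"]
  by (simp add: \<tau>_\<tau>inv[OF y] omega_std_def vec_eq_iff forall_2)

lemma continuous_on_\<tau>:
  assumes p: "continuous_on S p" "p ` S \<subseteq> Y" and v: "continuous_on S v" "\<And>t. t \<in> S \<Longrightarrow> v t \<in> \<xi> (p t)"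
  shows "continuous_on S (\<lambda>t. \<tau> (p t) (v t))"
proof -
  have ci: "continuous_on S (\<lambda>t. \<tau>inv (p t) w)" for w
    by (rule continuous_on_compose2[OF smooth_along_imp_continuous[OF \<tau>inv_smooth] p])
  have cJ: "continuous_on S (\<lambda>t. J (f t))" if "continuous_on S f" for f
    using bounded_linear.continuous_on[OF bounded_linear_J that] .
  have "continuous_on S (\<lambda>t. vector [J (v t) \<bullet> \<tau>inv (p t) (vector [0, 1]),
      J (\<tau>inv (p t) (vector [1, 0])) \<bullet> v t] :: real^2)"
  proof -
    have "continuous_on S (\<lambda>t. (\<chi> i. if i = 1 then J (v t) \<bullet> \<tau>inv (p t) (vector [0, 1])
        else J (\<tau>inv (p t) (vector [1, 0])) \<bullet> v t) :: real^2)"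
    proof (rule continuous_on_vec_lambda)
      fix i :: 2
      show "continuous_on S (\<lambda>t. if i = 1 then J (v t) \<bullet> \<tau>inv (p t) (vector [0, 1])
        else J (\<tau>inv (p t) (vector [1, 0])) \<bullet> v t)"
        by (cases "i = 1") (auto intro!: continuous_intros ci cJ v)
    qed
    moreover have "(\<chi> i. if i = 1 then a else b) = (vector [a, b] :: real^2)" for a b
      by (simp add: vec_eq_iff forall_2)
    ultimately show ?thesis by simp
  qed
  then show ?thesis
    by (rule continuous_on_eq) (use p v in \<open>auto simp: \<tau>_formula image_subset_iff\<close>)
qed

text \<open>The map \<open>w \<mapsto> \<tau> y (frame y w)\<close> is real-linear, so in complex notation it is \<open>w \<mapsto> a w + b cnj w\<close>. It
  preserves orientation, which means \<open>|b| < |a|\<close>.\<close>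

definition frame_image :: "c2 \<Rightarrow> complex \<Rightarrow> complex" where
  "frame_image y w = to_complex (\<tau> y (frame y w))"

definition a_part :: "c2 \<Rightarrow> complex" where
  "a_part y = (frame_image y 1 - \<i> * frame_image y \<i>) / 2"

definition b_part :: "c2 \<Rightarrow> complex" where
  "b_part y = (frame_image y 1 + \<i> * frame_image y \<i>) / 2"

lemma frame_image_eq: assumes y: "y \<in> Y" shows "frame_image y w = a_part y * w + b_part y * cnj w"
proof -
  have "w = of_real (Re w) * 1 + of_real (Im w) * \<i>" by (simp add: complex_eq_iff)
  then have "frame y w = frame y (of_real (Re w) * 1 + of_real (Im w) * \<i>)" by simp
  also have "\<dots> = Re w *\<^sub>R frame y 1 + Im w *\<^sub>R frame y \<i>"
    by (simp only: frame_add frame_scaleR)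
  finally have "frame y w = Re w *\<^sub>R frame y 1 + Im w *\<^sub>R frame y \<i>" .
  then have "frame_image y w = of_real (Re w) * frame_image y 1 + of_real (Im w) * frame_image y \<i>"
    using frame_in_plane[OF y] by (simp add: frame_image_def \<tau>_add[OF y] \<tau>_scaleR[OF y] plane_scaleR[OF y] to_complex_add to_complex_scaleR)
  then show ?thesis by (simp add: a_part_def b_part_def complex_eq_iff field_simps)
qed

lemma part_norms: assumes y: "y \<in> Y" shows "cmod (b_part y) < cmod (a_part y)"
proof -
  have "omega_std (\<tau> y (frame y 1)) (\<tau> y (frame y \<i>)) = N y \<bullet> N y"
    using \<tau>_omega[OF y frame_in_plane[OF y] frame_in_plane[OF y]] frame_omega[of y 1 \<i>] by simp
  then have "Re (frame_image y 1) * Im (frame_image y \<i>) - Im (frame_image y 1) * Re (frame_image y \<i>) = N y \<bullet> N y"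
    by (simp add: frame_image_def to_complex_def omega_std_def)
  then have "(cmod (a_part y))\<^sup>2 - (cmod (b_part y))\<^sup>2 = N y \<bullet> N y"
    unfolding a_part_def b_part_def cmod_power2 by (simp add: power2_eq_square field_simps)
  then have "(cmod (b_part y))\<^sup>2 < (cmod (a_part y))\<^sup>2" using N_norm_pos[OF y] by linarith
  then show ?thesis by (rule power2_less_imp_less) simp
qed

lemma continuous_on_N_Y: "continuous_on Y N"
  by (rule continuous_on_subset[OF continuous_on_N]) auto

lemma continuous_on_frame: "continuous_on Y (\<lambda>y. frame y w)"
proof -
  have cJ: "continuous_on Y (\<lambda>t. J (f t))" if "continuous_on Y f" for f
    using bounded_linear.continuous_on[OF bounded_linear_J that] .
  have cK: "continuous_on Y (\<lambda>t. K (f t))" if "continuous_on Y f" for f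
    using bounded_linear.continuous_on[OF bounded_linear_K that] .
  show ?thesis unfolding frame_def K_span_def by (intro continuous_intros cJ cK continuous_on_N_Y)
qed

lemma continuous_on_frame_image: "continuous_on Y (\<lambda>y. frame_image y w)"
  unfolding frame_image_def
  by (intro continuous_on_to_complex continuous_on_\<tau> continuous_on_frame frame_in_plane continuous_intros) auto

text \<open>The radial projection extends \<open>a_part\<close> to the complement of the origin, which is simply connected.\<close>

lemma a_part_logarithm:
  obtains l where "continuous_on Y l" "\<And>y. y \<in> Y \<Longrightarrow> a_part y = exp (l y)"
proof -
  have ca: "continuous_on Y a_part"
    unfolding a_part_def by (intro continuous_intros continuous_on_frame_image) auto
  have nz: "a_part y \<noteq> 0" if "y \<in> Y" for y using part_norms[OF that] by auto
  have 1: "continuous_on (-{0}) (\<lambda>z. a_part (proj z))"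
    by (rule continuous_on_compose2[OF ca continuous_on_proj]) (use proj_in_Y in auto)
  have 2: "simply_connected (-{0::c2})"
    by (rule simply_connected_punctured_universe) simp
  have 3: "locally path_connected (-{0::c2})"
    by (rule open_imp_locally_path_connected) auto
  have 4: "a_part (proj z) \<noteq> 0" if "z \<in> -{0}" for z using nz[OF proj_in_Y] that by auto
  obtain l where l: "continuous_on (-{0}) l" "\<And>z. z \<in> -{0} \<Longrightarrow> a_part (proj z) = exp (l z)"
    using continuous_logarithm_on_simply_connected[OF 1 2 3 4] by metis
  show ?thesis
  proof
    show "continuous_on Y l" by (rule continuous_on_subset[OF l(1)]) auto
    show "a_part y = exp (l y)" if "y \<in> Y" for y using l(2)[of y] that Y_nonzero[OF that] by auto
  qed
qed

text \<open>In \<open>a w + b cnj w = a w (1 + q)\<close> with \<open>|q| < 1\<close>, the factor \<open>1 + q\<close> stays in a half-plane, and \<open>a\<close>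
  has a continuous logarithm, whose imaginary part is bounded on the compact set \<open>Y\<close>. So up to an error
  that depends neither on the path nor on its duration, all rotation comes from \<open>w\<close>.\<close>

theorem frame_winding:
  "\<exists>M. \<forall>p w \<sigma> T. T \<ge> 0 \<longrightarrow> continuous_on {0..T} p \<longrightarrow> p ` {0..T} \<subseteq> Y \<longrightarrow>
     continuous_on {0..T} w \<longrightarrow> continuous_on {0..T} \<sigma> \<longrightarrow>
     (\<forall>t\<in>{0..T}. w t \<noteq> 0 \<and> w t = of_real (cmod (w t)) * cis (\<sigma> t)) \<longrightarrow>
     (\<exists>\<theta>. angle_lift (\<lambda>t. \<tau> (p t) (frame (p t) (w t))) T \<theta> \<and>
        \<bar>(\<theta> T - \<theta> 0) - (\<sigma> T - \<sigma> 0) / (2 * pi)\<bar> \<le> M)"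
proof -
  obtain l where l: "continuous_on Y l" "\<And>y. y \<in> Y \<Longrightarrow> a_part y = exp (l y)" using a_part_logarithm by blast
  have "compact ((\<lambda>y. Im (l y)) ` Y)"
    by (intro compact_continuous_image compact_Y continuous_intros l)
  then obtain B where B: "\<And>y. y \<in> Y \<Longrightarrow> \<bar>Im (l y)\<bar> \<le> B"
    using compact_imp_bounded bounded_iff by (metis image_eqI real_norm_def)
  have cont_ab: "continuous_on Y a_part" "continuous_on Y b_part"
    unfolding a_part_def b_part_def by (intro continuous_intros continuous_on_frame_image; simp)+
  show ?thesis
  proof (intro exI[of _ "(2 * B + 2 * pi) / (2 * pi)"] allI impI)
    fix p :: "real \<Rightarrow> c2" and w :: "real \<Rightarrow> complex" and \<sigma> and T :: real
    assume T: "T \<ge> 0" and p: "continuous_on {0..T} p" "p ` {0..T} \<subseteq> Y" and w: "continuous_on {0..T} w"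
      and \<sigma>: "continuous_on {0..T} \<sigma>"
      and w\<sigma>: "\<forall>t\<in>{0..T}. w t \<noteq> 0 \<and> w t = of_real (cmod (w t)) * cis (\<sigma> t)"
    have pY: "p t \<in> Y" if "t \<in> {0..T}" for t using p that by blast
    define q where "q t = (b_part (p t) / a_part (p t)) * (cnj (w t) / w t)" for t
    have anz: "a_part (p t) \<noteq> 0" if "t \<in> {0..T}" for t using part_norms[OF pY[OF that]] by auto
    have q1: "cmod (q t) < 1" if t: "t \<in> {0..T}" for t
      using part_norms[OF pY[OF t]] anz[OF t] w\<sigma> t by (simp add: q_def norm_mult norm_divide)
    have Re: "Re (1 + q t) > 0" if "t \<in> {0..T}" for t
      using q1[OF that] abs_Re_le_cmod[of "q t"] by simp
    have cq: "continuous_on {0..T} q"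
      unfolding q_def using anz w\<sigma>
      by (intro continuous_intros continuous_on_compose2[OF cont_ab(1) p] continuous_on_compose2[OF cont_ab(2) p] w) auto
    define \<theta> where "\<theta> t = (Im (l (p t)) + \<sigma> t + Im (Ln (1 + q t))) / (2 * pi)" for t
    have cLn: "continuous_on {0..T} (\<lambda>t. Ln (1 + q t))"
      by (intro continuous_on_Ln continuous_intros cq) (use Re in \<open>force simp: complex_nonpos_Reals_iff\<close>)
    have "continuous_on {0..T} \<theta>"
      unfolding \<theta>_def by (intro continuous_intros \<sigma> cLn continuous_on_compose2[OF l(1) p]) auto
    moreover have "has_angle (\<tau> (p t) (frame (p t) (w t))) (\<theta> t)" if t: "t \<in> {0..T}" for t
    proof (rule has_angleI)
      have nz: "1 + q t \<noteq> 0" using Re[OF t] by (metis less_irrefl zero_complex.simps(1))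
      have "to_complex (\<tau> (p t) (frame (p t) (w t))) = a_part (p t) * w t * (1 + q t)"
        using frame_image_eq[OF pY[OF t], of "w t"] anz[OF t] w\<sigma> t by (simp add: frame_image_def q_def field_simps)
      also have "\<dots> = exp (l (p t)) * (of_real (cmod (w t)) * cis (\<sigma> t)) * exp (Ln (1 + q t))"
        using l(2)[OF pY[OF t]] w\<sigma> t nz by simp
      also have "\<dots> = of_real (exp (Re (l (p t))) * cmod (w t) * exp (Re (Ln (1 + q t)))) *
          (cis (Im (l (p t))) * cis (\<sigma> t) * cis (Im (Ln (1 + q t))))"
        unfolding exp_eq_polar[of "l (p t)"] exp_eq_polar[of "Ln (1 + q t)"] by simp
      also have "cis (Im (l (p t))) * cis (\<sigma> t) * cis (Im (Ln (1 + q t))) = cis (2 * pi * \<theta> t)"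
        by (simp add: cis_mult \<theta>_def)
      finally show "to_complex (\<tau> (p t) (frame (p t) (w t))) =
        of_real (exp (Re (l (p t))) * cmod (w t) * exp (Re (Ln (1 + q t)))) * cis (2 * pi * \<theta> t)" .
    qed simp
    ultimately have lift: "angle_lift (\<lambda>t. \<tau> (p t) (frame (p t) (w t))) T \<theta>"
      unfolding angle_lift_def by blast
    have L: "\<bar>Im (Ln (1 + q t))\<bar> \<le> pi" if "t \<in> {0..T}" for t
    proof -
      have "1 + q t \<noteq> 0" using Re[OF that] by (metis less_irrefl zero_complex.simps(1))
      from mpi_less_Im_Ln[OF this] Im_Ln_le_pi[OF this] show ?thesis by (simp add: abs_le_iff)
    qed
    have "(\<theta> T - \<theta> 0) - (\<sigma> T - \<sigma> 0) / (2 * pi)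
        = ((Im (l (p T)) - Im (l (p 0))) + (Im (Ln (1 + q T)) - Im (Ln (1 + q 0)))) / (2 * pi)"
      by (simp add: \<theta>_def add_divide_distrib diff_divide_distrib)
    then have "\<bar>(\<theta> T - \<theta> 0) - (\<sigma> T - \<sigma> 0) / (2 * pi)\<bar>
        = \<bar>(Im (l (p T)) - Im (l (p 0))) + (Im (Ln (1 + q T)) - Im (Ln (1 + q 0)))\<bar> / (2 * pi)"
      by simp
    also have "\<dots> \<le> (2 * B + 2 * pi) / (2 * pi)"
      using B[OF pY[of T]] B[OF pY[of 0]] L[of T] L[of 0] T by (intro divide_right_mono) auto
    finally show "\<exists>\<theta>. angle_lift (\<lambda>t. \<tau> (p t) (frame (p t) (w t))) T \<theta> \<and>
        \<bar>(\<theta> T - \<theta> 0) - (\<sigma> T - \<sigma> 0) / (2 * pi)\<bar> \<le> (2 * B + 2 * pi) / (2 * pi)"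
      using lift by blast
  qed
qed

end

section \<open>The Reeb flow of a toric hypersurface\<close>

definition torus_rotate :: "real \<Rightarrow> real \<Rightarrow> c2 \<Rightarrow> c2" where
  "torus_rotate a b z = (cis a * fst z, cis b * snd z)"

lemma fst_rotate [simp]: "fst (torus_rotate a b z) = cis a * fst z" and snd_rotate [simp]: "snd (torus_rotate a b z) = cis b * snd z"
  by (simp_all add: torus_rotate_def)

lemma inner_mult_unit: "cmod c = 1 \<Longrightarrow> (c * u) \<bullet> (c * v) = u \<bullet> (v :: complex)"
proof -
  assume c: "cmod c = 1"
  have "(c * u) \<bullet> (c * v) = (cmod c)\<^sup>2 * (u \<bullet> v)"
    unfolding cmod_power2 by (simp add: inner_complex_def power2_eq_square algebra_simps)
  then show ?thesis using c by simp
qed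

lemma rotate_inner [simp]: "torus_rotate a b u \<bullet> torus_rotate a b v = u \<bullet> v"
  by (simp add: inner_prod_def inner_mult_unit)

lemma rotate_rotate: "torus_rotate a b (torus_rotate c d z) = torus_rotate (a + c) (b + d) z"
  by (simp add: torus_rotate_def cis_mult[symmetric] mult_ac)

lemma rotate_0 [simp]: "torus_rotate 0 0 z = z"
  by (simp add: torus_rotate_def)

lemma rotate_cancel [simp]: "torus_rotate a b (torus_rotate (- a) (- b) z) = z" "torus_rotate (- a) (- b) (torus_rotate a b z) = z"
  by (simp_all add: rotate_rotate)

lemma rotate_add: "torus_rotate a b (u + v) = torus_rotate a b u + torus_rotate a b v"
  and rotate_scaleR: "torus_rotate a b (r *\<^sub>R u) = r *\<^sub>R torus_rotate a b u"
  by (simp_all add: torus_rotate_def algebra_simps)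

lemma rotate_J: "torus_rotate a b (J u) = J (torus_rotate a b u)"
  by (simp add: torus_rotate_def J_def algebra_simps)

lemma rotate_eq_0 [simp]: "torus_rotate a b z = 0 \<longleftrightarrow> z = 0"
  by (metis rotate_cancel(2) rotate_scaleR scaleR_zero_left)

lemma rotate_zero: "torus_rotate a b 0 = 0"
  by (simp add: torus_rotate_def zero_prod_def)

lemma bounded_linear_rotate: "bounded_linear (torus_rotate a b)"
  by (rule linear_conv_bounded_linear[THEN iffD1], rule linearI) (simp_all add: rotate_add rotate_scaleR)

lemma complex_parallel:
  fixes n z :: complex
  assumes "n \<bullet> (\<i> * z) = 0" "z \<noteq> 0" shows "n = of_real ((n \<bullet> z) / (z \<bullet> z)) * z"
proof -
  have zz: "z \<bullet> z \<noteq> 0" using assms by simp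
  have e: "Re n * Im z = Im n * Re z" using assms(1) by (simp add: inner_complex_def)
  have "of_real (z \<bullet> z) * n = of_real (n \<bullet> z) * z"
    unfolding complex_eq_iff using e by (simp add: inner_complex_def) (intro conjI; algebra)
  then show ?thesis using zz by (simp add: field_simps)
qed

definition generic :: "c2 \<Rightarrow> bool" where
  "generic z \<longleftrightarrow> fst z \<noteq> 0 \<and> snd z \<noteq> 0"

lemma generic_nonzero: "generic z \<Longrightarrow> z \<noteq> 0"
  by (auto simp: generic_def)

lemma generic_rotate [simp]: "generic (torus_rotate a b z) \<longleftrightarrow> generic z"
  by (simp add: generic_def)

lemma open_generic: "open {z. generic z}"
proof -
  have "{z. generic z} = {z. fst z \<noteq> 0} \<inter> {z. snd z \<noteq> 0}" by (auto simp: generic_def)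
  moreover have "open {z::c2. fst z \<noteq> 0}" "open {z::c2. snd z \<noteq> 0}"
    by (intro open_Collect_neq continuous_intros)+
  ultimately show ?thesis by auto
qed

locale toric_gauge = star_gauge_c2 +
  assumes torus: "G (torus_rotate a b z) = G z"
begin

lemma N_rotate: assumes z: "z \<noteq> 0" shows "N (torus_rotate a b z) = torus_rotate a b (N z)"
proof -
  have "((\<lambda>v. G (torus_rotate (- a) (- b) v)) has_derivative (\<lambda>v. N z \<bullet> torus_rotate (- a) (- b) v)) (at (torus_rotate a b z))"
    by (rule has_derivative_compose[OF bounded_linear.has_derivative[OF bounded_linear_rotate has_derivative_ident]])
       (use deriv[OF z] in simp)
  moreover have "N z \<bullet> torus_rotate (- a) (- b) v = torus_rotate a b (N z) \<bullet> v" for v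
    by (metis rotate_inner rotate_cancel(1))
  ultimately have "(G has_derivative (\<lambda>v. torus_rotate a b (N z) \<bullet> v)) (at (torus_rotate a b z))"
    by (simp add: torus)
  then show ?thesis using gradient_unique[of "torus_rotate a b z"] z by simp
qed

lemma rotate_curve_derivative:
  "((\<lambda>t. torus_rotate (a * t) (b * t) z) has_derivative
     (\<lambda>h. h *\<^sub>R torus_rotate (a * t) (b * t) (\<i> * of_real a * fst z, \<i> * of_real b * snd z))) (at t)"
proof -
  have c: "((\<lambda>t. cis (k * t)) has_derivative (\<lambda>h. h *\<^sub>R (\<i> * of_real k * cis (k * t)))) (at t)" for k
  proof -
    have "((\<lambda>t. exp (\<i> * of_real k * of_real t)) has_vector_derivative (\<i> * of_real k * cis (k * t))) (at t)"
      by (rule has_vector_derivative_real_field) (auto intro!: derivative_eq_intros simp: cis_conv_exp mult_ac)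
    moreover have "(\<lambda>t. exp (\<i> * of_real k * of_real t)) = (\<lambda>t. cis (k * t))"
      by (auto simp: cis_conv_exp mult_ac)
    ultimately show ?thesis by (simp add: has_vector_derivative_def)
  qed
  have "((\<lambda>t. (cis (a * t) * fst z, cis (b * t) * snd z)) has_derivative
     (\<lambda>h. (h *\<^sub>R (\<i> * of_real a * cis (a * t)) * fst z, h *\<^sub>R (\<i> * of_real b * cis (b * t)) * snd z))) (at t)"
    by (intro has_derivative_Pair has_derivative_mult_left c)
  then show ?thesis by (simp add: torus_rotate_def mult_ac)
qed

lemma N_torus_direction: assumes z: "z \<noteq> 0" shows "N z \<bullet> (\<i> * of_real a * fst z, \<i> * of_real b * snd z) = 0"
proof -
  have "((\<lambda>t. G (torus_rotate (a * t) (b * t) z)) has_derivative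
      (\<lambda>h. N z \<bullet> (h *\<^sub>R (\<i> * of_real a * fst z, \<i> * of_real b * snd z)))) (at 0)"
    using has_derivative_compose[OF rotate_curve_derivative[of a b z 0], of G "\<lambda>v. N z \<bullet> v"] deriv[OF z] by simp
  then have "((\<lambda>t. G z) has_derivative
      (\<lambda>h. N z \<bullet> (h *\<^sub>R (\<i> * of_real a * fst z, \<i> * of_real b * snd z)))) (at (0::real))" by (simp add: torus)
  then have "(\<lambda>h. N z \<bullet> (h *\<^sub>R (\<i> * of_real a * fst z, \<i> * of_real b * snd z))) = (\<lambda>h::real. 0)"
    using has_derivative_const by (rule has_derivative_unique)
  then have "N z \<bullet> (1 *\<^sub>R (\<i> * of_real a * fst z, \<i> * of_real b * snd z)) = 0" by (rule fun_cong)
  then show ?thesis by simp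
qed

lemma fst_N_orth: "z \<noteq> 0 \<Longrightarrow> fst (N z) \<bullet> (\<i> * fst z) = 0"
  and snd_N_orth: "z \<noteq> 0 \<Longrightarrow> snd (N z) \<bullet> (\<i> * snd z) = 0"
  using N_torus_direction[of z 1 0] N_torus_direction[of z 0 1] by (simp_all add: inner_prod_def)

text \<open>Torus invariance makes \<open>N z\<close> orthogonal to the torus directions, so each of its components is a real
  multiple of the same component of \<open>z\<close>; these are the multiples.\<close>

definition \<nu>1 :: "c2 \<Rightarrow> real" where "\<nu>1 z = (fst (N z) \<bullet> fst z) / (fst z \<bullet> fst z)"

definition \<nu>2 :: "c2 \<Rightarrow> real" where "\<nu>2 z = (snd (N z) \<bullet> snd z) / (snd z \<bullet> snd z)"

lemma N_generic: assumes "generic z" shows "N z = (of_real (\<nu>1 z) * fst z, of_real (\<nu>2 z) * snd z)"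
  using complex_parallel[OF fst_N_orth[OF generic_nonzero[OF assms]]]
    complex_parallel[OF snd_N_orth[OF generic_nonzero[OF assms]]] assms
  unfolding generic_def \<nu>1_def \<nu>2_def by (metis prod.collapse)

lemma \<nu>_euler: assumes "generic z"
  shows "\<nu>1 z * (fst z \<bullet> fst z) + \<nu>2 z * (snd z \<bullet> snd z) = G z"
  using euler[OF generic_nonzero[OF assms]] assms
  by (simp add: inner_prod_def \<nu>1_def \<nu>2_def generic_def)

lemma \<nu>_rotate: "z \<noteq> 0 \<Longrightarrow> \<nu>1 (torus_rotate a b z) = \<nu>1 z" "z \<noteq> 0 \<Longrightarrow> \<nu>2 (torus_rotate a b z) = \<nu>2 z"
  by (simp_all add: \<nu>1_def \<nu>2_def N_rotate inner_mult_unit)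

definition flow :: "real \<Rightarrow> c2 \<Rightarrow> c2" where
  "flow t z = torus_rotate (2 * \<nu>1 z * t) (2 * \<nu>2 z * t) z"

lemma flow_0 [simp]: "flow 0 z = z"
  by (simp add: flow_def)

lemma G_flow [simp]: "G (flow t z) = G z"
  by (simp add: flow_def torus)

lemma generic_flow [simp]: "generic (flow t z) \<longleftrightarrow> generic z"
  by (simp add: flow_def)

lemma N_flow: "z \<noteq> 0 \<Longrightarrow> N (flow t z) = torus_rotate (2 * \<nu>1 z * t) (2 * \<nu>2 z * t) (N z)"
  by (simp add: flow_def N_rotate)

lemma flow_velocity:
  assumes g: "generic z"
  shows "((\<lambda>t. flow t z) has_vector_derivative 2 *\<^sub>R J (N (flow t z))) (at t)"
proof -
  have "2 *\<^sub>R J (N (flow t z)) = torus_rotate (2 * \<nu>1 z * t) (2 * \<nu>2 z * t) (2 *\<^sub>R J (N z))"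
    by (simp add: N_flow[OF generic_nonzero[OF g]] rotate_J rotate_scaleR)
  also have "2 *\<^sub>R J (N z) = (\<i> * of_real (2 * \<nu>1 z) * fst z, \<i> * of_real (2 * \<nu>2 z) * snd z)"
    unfolding N_generic[OF g] by (simp add: J_def scaleR_conv_of_real)
  finally show ?thesis
    using rotate_curve_derivative[of "2 * \<nu>1 z" "2 * \<nu>2 z" z t]
    by (simp add: has_vector_derivative_def flow_def)
qed

text \<open>Along an integral curve the moduli of both coordinates are constant, since \<open>N\<close> has no component in
  the torus directions. Hence \<open>\<nu>1\<close> and \<open>\<nu>2\<close> are constant too, and the equation becomes linear with
  constant coefficients.\<close>

lemma orbit_unique:
  assumes y: "generic y" and c0: "c 0 = y" and cY: "\<And>s. c s \<in> Y"
    and c: "\<And>s. (c has_vector_derivative 2 *\<^sub>R J (N (c s))) (at s)"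
  shows "c t = flow t y"
proof -
  have c1: "((\<lambda>s. fst (c s)) has_derivative (\<lambda>h. h *\<^sub>R (2 * \<i> * fst (N (c s))))) (at s)" for s
    using has_derivative_fst[OF c[of s, unfolded has_vector_derivative_def]] by (simp add: J_def mult_ac scaleR_conv_of_real)
  have c2: "((\<lambda>s. snd (c s)) has_derivative (\<lambda>h. h *\<^sub>R (2 * \<i> * snd (N (c s))))) (at s)" for s
    using has_derivative_snd[OF c[of s, unfolded has_vector_derivative_def]] by (simp add: J_def mult_ac scaleR_conv_of_real)
  have const: "f t = f 0" if "\<And>s. (f has_derivative (\<lambda>h::real. 0)) (at s)" for f :: "real \<Rightarrow> 'b::real_normed_vector" and t
    using has_derivative_zero_unique[of UNIV f t 0] that by simp
  have orth: "u \<bullet> (2 * \<i> * n) = - 2 * (n \<bullet> (\<i> * u))" for u n :: complex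
    by (simp add: inner_complex_def)
  have n1: "fst (c s) \<bullet> fst (c s) = fst y \<bullet> fst y" for s
  proof -
    have z: "fst (c s) \<bullet> (2 * \<i> * fst (N (c s))) = 0" for s
      unfolding orth using fst_N_orth[OF Y_nonzero[OF cY]] by simp
    then have z': "(2 * \<i> * fst (N (c s))) \<bullet> fst (c s) = 0" for s by (metis inner_commute)
    have "((\<lambda>s. fst (c s) \<bullet> fst (c s)) has_derivative (\<lambda>h. 0)) (at s)" for s
      using has_derivative_inner[OF c1 c1, of s] by (simp only: inner_scaleR_left inner_scaleR_right z z') simp
    from const[OF this, of s] show ?thesis using c0 by simp
  qed
  have n2: "snd (c s) \<bullet> snd (c s) = snd y \<bullet> snd y" for s
  proof -
    have z: "snd (c s) \<bullet> (2 * \<i> * snd (N (c s))) = 0" for s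
      unfolding orth using snd_N_orth[OF Y_nonzero[OF cY]] by simp
    then have z': "(2 * \<i> * snd (N (c s))) \<bullet> snd (c s) = 0" for s by (metis inner_commute)
    have "((\<lambda>s. snd (c s) \<bullet> snd (c s)) has_derivative (\<lambda>h. 0)) (at s)" for s
      using has_derivative_inner[OF c2 c2, of s] by (simp only: inner_scaleR_left inner_scaleR_right z z') simp
    from const[OF this, of s] show ?thesis using c0 by simp
  qed
  have gen: "generic (c s)" for s
    using n1[of s] n2[of s] y unfolding generic_def by (metis inner_eq_zero_iff)
  have ph: "\<exists>a. u = cis a * v" if "u \<bullet> u = v \<bullet> v" "v \<noteq> 0" for u v :: complex
  proof -
    have "cmod u = cmod v" using that(1) by (simp add: norm_eq_sqrt_inner)
    then have "cmod (u / v) = 1" using that(2) by (simp add: norm_divide)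
    then have "u / v = cis (Arg (u / v))" using rcis_cmod_Arg[of "u / v"] by (simp add: rcis_def)
    then show ?thesis using that(2) by (metis nonzero_divide_eq_eq)
  qed
  have nu: "\<nu>1 (c s) = \<nu>1 y \<and> \<nu>2 (c s) = \<nu>2 y" for s
  proof -
    obtain a b where "fst (c s) = cis a * fst y" "snd (c s) = cis b * snd y"
      using ph[OF n1[of s]] ph[OF n2[of s]] y by (auto simp: generic_def)
    then have "c s = torus_rotate a b y" by (simp add: torus_rotate_def prod_eq_iff)
    then show ?thesis using \<nu>_rotate[OF generic_nonzero[OF y]] by simp
  qed
  have lin: "f t = cis (k * t) * f 0"
    if f: "\<And>s. (f has_derivative (\<lambda>h. h *\<^sub>R (\<i> * of_real k * f s))) (at s)" for f :: "real \<Rightarrow> complex" and k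
  proof -
    have e: "((\<lambda>s. cis (- k * s)) has_derivative (\<lambda>h. h *\<^sub>R (- \<i> * of_real k * cis (- k * s)))) (at s)" for s
      using has_derivative_fst[OF rotate_curve_derivative[of "-k" 0 "(1,0)" s]] by (simp add: mult_ac)
    have "((\<lambda>s. cis (- k * s) * f s) has_derivative (\<lambda>h. 0)) (at s)" for s
      using has_derivative_mult[OF e f, of s] by (simp add: algebra_simps)
    from const[OF this, of t] have "cis (- k * t) * f t = f 0" by simp
    then have "cis (k * t) * (cis (- k * t) * f t) = cis (k * t) * f 0" by simp
    then show ?thesis by (simp add: mult.assoc[symmetric] cis_mult)
  qed
  have "fst (c t) = cis (2 * \<nu>1 y * t) * fst (c 0)"
  proof (rule lin)
    fix s show "((\<lambda>s. fst (c s)) has_derivative (\<lambda>h. h *\<^sub>R (\<i> * of_real (2 * \<nu>1 y) * fst (c s)))) (at s)"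
      using c1[of s] N_generic[OF gen[of s]] nu[of s] by (simp add: mult_ac)
  qed
  moreover have "snd (c t) = cis (2 * \<nu>2 y * t) * snd (c 0)"
  proof (rule lin)
    fix s show "((\<lambda>s. snd (c s)) has_derivative (\<lambda>h. h *\<^sub>R (\<i> * of_real (2 * \<nu>2 y) * snd (c s)))) (at s)"
      using c2[of s] N_generic[OF gen[of s]] nu[of s] by (simp add: mult_ac)
  qed
  ultimately show ?thesis by (simp add: flow_def torus_rotate_def prod_eq_iff c0)
qed

lemma reeb_flow_eq:
  assumes y: "y \<in> Y" "generic y" shows "reeb_flow Y liouville_form t y = flow t y"
proof -
  have "(THE c. c 0 = y \<and> (\<forall>s. c s \<in> Y \<and> (c has_vector_derivative reeb_field Y liouville_form (c s)) (at s)))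
      = (\<lambda>t. flow t y)"
  proof (rule the_equality)
    have "flow s y \<in> Y" for s using y by simp
    then show "flow 0 y = y \<and> (\<forall>s. flow s y \<in> Y \<and>
        ((\<lambda>t. flow t y) has_vector_derivative reeb_field Y liouville_form (flow s y)) (at s))"
      using flow_velocity[OF y(2)] reeb_field_eq by simp
  next
    fix c :: "real \<Rightarrow> c2"
    assume c: "c 0 = y \<and> (\<forall>s. c s \<in> Y \<and> (c has_vector_derivative reeb_field Y liouville_form (c s)) (at s))"
    then have cY: "c s \<in> Y" for s by blast
    have "(c has_vector_derivative 2 *\<^sub>R J (N (c s))) (at s)" for s
      using c reeb_field_eq[OF cY[of s]] by metis
    then show "c = (\<lambda>t. flow t y)" using orbit_unique[OF y(2), of c] cY c by blast
  qed
  then show ?thesis unfolding reeb_flow_def by simp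
qed

lemma \<nu>_differentiable:
  assumes "generic z" shows "\<nu>1 differentiable (at z)" "\<nu>2 differentiable (at z)"
proof -
  have f: "fst differentiable (at z)" "snd differentiable (at z)"
    by (intro bounded_linear_imp_differentiable bounded_linear_fst bounded_linear_snd)+
  obtain D where D: "(N has_derivative D) (at z)"
    using differentiable_N[OF generic_nonzero[OF assms]] by (auto simp: differentiable_def)
  have n: "(\<lambda>z. fst (N z)) differentiable (at z)" "(\<lambda>z. snd (N z)) differentiable (at z)"
    using has_derivative_fst[OF D] has_derivative_snd[OF D] by (auto simp: differentiable_def)
  show "\<nu>1 differentiable (at z)" "\<nu>2 differentiable (at z)"
    unfolding \<nu>1_def[abs_def] \<nu>2_def[abs_def]
    using assms by (intro differentiable_divide differentiable_inner n f; simp add: generic_def)+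
qed

end

text \<open>The linearized flow along the orbit of \<open>y\<close> involves the derivatives \<open>\<kappa>1\<close> and \<open>\<kappa>2\<close> of the two speeds
  at \<open>y\<close>.\<close>

locale generic_orbit = toric_gauge +
  fixes y :: c2
  assumes yY: "y \<in> Y" and gen: "generic y"
begin

definition \<kappa>1 :: "c2 \<Rightarrow> real" where "\<kappa>1 = frechet_derivative \<nu>1 (at y)"

definition \<kappa>2 :: "c2 \<Rightarrow> real" where "\<kappa>2 = frechet_derivative \<nu>2 (at y)"

lemma \<kappa>1: "(\<nu>1 has_derivative \<kappa>1) (at y)" and \<kappa>2: "(\<nu>2 has_derivative \<kappa>2) (at y)"
  using \<nu>_differentiable[OF gen] by (simp_all add: \<kappa>1_def \<kappa>2_def frechet_derivative_works)

lemma linear_\<kappa>: "linear \<kappa>1" "linear \<kappa>2"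
  using \<kappa>1 \<kappa>2 has_derivative_linear by blast+

text \<open>Differentiate \<open>\<nu>1 |z\<^sub>1|\<^sup>2 + \<nu>2 |z\<^sub>2|\<^sup>2 = G z\<close> in the direction \<open>v\<close>: the derivatives of the moduli
  contribute \<open>2 (N y \<bullet> v)\<close> and the right-hand side \<open>N y \<bullet> v\<close>, both of which vanish.\<close>

lemma \<kappa>_tangent:
  assumes "N y \<bullet> v = 0"
  shows "\<kappa>1 v * (fst y \<bullet> fst y) + \<kappa>2 v * (snd y \<bullet> snd y) = 0"
proof -
  have f: "(fst has_derivative fst) (at y)" "(snd has_derivative snd) (at y)"
    by (rule bounded_linear.has_derivative[OF bounded_linear_fst has_derivative_ident],
        rule bounded_linear.has_derivative[OF bounded_linear_snd has_derivative_ident])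
  let ?f = "\<lambda>z. \<nu>1 z * (fst z \<bullet> fst z) + \<nu>2 z * (snd z \<bullet> snd z)"
  have "(?f has_derivative (\<lambda>v. (\<nu>1 y * (fst y \<bullet> fst v + fst v \<bullet> fst y) + \<kappa>1 v * (fst y \<bullet> fst y)) +
      (\<nu>2 y * (snd y \<bullet> snd v + snd v \<bullet> snd y) + \<kappa>2 v * (snd y \<bullet> snd y)))) (at y)"
    by (intro has_derivative_add has_derivative_mult has_derivative_inner \<kappa>1 \<kappa>2 f)
  moreover have "(?f has_derivative (\<lambda>v. N y \<bullet> v)) (at y)"
    by (rule has_derivative_transform_within_open[OF deriv[OF generic_nonzero[OF gen]] open_generic])
       (use gen \<nu>_euler in auto)
  ultimately have "(\<nu>1 y * (fst y \<bullet> fst v + fst v \<bullet> fst y) + \<kappa>1 v * (fst y \<bullet> fst y)) +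
      (\<nu>2 y * (snd y \<bullet> snd v + snd v \<bullet> snd y) + \<kappa>2 v * (snd y \<bullet> snd y)) = N y \<bullet> v"
    by (metis (no_types, lifting) has_derivative_unique)
  moreover have "N y \<bullet> v = \<nu>1 y * (fst y \<bullet> fst v) + \<nu>2 y * (snd y \<bullet> snd v)"
    unfolding N_generic[OF gen] by (simp add: inner_prod_def inner_complex_def algebra_simps)
  ultimately show ?thesis using assms by (simp add: inner_commute algebra_simps)
qed

lemma \<kappa>_torus: "\<kappa>1 (\<i> * of_real a * fst y, \<i> * of_real b * snd y) = 0"
  "\<kappa>2 (\<i> * of_real a * fst y, \<i> * of_real b * snd y) = 0"
proof -
  have *: "k (\<i> * of_real a * fst y, \<i> * of_real b * snd y) = 0"
    if k: "(f has_derivative k) (at y)" and inv: "\<And>a b. f (torus_rotate a b y) = f y" for f k :: "c2 \<Rightarrow> real"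
  proof -
    have "((\<lambda>t. f (torus_rotate (a * t) (b * t) y)) has_derivative
        (\<lambda>h. k (h *\<^sub>R (\<i> * of_real a * fst y, \<i> * of_real b * snd y)))) (at 0)"
      using has_derivative_compose[OF rotate_curve_derivative[of a b y 0], of f k] k by simp
    then have "((\<lambda>t. f y) has_derivative
        (\<lambda>h. k (h *\<^sub>R (\<i> * of_real a * fst y, \<i> * of_real b * snd y)))) (at (0::real))" by (simp add: inv)
    then have "(\<lambda>h. k (h *\<^sub>R (\<i> * of_real a * fst y, \<i> * of_real b * snd y))) = (\<lambda>h::real. 0)"
      using has_derivative_const by (rule has_derivative_unique)
    then have "k (1 *\<^sub>R (\<i> * of_real a * fst y, \<i> * of_real b * snd y)) = 0" by (rule fun_cong)
    then show ?thesis by simp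
  qed
  show "\<kappa>1 (\<i> * of_real a * fst y, \<i> * of_real b * snd y) = 0"
    "\<kappa>2 (\<i> * of_real a * fst y, \<i> * of_real b * snd y) = 0"
    using *[OF \<kappa>1] *[OF \<kappa>2] \<nu>_rotate[OF generic_nonzero[OF gen]] by blast+
qed

abbreviation "R t \<equiv> torus_rotate (2 * \<nu>1 y * t) (2 * \<nu>2 y * t)"

text \<open>The differential of the flow is this shear in the torus directions, caused by the variation of the
  speeds, followed by the rotation \<open>R t\<close>.\<close>

definition shear :: "real \<Rightarrow> c2 \<Rightarrow> c2" where
  "shear t v = v + (\<i> * of_real (2 * t * \<kappa>1 v) * fst y, \<i> * of_real (2 * t * \<kappa>2 v) * snd y)"

lemma flow_y: "flow t y = R t y"
  by (simp add: flow_def)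

lemma flow_has_derivative: "(flow t has_derivative (\<lambda>v. R t (shear t v))) (at y)"
proof -
  have f: "(fst has_derivative fst) (at y)" "(snd has_derivative snd) (at y)"
    by (rule bounded_linear.has_derivative[OF bounded_linear_fst has_derivative_ident],
        rule bounded_linear.has_derivative[OF bounded_linear_snd has_derivative_ident])
  have c: "((\<lambda>z. cis (2 * \<nu> z * t)) has_derivative (\<lambda>v. (2 * \<kappa> v * t) *\<^sub>R (\<i> * cis (2 * \<nu> y * t)))) (at y)"
    if "(\<nu> has_derivative \<kappa>) (at y)" for \<nu> \<kappa>
  proof -
    have "((\<lambda>z. 2 * \<nu> z * t) has_derivative (\<lambda>v. 2 * \<kappa> v * t)) (at y)"
      using that by (auto intro!: derivative_eq_intros)
    moreover have "(cis has_derivative (\<lambda>h. h *\<^sub>R (\<i> * cis s))) (at s)" for s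
      using has_derivative_fst[OF rotate_curve_derivative[of 1 0 "(1,0)" s]] by (simp add: mult_ac)
    ultimately show ?thesis by (rule has_derivative_compose)
  qed
  have "((\<lambda>z. (cis (2 * \<nu>1 z * t) * fst z, cis (2 * \<nu>2 z * t) * snd z)) has_derivative
     (\<lambda>v. (cis (2 * \<nu>1 y * t) * fst v + ((2 * \<kappa>1 v * t) *\<^sub>R (\<i> * cis (2 * \<nu>1 y * t))) * fst y,
           cis (2 * \<nu>2 y * t) * snd v + ((2 * \<kappa>2 v * t) *\<^sub>R (\<i> * cis (2 * \<nu>2 y * t))) * snd y))) (at y)"
    by (intro has_derivative_Pair has_derivative_mult c \<kappa>1 \<kappa>2 f)
  moreover have "(\<lambda>v. (cis (2 * \<nu>1 y * t) * fst v + ((2 * \<kappa>1 v * t) *\<^sub>R (\<i> * cis (2 * \<nu>1 y * t))) * fst y,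
           cis (2 * \<nu>2 y * t) * snd v + ((2 * \<kappa>2 v * t) *\<^sub>R (\<i> * cis (2 * \<nu>2 y * t))) * snd y))
      = (\<lambda>v. R t (shear t v))"
    by (rule ext) (simp add: torus_rotate_def shear_def algebra_simps scaleR_conv_of_real)
  ultimately show ?thesis by (simp add: flow_def[abs_def] torus_rotate_def)
qed

text \<open>A derivative relative to \<open>Y\<close> is determined on tangent vectors only; comparing along curves in \<open>Y\<close>
  identifies it there with the derivative of the ambient extension \<open>flow\<close>.\<close>

lemma reeb_flow_deriv_eq:
  assumes v: "N y \<bullet> v = 0" shows "reeb_flow_deriv Y liouville_form t y v = R t (shear t v)"
proof -
  have "(reeb_flow Y liouville_form t has_derivative (\<lambda>v. R t (shear t v))) (at y within Y)"
  proof -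
    obtain e where e: "e > 0" "ball y e \<subseteq> {z. generic z}"
      using open_generic gen open_contains_ball by (metis mem_Collect_eq)
    show ?thesis
    proof (rule has_derivative_transform_within[OF has_derivative_at_withinI[OF flow_has_derivative] e(1) yY])
      fix z assume "z \<in> Y" "dist z y < e"
      then have "generic z" using e(2) by (metis mem_ball dist_commute mem_Collect_eq subsetD)
      then show "flow t z = reeb_flow Y liouville_form t z" using reeb_flow_eq[OF \<open>z \<in> Y\<close>] by simp
    qed
  qed
  then have 1: "(reeb_flow Y liouville_form t has_derivative (\<lambda>v. R t (shear t v))) (at y within Y)" .
  then have 2: "(reeb_flow Y liouville_form t has_derivative reeb_flow_deriv Y liouville_form t y) (at y within Y)"
    unfolding reeb_flow_deriv_def by (meson differentiable_def frechet_derivative_works)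
  have "v \<in> tangent_space Y y" using v yY by (simp add: tangent_space_Y)
  then obtain c :: "real \<Rightarrow> c2" where c: "\<And>t. c t \<in> Y" "c 0 = y" "(c has_vector_derivative v) (at 0)"
    unfolding tangent_space_def by blast
  have comp: "((\<lambda>s. reeb_flow Y liouville_form t (c s)) has_derivative (\<lambda>h. D (h *\<^sub>R v))) (at 0)"
    if "(reeb_flow Y liouville_form t has_derivative D) (at y within Y)" for D
  proof -
    have "(reeb_flow Y liouville_form t has_derivative D) (at (c 0) within range c)"
      unfolding c(2) by (rule has_derivative_subset[OF that]) (use c(1) in auto)
    from has_derivative_in_compose[OF c(3)[unfolded has_vector_derivative_def] this]
    show ?thesis .
  qed
  have "(\<lambda>h. reeb_flow_deriv Y liouville_form t y (h *\<^sub>R v)) = (\<lambda>h. R t (shear t (h *\<^sub>R v)))"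
    using comp[OF 2] comp[OF 1] by (rule has_derivative_unique)
  then have "reeb_flow_deriv Y liouville_form t y (1 *\<^sub>R v) = R t (shear t (1 *\<^sub>R v))" by (rule fun_cong)
  then show ?thesis by simp
qed

end

section \<open>The rotation number of a generic orbit\<close>

text \<open>The direction tangent to the torus orbits on which the contact form vanishes.\<close>

definition torus_field :: "c2 \<Rightarrow> c2" where
  "torus_field p = (\<i> * of_real (snd p \<bullet> snd p) * fst p, \<i> * of_real (- (fst p \<bullet> fst p)) * snd p)"

lemma torus_field_rotate: "torus_field (torus_rotate a b p) = torus_rotate a b (torus_field p)"
  by (simp add: torus_field_def torus_rotate_def inner_mult_unit mult_ac)

lemma J_torus_direction:
  "J z \<bullet> (\<i> * of_real a * fst z, \<i> * of_real b * snd z) = a * (fst z \<bullet> fst z) + b * (snd z \<bullet> snd z)"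
  by (simp add: J_def inner_prod_def inner_complex_def algebra_simps)

context toric_gauge
begin

lemma torus_field_in_plane:
  assumes p: "p \<in> Y" shows "torus_field p \<in> \<xi> p"
  using N_torus_direction[OF Y_nonzero[OF p], of "snd p \<bullet> snd p" "- (fst p \<bullet> fst p)"]
    J_torus_direction[of p "snd p \<bullet> snd p" "- (fst p \<bullet> fst p)"] p
  by (simp add: contact_plane_eq torus_field_def)

text \<open>The coordinate of \<open>torus_field\<close> in the frame shows how it turns: along the flow \<open>fst p * snd p\<close> is
  rotated with speed \<open>2 (\<nu>1 + \<nu>2)\<close> and \<open>N p \<bullet> N p\<close> is constant.\<close>

lemma torus_field_frame:
  assumes p: "p \<in> Y" "generic p"
  shows "torus_field p = frame p (- \<i> * fst p * snd p / of_real (N p \<bullet> N p))"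
proof -
  have e: "\<nu>1 p * (Re (fst p) * Re (fst p) + Im (fst p) * Im (fst p))
      + \<nu>2 p * (Re (snd p) * Re (snd p) + Im (snd p) * Im (snd p)) = 1"
    using \<nu>_euler[OF p(2)] p(1) by (simp add: inner_complex_def)
  have 1: "torus_field p \<bullet> K (N p) = Re (- \<i> * fst p * snd p)"
    unfolding N_generic[OF p(2)] using e
    by (simp add: torus_field_def K_def inner_prod_def inner_complex_def) algebra
  have 2: "torus_field p \<bullet> J (K (N p)) = Im (- \<i> * fst p * snd p)"
    unfolding N_generic[OF p(2)] using e
    by (simp add: torus_field_def K_def J_def inner_prod_def inner_complex_def) algebra
  have "Complex ((torus_field p \<bullet> K (N p)) / (N p \<bullet> N p)) ((torus_field p \<bullet> J (K (N p))) / (N p \<bullet> N p))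
      = - \<i> * fst p * snd p / of_real (N p \<bullet> N p)"
    unfolding 1 2 complex_eq_iff using N_norm_pos[OF p(1)] by (simp add: field_simps)
  then show ?thesis using frame_coords[OF p(1) torus_field_in_plane[OF p(1)]] by simp
qed

end

context generic_orbit
begin

lemma shear_add: "shear t (u + v) = shear t u + shear t v"
  by (simp add: shear_def linear_add[OF linear_\<kappa>(1)] linear_add[OF linear_\<kappa>(2)] algebra_simps)

lemma shear_scaleR: "shear t (r *\<^sub>R u) = r *\<^sub>R shear t u"
  by (simp add: shear_def linear_scale[OF linear_\<kappa>(1)] linear_scale[OF linear_\<kappa>(2)] algebra_simps scaleR_conv_of_real)

lemma shear_torus_field: "shear t (torus_field y) = torus_field y"
  unfolding shear_def torus_field_def \<kappa>_torus by (simp add: zero_prod_def[symmetric])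

lemma shear_0: "shear 0 v = v"
  by (simp add: shear_def zero_prod_def[symmetric])

text \<open>A vector in the kernel of the shear is a torus direction, and the speeds do not vary in torus
  directions.\<close>

lemma shear_injective:
  assumes "shear t v = 0" shows "v = 0"
proof -
  have v: "v = (\<i> * of_real (- 2 * t * \<kappa>1 v) * fst y, \<i> * of_real (- 2 * t * \<kappa>2 v) * snd y)"
    using assms by (cases v) (simp add: shear_def zero_prod_def eq_neg_iff_add_eq_0)
  have "\<kappa>1 v = 0" using \<kappa>_torus(1)[of "- 2 * t * \<kappa>1 v" "- 2 * t * \<kappa>2 v"] v by simp
  moreover have "\<kappa>2 v = 0" using \<kappa>_torus(2)[of "- 2 * t * \<kappa>1 v" "- 2 * t * \<kappa>2 v"] v by simp
  ultimately show ?thesis using v by (simp add: zero_prod_def)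
qed

lemma transported_in_plane:
  assumes v: "v \<in> \<xi> y" shows "R t (shear t v) \<in> \<xi> (flow t y)"
proof -
  have vy: "N y \<bullet> v = 0" "J y \<bullet> v = 0" using v yY by (auto simp: contact_plane_eq)
  have "N (flow t y) \<bullet> R t (shear t v) = 0"
    using vy N_torus_direction[OF generic_nonzero[OF gen], of "2 * t * \<kappa>1 v" "2 * t * \<kappa>2 v"]
    by (simp add: N_flow[OF generic_nonzero[OF gen]] shear_def inner_add_right)
  moreover have "J (flow t y) \<bullet> R t (shear t v) = 0"
  proof -
    have "J (flow t y) \<bullet> R t (shear t v) = J y \<bullet> shear t v"
      by (simp add: flow_y rotate_J[symmetric])
    also have "\<dots> = 2 * t * \<kappa>1 v * (fst y \<bullet> fst y) + 2 * t * \<kappa>2 v * (snd y \<bullet> snd y)"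
      using J_torus_direction[of y "2 * t * \<kappa>1 v" "2 * t * \<kappa>2 v"] by (simp add: shear_def inner_add_right vy)
    also have "\<dots> = 2 * t * (\<kappa>1 v * (fst y \<bullet> fst y) + \<kappa>2 v * (snd y \<bullet> snd y))"
      by (simp add: algebra_simps)
    finally show ?thesis using \<kappa>_tangent[OF vy(1)] by simp
  qed
  moreover have "flow t y \<in> Y" using yY by simp
  ultimately show ?thesis by (simp add: contact_plane_eq)
qed

end

locale trivialized_orbit = generic_orbit G N y + trivialized G N \<tau> for G N y \<tau>
begin

abbreviation "A \<equiv> linearized_flow Y liouville_form \<tau> y"

lemma flow_in_Y: "flow t y \<in> Y"
  using yY by simp

lemma \<tau>_zero: "p \<in> Y \<Longrightarrow> v \<in> \<xi> p \<Longrightarrow> \<tau> p v = 0 \<Longrightarrow> v = 0"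
  using \<tau>inv_\<tau>[of p v] \<tau>inv_scaleR[of p 0 0] by simp

lemma linearized_flow_apply: "A t *v w = \<tau> (flow t y) (R t (shear t (\<tau>inv y w)))"
proof -
  have eq: "(\<lambda>w. \<tau> (reeb_flow Y liouville_form t y) (reeb_flow_deriv Y liouville_form t y (\<tau>inv y w)))
      = (\<lambda>w. \<tau> (flow t y) (R t (shear t (\<tau>inv y w))))"
  proof
    fix w
    have "N y \<bullet> \<tau>inv y w = 0" using \<tau>inv_in[OF yY, of w] yY by (simp add: contact_plane_eq)
    then show "\<tau> (reeb_flow Y liouville_form t y) (reeb_flow_deriv Y liouville_form t y (\<tau>inv y w))
      = \<tau> (flow t y) (R t (shear t (\<tau>inv y w)))"
      by (simp add: reeb_flow_eq[OF yY gen] reeb_flow_deriv_eq)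
  qed
  have "linear (\<lambda>w. \<tau> (flow t y) (R t (shear t (\<tau>inv y w))))"
  proof (rule linearI)
    fix u v
    show "\<tau> (flow t y) (R t (shear t (\<tau>inv y (u + v)))) =
       \<tau> (flow t y) (R t (shear t (\<tau>inv y u))) + \<tau> (flow t y) (R t (shear t (\<tau>inv y v)))"
      using \<tau>_add[OF flow_in_Y transported_in_plane transported_in_plane, OF \<tau>inv_in[OF yY] \<tau>inv_in[OF yY]]
      by (simp add: \<tau>inv_add[OF yY] shear_add rotate_add)
  next
    fix r v
    show "\<tau> (flow t y) (R t (shear t (\<tau>inv y (r *\<^sub>R v)))) = r *\<^sub>R \<tau> (flow t y) (R t (shear t (\<tau>inv y v)))"
      using \<tau>_scaleR[OF flow_in_Y transported_in_plane, OF \<tau>inv_in[OF yY]]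
      by (simp add: \<tau>inv_scaleR[OF yY] shear_scaleR rotate_scaleR)
  qed
  from fun_cong[OF matrix_vector_mul(2)[OF this], of w] show ?thesis
    unfolding linearized_flow_def eq .
qed

lemma continuous_on_R: "continuous_on S f \<Longrightarrow> continuous_on S (\<lambda>t. R t (f t))"
  unfolding torus_rotate_def cis_conv_exp by (intro continuous_intros)

lemma continuous_on_flow: "continuous_on S (\<lambda>t. flow t y)"
  unfolding flow_y by (intro continuous_on_R continuous_intros)

lemma matrix_path_A: assumes T: "T \<ge> 0" shows "matrix_path A T"
proof
  show "0 \<le> T" by fact
  fix v :: "real^2"
  show "continuous_on {0..T} (\<lambda>t. A t *v v)"
    unfolding linearized_flow_apply
  proof (rule continuous_on_\<tau>)
    show "continuous_on {0..T} (\<lambda>t. R t (shear t (\<tau>inv y v)))"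
      unfolding shear_def by (intro continuous_on_R continuous_intros)
  qed (use continuous_on_flow flow_in_Y transported_in_plane[OF \<tau>inv_in[OF yY]] in auto)
  show "A 0 *v v = v"
    by (simp add: linearized_flow_apply shear_0 \<tau>_\<tau>inv[OF yY])
  fix t assume "v \<noteq> 0"
  show "A t *v v \<noteq> 0"
  proof
    assume "A t *v v = 0"
    then have "R t (shear t (\<tau>inv y v)) = 0"
      unfolding linearized_flow_apply
      using \<tau>_zero[OF flow_in_Y transported_in_plane[OF \<tau>inv_in[OF yY]]] by blast
    then have "\<tau>inv y v = 0" using shear_injective by simp
    then have "v = \<tau> y 0" using \<tau>_\<tau>inv[OF yY, of v] by simp
    moreover have "\<tau> y 0 = 0" using \<tau>_scaleR[OF yY \<tau>inv_in[OF yY, of 0], of 0] by simp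
    ultimately show False using \<open>v \<noteq> 0\<close> by simp
  qed
qed

text \<open>The image of \<open>torus_field y\<close> under the linearized flow is \<open>torus_field\<close> at the later point. By
  \<open>frame_winding\<close> its rotation up to time \<open>T\<close> is \<open>(\<nu>1 + \<nu>2) T / pi\<close> with bounded error, and \<open>rot\<close> differs
  from this rotation by at most one turn.\<close>

theorem rotation_average: "((\<lambda>T. 1 / T * rot A T) \<longlongrightarrow> (\<nu>1 y + \<nu>2 y) / pi) at_top"
proof -
  (* the coordinate of torus_field along the orbit, by torus_field_frame, and its argument sigma *)
  define w where "w t = - \<i> * fst (flow t y) * snd (flow t y) / of_real (N (flow t y) \<bullet> N (flow t y))" for t
  define \<sigma> where "\<sigma> t = Arg (w 0) + 2 * (\<nu>1 y + \<nu>2 y) * t" for t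
  define v0 where "v0 = \<tau> y (torus_field y)"
  have y0: "y \<noteq> 0" using gen by (rule generic_nonzero)
  have NN: "N y \<bullet> N y \<noteq> 0" using N_norm_pos[OF yY] by simp
  have wt: "w t = w 0 * cis (2 * (\<nu>1 y + \<nu>2 y) * t)" for t
  proof -
    have "cis (2 * (\<nu>1 y + \<nu>2 y) * t) = cis (2 * \<nu>1 y * t) * cis (2 * \<nu>2 y * t)"
      by (simp add: cis_mult algebra_simps)
    then show ?thesis by (simp add: w_def flow_y N_rotate[OF y0] mult_ac)
  qed
  have w0: "w 0 \<noteq> 0" using gen NN by (simp add: w_def generic_def)
  have wn: "w t \<noteq> 0" for t using w0 by (subst wt) simp
  have w\<sigma>: "w t = of_real (cmod (w t)) * cis (\<sigma> t)" for t
  proof -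
    have "w 0 = of_real (cmod (w 0)) * cis (Arg (w 0))" using rcis_cmod_Arg[of "w 0"] by (simp add: rcis_def)
    then have "w t = of_real (cmod (w 0)) * (cis (Arg (w 0)) * cis (2 * (\<nu>1 y + \<nu>2 y) * t))"
      using wt[of t] by (simp add: mult.assoc)
    moreover have "cmod (w t) = cmod (w 0)" by (subst wt) (simp add: norm_mult)
    ultimately show ?thesis by (simp add: \<sigma>_def cis_mult)
  qed
  have Av: "A t *v v0 = \<tau> (flow t y) (frame (flow t y) (w t))" for t
  proof -
    have "A t *v v0 = \<tau> (flow t y) (R t (torus_field y))"
      by (simp add: linearized_flow_apply v0_def \<tau>inv_\<tau>[OF yY torus_field_in_plane[OF yY]] shear_torus_field)
    also have "R t (torus_field y) = torus_field (flow t y)" by (simp add: flow_y torus_field_rotate)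
    also have "\<dots> = frame (flow t y) (w t)"
      unfolding w_def using torus_field_frame[OF flow_in_Y] gen by simp
    finally show ?thesis .
  qed
  have v0: "v0 \<noteq> 0"
  proof
    assume "v0 = 0"
    then have "torus_field y = 0" using \<tau>_zero[OF yY torus_field_in_plane[OF yY]] by (simp add: v0_def)
    then show False using gen by (simp add: torus_field_def generic_def zero_prod_def)
  qed
  have cw: "continuous_on S w" for S
  proof (rule continuous_on_eq)
    show "continuous_on S (\<lambda>t. w 0 * cis (2 * (\<nu>1 y + \<nu>2 y) * t))"
      unfolding cis_conv_exp by (intro continuous_intros)
  qed (rule wt[symmetric])
  have c\<sigma>: "continuous_on S \<sigma>" for S unfolding \<sigma>_def by (intro continuous_intros)
  obtain M where M: "\<And>T. T \<ge> 0 \<Longrightarrow> \<exists>\<theta>. angle_lift (\<lambda>t. \<tau> (flow t y) (frame (flow t y) (w t))) T \<theta> \<and>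
        \<bar>(\<theta> T - \<theta> 0) - (\<sigma> T - \<sigma> 0) / (2 * pi)\<bar> \<le> M"
  proof -
    obtain M where M: "\<forall>p w \<sigma> T. T \<ge> 0 \<longrightarrow> continuous_on {0..T} p \<longrightarrow> p ` {0..T} \<subseteq> Y \<longrightarrow>
     continuous_on {0..T} w \<longrightarrow> continuous_on {0..T} \<sigma> \<longrightarrow>
     (\<forall>t\<in>{0..T}. w t \<noteq> 0 \<and> w t = of_real (cmod (w t)) * cis (\<sigma> t)) \<longrightarrow>
     (\<exists>\<theta>. angle_lift (\<lambda>t. \<tau> (p t) (frame (p t) (w t))) T \<theta> \<and>
        \<bar>(\<theta> T - \<theta> 0) - (\<sigma> T - \<sigma> 0) / (2 * pi)\<bar> \<le> M)"
      using frame_winding by blast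
    show ?thesis
    proof (rule that)
      fix T :: real assume T: "T \<ge> 0"
      have "(\<lambda>t. flow t y) ` {0..T} \<subseteq> Y" using flow_in_Y by blast
      moreover have "\<forall>t\<in>{0..T}. w t \<noteq> 0 \<and> w t = of_real (cmod (w t)) * cis (\<sigma> t)" using wn w\<sigma> by blast
      ultimately show "\<exists>\<theta>. angle_lift (\<lambda>t. \<tau> (flow t y) (frame (flow t y) (w t))) T \<theta> \<and>
        \<bar>(\<theta> T - \<theta> 0) - (\<sigma> T - \<sigma> 0) / (2 * pi)\<bar> \<le> M"
        using M[rule_format, OF T continuous_on_flow _ cw c\<sigma>] by blast
    qed
  qed
  let ?c = "(\<nu>1 y + \<nu>2 y) / pi"
  have bound: "\<bar>rot A T - ?c * T\<bar> \<le> M + 1" if T: "T \<ge> 0" for T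
  proof -
    interpret P: matrix_path A T using matrix_path_A[OF T] .
    obtain \<theta> where \<theta>: "angle_lift (\<lambda>t. A t *v v0) T \<theta>" "\<bar>(\<theta> T - \<theta> 0) - (\<sigma> T - \<sigma> 0) / (2 * pi)\<bar> \<le> M"
      using M[OF T] unfolding Av by blast
    have "rho A T v0 = \<theta> T - \<theta> 0" by (rule rho_eq[OF \<theta>(1) T P.inj[OF _ v0]])
    moreover have "(\<sigma> T - \<sigma> 0) / (2 * pi) = ?c * T" by (simp add: \<sigma>_def field_simps)
    ultimately have "\<bar>rho A T v0 - ?c * T\<bar> \<le> M" using \<theta>(2) by simp
    moreover have "\<bar>a - c\<bar> \<le> M + 1" if "\<bar>a - b\<bar> \<le> 1" "\<bar>b - c\<bar> \<le> M" for a b c :: real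
      using that by linarith
    ultimately show ?thesis using P.rot_close_to_rho[OF v0] by blast
  qed
  have "((\<lambda>T. 1 / T * rot A T - ?c) \<longlongrightarrow> 0) at_top"
  proof (rule Lim_null_comparison)
    show "\<forall>\<^sub>F T in at_top. norm (1 / T * rot A T - ?c) \<le> (M + 1) / T"
      using eventually_gt_at_top[of 0]
    proof eventually_elim
      case (elim T)
      then have "1 / T * rot A T - ?c = (rot A T - ?c * T) / T" by (simp add: diff_divide_distrib)
      then have "norm (1 / T * rot A T - ?c) = \<bar>rot A T - ?c * T\<bar> / T" using elim by (simp add: abs_divide)
      also have "\<dots> \<le> (M + 1) / T" using bound[of T] elim by (intro divide_right_mono) auto
      finally show ?case .
    qed
    show "((\<lambda>T. (M + 1) / T) \<longlongrightarrow> 0) at_top"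
      by (intro tendsto_divide_0[OF tendsto_const] filterlim_at_top_imp_at_infinity filterlim_ident)
  qed
  then show ?thesis by (simp add: LIM_zero_iff)
qed

end

context generic_orbit
begin

text \<open>The existence of the trivialization \<open>triv\<close> makes the limit unique.\<close>

theorem rotation_number_eq: "rotation_number Y liouville_form y = (\<nu>1 y + \<nu>2 y) / pi"
  unfolding rotation_number_def
proof (rule the_equality)
  have t: "trivialized_orbit G N y \<tau>" if "symplectic_trivialization Y liouville_form \<tau>" for \<tau>
    using that by unfold_locales
  then show all: "\<forall>\<tau>. symplectic_trivialization Y liouville_form \<tau> \<longrightarrow>
      ((\<lambda>T. 1 / T * rot (linearized_flow Y liouville_form \<tau> y) T) \<longlongrightarrow> (\<nu>1 y + \<nu>2 y) / pi) at_top"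
    using trivialized_orbit.rotation_average by blast
  fix r assume "\<forall>\<tau>. symplectic_trivialization Y liouville_form \<tau> \<longrightarrow>
      ((\<lambda>T. 1 / T * rot (linearized_flow Y liouville_form \<tau> y) T) \<longlongrightarrow> r) at_top"
  then have "((\<lambda>T. 1 / T * rot (linearized_flow Y liouville_form triv y) T) \<longlongrightarrow> r) at_top"
    using symplectic_trivialization_triv by blast
  moreover have "((\<lambda>T. 1 / T * rot (linearized_flow Y liouville_form triv y) T) \<longlongrightarrow> (\<nu>1 y + \<nu>2 y) / pi) at_top"
    using all symplectic_trivialization_triv by blast
  ultimately show "r = (\<nu>1 y + \<nu>2 y) / pi" by (rule tendsto_unique[OF trivial_limit_at_top_linorder])
qed

end

section \<open>Integrating the rotation number\<close>

lemma emeasure_square_sublevel: "emeasure lborel {z::complex. pi * (cmod z)\<^sup>2 \<le> a} = ennreal a"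
proof (cases "a \<ge> 0")
  case True
  have le: "pi * (cmod z)\<^sup>2 \<le> a \<longleftrightarrow> cmod z \<le> sqrt (a / pi)" for z
  proof -
    have "pi * (cmod z)\<^sup>2 \<le> a \<longleftrightarrow> (cmod z)\<^sup>2 \<le> a / pi" by (simp add: pos_le_divide_eq mult.commute)
    also have "\<dots> \<longleftrightarrow> sqrt ((cmod z)\<^sup>2) \<le> sqrt (a / pi)" by (rule real_sqrt_le_iff[symmetric])
    finally show ?thesis by simp
  qed
  have "{z::complex. pi * (cmod z)\<^sup>2 \<le> a} = cball 0 (sqrt (a / pi))"
    by (intro set_eqI) (simp only: mem_Collect_eq mem_cball dist_0_norm le)
  then show ?thesis using True by (simp add: emeasure_cball unit_ball_vol_2)
next
  case False
  then have "{z::complex. pi * (cmod z)\<^sup>2 \<le> a} = {}"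
    by (auto simp: not_le intro: less_le_trans)
  then show ?thesis using False by (simp add: ennreal_neg)
qed

lemma distr_lborel_complex_square:
  "distr lborel borel (\<lambda>z::complex. pi * (cmod z)\<^sup>2) = density lborel (indicator {0::real..})"
    (is "?M = ?N")
proof (rule measure_eqI_generator_eq[where E = "range (\<lambda>a::real. {..a})" and \<Omega> = UNIV and A = "\<lambda>n. {..real n}"])
  show "Int_stable (range (\<lambda>a::real. {..a}))" by (auto simp: Int_stable_def)
  show "sets ?M = sigma_sets UNIV (range (\<lambda>a::real. {..a}))" "sets ?N = sigma_sets UNIV (range (\<lambda>a::real. {..a}))"
    by (simp_all add: borel_eq_atMost)
  have M: "emeasure ?M {..a} = ennreal a" for a
    using emeasure_square_sublevel[of a] by (simp add: emeasure_distr vimage_def)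
  show "emeasure ?M {..real n} \<noteq> \<infinity>" for n using M by simp
  fix X :: "real set" assume "X \<in> range (\<lambda>a. {..a})"
  then obtain a where X: "X = {..a}" by blast
  have "emeasure ?N {..a} = (\<integral>\<^sup>+x. indicator {0..} x * indicator {..a} x \<partial>lborel)"
    by (rule emeasure_density) auto
  also have "\<dots> = (\<integral>\<^sup>+x. indicator {0..a} x \<partial>lborel)"
    by (rule nn_integral_cong) (auto split: split_indicator)
  also have "\<dots> = emeasure lborel {0..a}" by simp
  also have "\<dots> = ennreal a" by (cases "0 \<le> a") (simp_all add: ennreal_neg)
  finally show "emeasure ?M X = emeasure ?N X" using M X by simp
next
  show "(\<Union>n. {..real n}) = UNIV" using real_arch_simple by auto
qed auto

lemma nn_integral_complex_square:
  assumes f: "f \<in> borel_measurable borel"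
  shows "(\<integral>\<^sup>+z. f (pi * (cmod z)\<^sup>2) \<partial>lborel) = (\<integral>\<^sup>+x. f x * indicator {0..} x \<partial>lborel)"
proof -
  have "(\<integral>\<^sup>+z. f (pi * (cmod z)\<^sup>2) \<partial>lborel) = (\<integral>\<^sup>+x. f x \<partial>distr lborel borel (\<lambda>z::complex. pi * (cmod z)\<^sup>2))"
    using f by (subst nn_integral_distr) auto
  also have "\<dots> = (\<integral>\<^sup>+x. indicator {0..} x * f x \<partial>lborel)"
    unfolding distr_lborel_complex_square using f by (subst nn_integral_density) auto
  finally show ?thesis by (simp add: mult.commute)
qed

text \<open>The moment map of the torus action.\<close>

definition moment :: "c2 \<Rightarrow> real \<times> real" where
  "moment z = (pi * (cmod (fst z))\<^sup>2, pi * (cmod (snd z))\<^sup>2)"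

text \<open>The disc \<open>pi |z|\<^sup>2 \<le> a\<close> has area \<open>a\<close>, so in each factor the moment map carries Lebesgue measure to
  Lebesgue measure on the half-line.\<close>

lemma nn_integral_moment:
  assumes f: "f \<in> borel_measurable borel"
  shows "(\<integral>\<^sup>+z. f (moment z) \<partial>lborel) = (\<integral>\<^sup>+x. f x * indicator ({0..} \<times> {0..}) x \<partial>lborel)"
proof -
  have fp: "f \<in> borel_measurable (borel \<Otimes>\<^sub>M borel)" using f by (simp add: borel_prod)
  have "(\<integral>\<^sup>+z. f (moment z) \<partial>lborel) = (\<integral>\<^sup>+z. f (pi * (cmod (fst z))\<^sup>2, pi * (cmod (snd z))\<^sup>2) \<partial>(lborel \<Otimes>\<^sub>M lborel))"
    by (simp add: moment_def lborel_prod)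
  also have "\<dots> = (\<integral>\<^sup>+z1. \<integral>\<^sup>+z2. f (pi * (cmod z1)\<^sup>2, pi * (cmod z2)\<^sup>2) \<partial>lborel \<partial>lborel)"
    using fp by (subst lborel.nn_integral_fst[symmetric]) auto
  also have "\<dots> = (\<integral>\<^sup>+z1. (\<lambda>x1. \<integral>\<^sup>+x2. f (x1, x2) * indicator {0..} x2 \<partial>lborel) (pi * (cmod z1)\<^sup>2) \<partial>lborel)"
    using fp by (intro nn_integral_cong) (subst nn_integral_complex_square, auto)
  also have "\<dots> = (\<integral>\<^sup>+x1. (\<integral>\<^sup>+x2. f (x1, x2) * indicator {0..} x2 \<partial>lborel) * indicator {0..} x1 \<partial>lborel)"
    using fp by (intro nn_integral_complex_square) auto
  also have "\<dots> = (\<integral>\<^sup>+x1. \<integral>\<^sup>+x2. f (x1, x2) * indicator ({0..} \<times> {0..}) (x1, x2) \<partial>lborel \<partial>lborel)"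
    by (intro nn_integral_cong) (auto intro!: nn_integral_cong simp: indicator_def)
  also have "\<dots> = (\<integral>\<^sup>+x. f x * indicator ({0..} \<times> {0..}) x \<partial>(lborel \<Otimes>\<^sub>M lborel))"
    using fp by (subst lborel.nn_integral_fst[symmetric]) auto
  finally show ?thesis by (simp add: lborel_prod)
qed

lemma has_integral_open_left:
  fixes f :: "real \<Rightarrow> real"
  assumes "(f has_integral I) {0..s}" shows "(f has_integral I) {0<..s}"
proof -
  have 1: "negligible {x \<in> {0..s} - {0<..s}. f x \<noteq> 0}"
    by (rule negligible_subset[of "{0}"]) auto
  have 2: "negligible {x \<in> {0<..s} - {0..s}. f x \<noteq> 0}"
    by (rule negligible_subset[of "{0}"]) auto
  from has_integral_spike_set_eq[OF 1 2] assms show ?thesis by simp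
qed

text \<open>As \<open>h\<close> is increasing, the sublevel set is an interval that ends where \<open>h = 1\<close>. If \<open>h 0 \<ge> 1\<close>, it is
  empty, and \<open>ennreal\<close> truncates the right-hand side to zero.\<close>

lemma nn_integral_derivative_sublevel:
  fixes h h' :: "real \<Rightarrow> real"
  assumes cont: "continuous_on {0..} h" and der: "\<And>x. x > 0 \<Longrightarrow> (h has_real_derivative h' x) (at x)"
    and pos: "\<And>x. x > 0 \<Longrightarrow> h' x > 0" and unb: "X > 0" "h X > 1"
  shows "(\<integral>\<^sup>+x. ennreal (h' x) * indicator {x. x > 0 \<and> h x \<le> 1} x \<partial>lborel) = ennreal (1 - h 0)"
proof -
  have mono: "h x < h z" if "0 \<le> x" "x < z" for x z
  proof (rule DERIV_pos_imp_increasing_open[OF that(2)])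
    show "\<exists>d. (h has_real_derivative d) (at u) \<and> d > 0" if "x < u" "u < z" for u
      using der[of u] pos[of u] that \<open>0 \<le> x\<close> by (intro exI[of _ "h' u"]) auto
    show "continuous_on {x..z} h" by (rule continuous_on_subset[OF cont]) (use that in auto)
  qed
  show ?thesis
  proof (cases "h 0 < 1")
    case False
    have "{x. x > 0 \<and> h x \<le> 1} = {}" using mono[of 0] False by force
    then show ?thesis using False by (simp add: ennreal_neg)
  next
    case True
    obtain s where s: "0 \<le> s" "s \<le> X" "h s = 1"
      using IVT'[of h 0 1 X] True unb continuous_on_subset[OF cont, of "{0..X}"] by auto
    have s0: "s > 0" using s True by (cases "s = 0") auto
    have "h x \<le> 1 \<longleftrightarrow> x \<le> s" if "x > 0" for x
      using mono[of x s] mono[of s x] s that by (cases x s rule: linorder_cases) auto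
    then have set: "{x. x > 0 \<and> h x \<le> 1} = {0<..s}" by auto
    have "(h' has_integral (h s - h 0)) {0..s}"
      by (rule fundamental_theorem_of_calculus_interior)
         (use s der continuous_on_subset[OF cont] in \<open>auto simp: has_real_derivative_iff_has_vector_derivative[symmetric]\<close>)
    then have "(h' has_integral (1 - h 0)) {0<..s}"
      unfolding s(3) by (rule has_integral_open_left)
    then have "(\<integral>\<^sup>+x. ennreal (h' x) * indicator {0<..s} x \<partial>lborel) = ennreal (1 - h 0)"
      by (intro nn_integral_has_integral_lebesgue') (use pos in \<open>auto intro: less_imp_le\<close>)
    then show ?thesis by (simp add: set)
  qed
qed

lemma nn_integral_triangle:
  assumes "b > 0" shows "(\<integral>\<^sup>+x. ennreal (1 - x / b) * indicator {0<..} x \<partial>lborel) = ennreal (b / 2)"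
proof -
  have i: "((\<lambda>x. 1 - x / b) has_integral (b - b\<^sup>2 / (2 * b)) - (0 - 0\<^sup>2 / (2 * b))) {0..b}"
    by (rule fundamental_theorem_of_calculus)
       (use assms in \<open>auto intro!: derivative_eq_intros simp: has_real_derivative_iff_has_vector_derivative[symmetric]\<close>)
  have e: "(b - b\<^sup>2 / (2 * b)) - (0 - 0\<^sup>2 / (2 * b)) = b / 2" using assms by (simp add: power2_eq_square field_simps)
  have "((\<lambda>x. 1 - x / b) has_integral b / 2) {0<..b}"
    using has_integral_open_left[OF i] unfolding e .
  then have "(\<integral>\<^sup>+x. ennreal (1 - x / b) * indicator {0<..b} x \<partial>lborel) = ennreal (b / 2)"
    by (intro nn_integral_has_integral_lebesgue') (use assms in \<open>auto simp: field_simps\<close>)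
  moreover have "(\<integral>\<^sup>+x. ennreal (1 - x / b) * indicator {0<..b} x \<partial>lborel) =
      (\<integral>\<^sup>+x. ennreal (1 - x / b) * indicator {0<..} x \<partial>lborel)"
  proof (rule nn_integral_cong)
    fix x :: real
    have "ennreal (1 - x / b) = 0" if "x > b" using that assms by (intro ennreal_neg) (simp add: field_simps)
    then show "ennreal (1 - x / b) * indicator {0<..b} x = ennreal (1 - x / b) * indicator {0<..} x"
      by (auto split: split_indicator)
  qed
  ultimately show ?thesis by simp
qed

text \<open>A right inverse of the moment map on the quadrant.\<close>

definition sqrt_point :: "real \<times> real \<Rightarrow> c2" where
  "sqrt_point x = (of_real (sqrt (fst x / pi)), of_real (sqrt (snd x / pi)))"

lemma root_moment: "\<exists>a b. z = torus_rotate a b (sqrt_point (moment z))"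
proof -
  have "u = cis (Arg u) * of_real (sqrt (pi * (cmod u)\<^sup>2 / pi))" for u
    using rcis_cmod_Arg[of u] by (simp add: rcis_def mult.commute)
  then show ?thesis unfolding torus_rotate_def sqrt_point_def moment_def fst_conv snd_conv by (metis prod.collapse)
qed

lemma generic_root: "generic (sqrt_point x) \<longleftrightarrow> fst x \<noteq> 0 \<and> snd x \<noteq> 0"
  by (simp add: generic_def sqrt_point_def)

lemma continuous_on_root: "continuous_on S sqrt_point"
  unfolding sqrt_point_def by (intro continuous_intros) auto

lemma AE_generic: "AE z in lborel. generic z"
proof -
  have "{z::c2. fst z = 0} = {0} \<times> UNIV" "{z::c2. snd z = 0} = UNIV \<times> {0}" by auto
  then have "{z::c2. fst z = 0} \<in> null_sets (lborel \<Otimes>\<^sub>M lborel)" "{z::c2. snd z = 0} \<in> null_sets (lborel \<Otimes>\<^sub>M lborel)"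
    by (auto simp: null_sets_def lborel.emeasure_pair_measure_Times)
  then have "{z::c2. fst z = 0} \<union> {z. snd z = 0} \<in> null_sets lborel" by (auto simp: lborel_prod)
  then show ?thesis by (rule AE_I') (auto simp: generic_def)
qed

context toric_gauge
begin

text \<open>The restriction avoids the origin, where the values of \<open>N\<close> are arbitrary.\<close>

lemma measurable_N0: "(\<lambda>z. indicator (-{0}) z *\<^sub>R N z) \<in> borel_measurable borel"
  by (rule borel_measurable_continuous_on_indicator[OF _ continuous_on_N]) auto

lemma measurable_\<nu> [measurable]: "\<nu>1 \<in> borel_measurable borel" "\<nu>2 \<in> borel_measurable borel"
proof -
  let ?N = "\<lambda>z. indicator (-{0}) z *\<^sub>R N z"
  have f: "(\<lambda>z. fst (?N z)) \<in> borel_measurable borel" "(\<lambda>z. snd (?N z)) \<in> borel_measurable borel"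
    by (rule measurable_compose[OF measurable_N0], rule borel_measurable_continuous_onI, intro continuous_intros)+
  have g: "(fst :: c2 \<Rightarrow> complex) \<in> borel_measurable borel" "(snd :: c2 \<Rightarrow> complex) \<in> borel_measurable borel"
    by (rule borel_measurable_continuous_onI, intro continuous_intros)+
  have "\<nu>1 = (\<lambda>z. (fst (?N z) \<bullet> fst z) / (fst z \<bullet> fst z))" "\<nu>2 = (\<lambda>z. (snd (?N z) \<bullet> snd z) / (snd z \<bullet> snd z))"
    by (auto simp: \<nu>1_def \<nu>2_def fun_eq_iff zero_prod_def split: split_indicator)
  from this(1) show "\<nu>1 \<in> borel_measurable borel"
    by (rule ssubst) (intro borel_measurable_divide borel_measurable_inner f g)
  from \<open>\<nu>2 = _\<close> show "\<nu>2 \<in> borel_measurable borel"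
    by (rule ssubst) (intro borel_measurable_divide borel_measurable_inner f g)
qed

lemma \<nu>_proj: assumes z: "z \<noteq> 0" shows "\<nu>1 (proj z) = G z * \<nu>1 z" "\<nu>2 (proj z) = G z * \<nu>2 z"
  using pos[OF z] by (simp_all add: \<nu>1_def \<nu>2_def N_proj[OF z] field_simps)

lemma G_root: "G z = G (sqrt_point (moment z))"
  using root_moment[of z] torus by metis

lemma \<nu>_root: assumes z: "z \<noteq> 0" shows "\<nu>1 z = \<nu>1 (sqrt_point (moment z))" "\<nu>2 z = \<nu>2 (sqrt_point (moment z))"
proof -
  obtain a b where ab: "z = torus_rotate a b (sqrt_point (moment z))" using root_moment by blast
  then have "sqrt_point (moment z) \<noteq> 0" using z rotate_eq_0 by metis
  then show "\<nu>1 z = \<nu>1 (sqrt_point (moment z))" "\<nu>2 z = \<nu>2 (sqrt_point (moment z))" using \<nu>_rotate ab by metis+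
qed

text \<open>The gauge of the moment image of the domain. It is the square of \<open>G\<close> because the moment map is
  quadratic. Its partial derivatives are \<open>mgauge1\<close> and \<open>mgauge2\<close>, by \<open>mgauge_derivative\<close>.\<close>

definition mgauge :: "real \<times> real \<Rightarrow> real" where
  "mgauge x = (G (sqrt_point x))\<^sup>2"

definition mgauge1 :: "real \<times> real \<Rightarrow> real" where
  "mgauge1 x = G (sqrt_point x) * \<nu>1 (sqrt_point x) / pi"

definition mgauge2 :: "real \<times> real \<Rightarrow> real" where
  "mgauge2 x = G (sqrt_point x) * \<nu>2 (sqrt_point x) / pi"

lemma continuous_on_mgauge: "continuous_on S mgauge"
  unfolding mgauge_def by (intro continuous_intros continuous_on_compose2[OF cont continuous_on_root]) auto

lemma mgauge_derivative:
  assumes x: "x1 > 0" "x2 > 0"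
  shows "((\<lambda>t. mgauge (t, x2)) has_real_derivative mgauge1 (x1, x2)) (at x1)"
    and "((\<lambda>t. mgauge (x1, t)) has_real_derivative mgauge2 (x1, x2)) (at x2)"
proof -
  let ?z = "sqrt_point (x1, x2)"
  have gen: "generic ?z" using x by (simp add: generic_root)
  note N = N_generic[OF gen]
  have N1: "fst (N ?z) = of_real (\<nu>1 ?z * sqrt (x1 / pi))" and N2: "snd (N ?z) = of_real (\<nu>2 ?z * sqrt (x2 / pi))"
    by (subst N; simp add: sqrt_point_def)+
  note dz = deriv[OF generic_nonzero[OF gen]]
  have s: "((\<lambda>t. sqrt (t / pi)) has_real_derivative 1 / (2 * pi * sqrt (a / pi))) (at a)" if "a > 0" for a
    using that by (auto intro!: derivative_eq_intros simp: field_simps)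
  have c: "((\<lambda>t. complex_of_real (sqrt (t / pi))) has_derivative (\<lambda>h. of_real (h * (1 / (2 * pi * sqrt (a / pi)))))) (at a)"
    if "a > 0" for a
    by (rule has_derivative_eq_rhs[OF has_derivative_of_real[OF s[OF that, unfolded has_field_derivative_def]]])
       (simp add: fun_eq_iff mult_ac)
  have sq: "((\<lambda>t. (f t)\<^sup>2) has_real_derivative 2 * f a * d) (at a)" if "(f has_real_derivative d) (at a)" for f :: "real \<Rightarrow> real" and a d
    using that by (auto intro!: derivative_eq_intros)
  have "((\<lambda>t. sqrt_point (t, x2)) has_derivative (\<lambda>h. (of_real (h * (1 / (2 * pi * sqrt (x1 / pi)))), 0))) (at x1)"
    unfolding sqrt_point_def fst_conv snd_conv by (intro has_derivative_Pair c x) auto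
  from has_derivative_compose[OF this dz]
  have "((\<lambda>t. G (sqrt_point (t, x2))) has_derivative (\<lambda>h. N ?z \<bullet> (of_real (h * (1 / (2 * pi * sqrt (x1 / pi)))), 0))) (at x1)" .
  moreover have "(\<lambda>h. N ?z \<bullet> (of_real (h * (1 / (2 * pi * sqrt (x1 / pi)))), 0)) = (\<lambda>h. (\<nu>1 ?z / (2 * pi)) * h)"
    using x by (simp add: N1 N2 inner_prod_def inner_complex_def fun_eq_iff)
  ultimately have "((\<lambda>t. G (sqrt_point (t, x2))) has_derivative (\<lambda>h. (\<nu>1 ?z / (2 * pi)) * h)) (at x1)" by simp
  then have "((\<lambda>t. G (sqrt_point (t, x2))) has_real_derivative (\<nu>1 ?z / (2 * pi))) (at x1)"
    by (rule has_derivative_imp_has_field_derivative) simp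
  from sq[OF this] show "((\<lambda>t. mgauge (t, x2)) has_real_derivative mgauge1 (x1, x2)) (at x1)"
    by (simp add: mgauge_def mgauge1_def)
  have "((\<lambda>t. sqrt_point (x1, t)) has_derivative (\<lambda>h. (0, of_real (h * (1 / (2 * pi * sqrt (x2 / pi))))))) (at x2)"
    unfolding sqrt_point_def fst_conv snd_conv by (intro has_derivative_Pair c x) auto
  from has_derivative_compose[OF this dz]
  have "((\<lambda>t. G (sqrt_point (x1, t))) has_derivative (\<lambda>h. N ?z \<bullet> (0, of_real (h * (1 / (2 * pi * sqrt (x2 / pi))))))) (at x2)" .
  moreover have "(\<lambda>h. N ?z \<bullet> (0, of_real (h * (1 / (2 * pi * sqrt (x2 / pi)))))) = (\<lambda>h. (\<nu>2 ?z / (2 * pi)) * h)"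
    using x by (simp add: N1 N2 inner_prod_def inner_complex_def fun_eq_iff)
  ultimately have "((\<lambda>t. G (sqrt_point (x1, t))) has_derivative (\<lambda>h. (\<nu>2 ?z / (2 * pi)) * h)) (at x2)" by simp
  then have "((\<lambda>t. G (sqrt_point (x1, t))) has_real_derivative (\<nu>2 ?z / (2 * pi))) (at x2)"
    by (rule has_derivative_imp_has_field_derivative) simp
  from sq[OF this] show "((\<lambda>t. mgauge (x1, t)) has_real_derivative mgauge2 (x1, x2)) (at x2)"
    by (simp add: mgauge_def mgauge2_def)
qed

abbreviation "width \<equiv> pi / (G (1, 0))\<^sup>2"

abbreviation "height \<equiv> pi / (G (0, 1))\<^sup>2"

lemma G_axes: "r \<ge> 0 \<Longrightarrow> G (of_real r, 0) = r * G (1, 0)" "r \<ge> 0 \<Longrightarrow> G (0, of_real r) = r * G (0, 1)"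
  using homog[of r "(1, 0)"] homog[of r "(0, 1)"] by (simp_all add: scaleR_conv_of_real)

lemma mgauge_axes: "x \<ge> 0 \<Longrightarrow> mgauge (x, 0) = x / width" "x \<ge> 0 \<Longrightarrow> mgauge (0, x) = x / height"
  by (simp_all add: mgauge_def sqrt_point_def G_axes power_mult_distrib)

lemma axes_pos: "G (1, 0) > 0" "G (0, 1) > 0" "width > 0" "height > 0"
  using pos[of "(1, 0)"] pos[of "(0, 1)"] by (auto simp: zero_prod_def)

lemma mgauge_unbounded: "\<exists>t>0. mgauge (t, x) > 1" "\<exists>t>0. mgauge (x, t) > 1"
proof -
  obtain B where B: "B > 0" "\<And>z. norm z \<le> B * G z" using norm_bounds by blast
  have *: "mgauge p > 1" if "norm (sqrt_point p) > B" for p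
  proof -
    have "G (sqrt_point p) > 1"
    proof (rule ccontr)
      assume "\<not> G (sqrt_point p) > 1"
      then have "B * G (sqrt_point p) \<le> B * 1" using B(1) by (intro mult_left_mono) auto
      then show False using B(2)[of "sqrt_point p"] that by simp
    qed
    then show ?thesis by (simp add: mgauge_def one_less_power)
  qed
  define t where "t = pi * (B + 1)\<^sup>2"
  have t: "t > 0" "sqrt (t / pi) = B + 1" using B by (simp_all add: t_def)
  have "norm (sqrt_point (t, x)) \<ge> norm (fst (sqrt_point (t, x)))" "norm (sqrt_point (x, t)) \<ge> norm (snd (sqrt_point (x, t)))"
    by (metis norm_fst_le prod.collapse, metis norm_snd_le prod.collapse)
  then have "norm (sqrt_point (t, x)) > B" "norm (sqrt_point (x, t)) > B" using t B(1) by (simp_all add: sqrt_point_def)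
  then show "\<exists>t>0. mgauge (t, x) > 1" "\<exists>t>0. mgauge (x, t) > 1" using * t(1) by blast+
qed

end

text \<open>The function \<open>f\<close> is measurable for the completion because it differs from \<open>g\<close> on a null set only. This
  is used for \<open>rotation_number\<close>, which is known only at generic points.\<close>

lemma integral_completion_cong_AE:
  fixes f g :: "'a \<Rightarrow> real"
  assumes g: "g \<in> borel_measurable M" and ae: "AE x in M. f x = g x"
  shows "(\<integral>x. f x \<partial>completion M) = (\<integral>x. g x \<partial>M)"
proof -
  obtain Z where Z: "Z \<in> null_sets M" "{x \<in> space M. f x \<noteq> g x} \<subseteq> Z"
    using AE_E[OF ae] by (metis (no_types, lifting) null_setsI)
  have Zc: "Z \<in> null_sets (completion M)" using Z(1) by (rule null_sets_completionI)
  have gm: "g \<in> borel_measurable (completion M)" using g by (rule measurable_completion)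
  have fm: "f \<in> borel_measurable (completion M)"
  proof (rule measurableI)
    fix S :: "real set" assume S: "S \<in> sets borel"
    have "f -` S \<inter> space M = (g -` S \<inter> space M - Z) \<union> (f -` S \<inter> space M \<inter> Z)" using Z(2) by auto
    moreover have "f -` S \<inter> space M \<inter> Z \<in> null_sets (completion M)"
      by (rule null_sets_completion_subset[OF _ Zc]) auto
    moreover have "g -` S \<inter> space M \<in> sets (completion M)" using measurable_sets[OF gm S] by simp
    ultimately show "f -` S \<inter> space (completion M) \<in> sets (completion M)"
      using Zc by (metis null_setsD2 sets.Diff sets.Un space_completion)
  qed auto
  have "AE x in completion M. f x = g x" using ae by (rule AE_completion)
  from integral_cong_AE[OF fm gm this] show ?thesis using integral_completion[OF g] by simp
qed

lemma moment_generic: "generic z \<longleftrightarrow> fst (moment z) > 0 \<and> snd (moment z) > 0"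
  by (simp add: generic_def moment_def zero_less_mult_iff)

context toric_gauge
begin

lemma rotation_number_generic: "y \<in> Y \<Longrightarrow> generic y \<Longrightarrow> rotation_number Y liouville_form y = (\<nu>1 y + \<nu>2 y) / pi"
  by (rule generic_orbit.rotation_number_eq) (unfold_locales; simp)

text \<open>The rotation number, extended to be constant along rays, is the sum of the partial derivatives of
  \<open>mgauge\<close> in moment coordinates.\<close>

lemma rotation_density_proj:
  assumes z: "z \<noteq> 0" shows "(\<nu>1 (proj z) + \<nu>2 (proj z)) / pi = mgauge1 (moment z) + mgauge2 (moment z)"
  unfolding mgauge1_def mgauge2_def \<nu>_proj[OF z] G_root[of z, symmetric] \<nu>_root[OF z, symmetric]
  by (simp add: add_divide_distrib)

lemma mgauge_moment: "mgauge (moment z) = (G z)\<^sup>2"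
  using G_root[of z] by (simp add: mgauge_def)

lemma AE_cone_generic: "AE y in cone_measure. generic y"
proof -
  have gb: "{z::c2. \<not> generic z} \<in> sets borel"
  proof -
    have "closed {z::c2. fst z = 0}" "closed {z::c2. snd z = 0}" by (intro closed_Collect_eq continuous_intros)+
    then have "closed ({z::c2. fst z = 0} \<union> {z. snd z = 0})" by (rule closed_Un)
    moreover have "{z::c2. \<not> generic z} = {z. fst z = 0} \<union> {z. snd z = 0}" by (auto simp: generic_def)
    ultimately show ?thesis by (metis borel_closed)
  qed
  define B where "B = Y \<inter> {z. \<not> generic z}"
  have B: "B \<in> sets (restrict_space borel Y)" using gb Y_borel by (auto simp: B_def sets_Y)
  have "AE z in lborel. \<not> (z \<noteq> 0 \<and> G z \<le> 1 \<and> proj z \<in> B)"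
    using AE_generic
  proof eventually_elim
    case (elim z)
    then have "generic (proj z)" using pos[OF generic_nonzero[OF elim]] by (simp add: generic_def)
    then show ?case by (simp add: B_def)
  qed
  from emeasure_eq_0_AE[OF this] have "emeasure cone_measure B = 0"
    unfolding emeasure_cone[OF B] by simp
  then have "B \<in> null_sets cone_measure" using B sets_cone_measure by auto
  moreover have "space cone_measure = Y" by (simp add: cone_measure_def space_restrict_space)
  ultimately show ?thesis by (intro AE_I'[of B]) (auto simp: B_def)
qed

end

locale positive_toric_gauge = toric_gauge +
  assumes \<nu>_pos: "generic z \<Longrightarrow> \<nu>1 z > 0" "generic z \<Longrightarrow> \<nu>2 z > 0"
begin

lemma mgauge_pos: "fst x > 0 \<Longrightarrow> snd x > 0 \<Longrightarrow> mgauge1 x > 0" "fst x > 0 \<Longrightarrow> snd x > 0 \<Longrightarrow> mgauge2 x > 0"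
  using \<nu>_pos[of "sqrt_point x"] pos[OF generic_nonzero, of "sqrt_point x"]
  by (simp_all add: mgauge1_def mgauge2_def generic_root)

definition mdomain :: "(real \<times> real) set" where
  "mdomain = {x. fst x > 0 \<and> snd x > 0 \<and> mgauge x \<le> 1}"

lemma measurable_root: "sqrt_point \<in> borel_measurable borel"
  by (rule borel_measurable_continuous_onI[OF continuous_on_root])

lemma measurable_mgauge [measurable]: "mgauge1 \<in> borel_measurable borel" "mgauge2 \<in> borel_measurable borel"
proof -
  have "(\<lambda>x. G (sqrt_point x)) \<in> borel_measurable borel" "(\<lambda>x. \<nu>1 (sqrt_point x)) \<in> borel_measurable borel"
    "(\<lambda>x. \<nu>2 (sqrt_point x)) \<in> borel_measurable borel"
    using measurable_compose[OF measurable_root] measurable_G measurable_\<nu> by blast+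
  then show "mgauge1 \<in> borel_measurable borel" "mgauge2 \<in> borel_measurable borel"
    unfolding mgauge1_def[abs_def] mgauge2_def[abs_def] by (auto intro!: borel_measurable_divide borel_measurable_times)
qed

lemma mdomain_borel [measurable]: "mdomain \<in> sets borel"
proof -
  have "open {x::real\<times>real. fst x > 0}" "open {x::real\<times>real. snd x > 0}" by (intro open_Collect_less continuous_intros)+
  moreover have "closed {x. mgauge x \<le> 1}" by (intro closed_Collect_le continuous_on_mgauge continuous_intros)
  moreover have "mdomain = {x. fst x > 0} \<inter> {x. snd x > 0} \<inter> {x. mgauge x \<le> 1}" by (auto simp: mdomain_def)
  ultimately show ?thesis by (metis borel_open borel_closed sets.Int)
qed

text \<open>On the horizontal line at height \<open>x2\<close>, \<open>mgauge\<close> grows from \<open>x2 / height\<close> on the vertical axis to \<open>1\<close>,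
  so the inner integral is \<open>1 - x2 / height\<close>.\<close>

lemma nn_integral_mgauge1: "(\<integral>\<^sup>+x. ennreal (mgauge1 x) * indicator mdomain x \<partial>lborel) = ennreal (height / 2)"
proof -
  have m: "(\<lambda>x. ennreal (mgauge1 x) * indicator mdomain x) \<in> borel_measurable (lborel \<Otimes>\<^sub>M lborel)"
    unfolding lborel_prod using measurable_mgauge mdomain_borel by measurable
  have "(\<integral>\<^sup>+x. ennreal (mgauge1 x) * indicator mdomain x \<partial>lborel)
      = (\<integral>\<^sup>+x. ennreal (mgauge1 x) * indicator mdomain x \<partial>(lborel \<Otimes>\<^sub>M lborel))" by (simp add: lborel_prod)
  also have "\<dots> = (\<integral>\<^sup>+x2. \<integral>\<^sup>+x1. ennreal (mgauge1 (x1, x2)) * indicator mdomain (x1, x2) \<partial>lborel \<partial>lborel)"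
    using lborel_pair.nn_integral_snd[OF m] by simp
  also have "\<dots> = (\<integral>\<^sup>+x2. ennreal (1 - x2 / height) * indicator {0<..} x2 \<partial>lborel)"
  proof (rule nn_integral_cong)
    fix x2 :: real
    show "(\<integral>\<^sup>+x1. ennreal (mgauge1 (x1, x2)) * indicator mdomain (x1, x2) \<partial>lborel) = ennreal (1 - x2 / height) * indicator {0<..} x2"
    proof (cases "x2 > 0")
      case True
      obtain t where t: "t > 0" "mgauge (t, x2) > 1" using mgauge_unbounded(1) by blast
      have "(\<integral>\<^sup>+x1. ennreal (mgauge1 (x1, x2)) * indicator mdomain (x1, x2) \<partial>lborel)
          = (\<integral>\<^sup>+x1. ennreal (mgauge1 (x1, x2)) * indicator {x1. x1 > 0 \<and> mgauge (x1, x2) \<le> 1} x1 \<partial>lborel)"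
        using True by (intro nn_integral_cong) (simp add: mdomain_def indicator_def)
      also have "\<dots> = ennreal (1 - mgauge (0, x2))"
        by (rule nn_integral_derivative_sublevel[where X = t])
           (use True t mgauge_derivative(1) mgauge_pos(1) in
             \<open>auto intro!: continuous_on_compose2[OF continuous_on_mgauge[of UNIV]] continuous_intros\<close>)
      finally show ?thesis using True mgauge_axes(2)[of x2] by simp
    qed (simp add: mdomain_def)
  qed
  also have "\<dots> = ennreal (height / 2)" by (rule nn_integral_triangle[OF axes_pos(4)])
  finally show ?thesis .
qed

lemma nn_integral_mgauge2: "(\<integral>\<^sup>+x. ennreal (mgauge2 x) * indicator mdomain x \<partial>lborel) = ennreal (width / 2)"
proof -
  have m: "(\<lambda>x. ennreal (mgauge2 x) * indicator mdomain x) \<in> borel_measurable (lborel \<Otimes>\<^sub>M lborel)"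
    unfolding lborel_prod using measurable_mgauge mdomain_borel by measurable
  have "(\<integral>\<^sup>+x. ennreal (mgauge2 x) * indicator mdomain x \<partial>lborel)
      = (\<integral>\<^sup>+x. ennreal (mgauge2 x) * indicator mdomain x \<partial>(lborel \<Otimes>\<^sub>M lborel))" by (simp add: lborel_prod)
  also have "\<dots> = (\<integral>\<^sup>+x1. \<integral>\<^sup>+x2. ennreal (mgauge2 (x1, x2)) * indicator mdomain (x1, x2) \<partial>lborel \<partial>lborel)"
    using lborel.nn_integral_fst[OF m] by simp
  also have "\<dots> = (\<integral>\<^sup>+x1. ennreal (1 - x1 / width) * indicator {0<..} x1 \<partial>lborel)"
  proof (rule nn_integral_cong)
    fix x1 :: real
    show "(\<integral>\<^sup>+x2. ennreal (mgauge2 (x1, x2)) * indicator mdomain (x1, x2) \<partial>lborel) = ennreal (1 - x1 / width) * indicator {0<..} x1"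
    proof (cases "x1 > 0")
      case True
      obtain t where t: "t > 0" "mgauge (x1, t) > 1" using mgauge_unbounded(2) by blast
      have "(\<integral>\<^sup>+x2. ennreal (mgauge2 (x1, x2)) * indicator mdomain (x1, x2) \<partial>lborel)
          = (\<integral>\<^sup>+x2. ennreal (mgauge2 (x1, x2)) * indicator {x2. x2 > 0 \<and> mgauge (x1, x2) \<le> 1} x2 \<partial>lborel)"
        using True by (intro nn_integral_cong) (simp add: mdomain_def indicator_def)
      also have "\<dots> = ennreal (1 - mgauge (x1, 0))"
        by (rule nn_integral_derivative_sublevel[where X = t])
           (use True t mgauge_derivative(2) mgauge_pos(2) in
             \<open>auto intro!: continuous_on_compose2[OF continuous_on_mgauge[of UNIV]] continuous_intros\<close>)
      finally show ?thesis using True mgauge_axes(1)[of x1] by simp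
    qed (simp add: mdomain_def)
  qed
  also have "\<dots> = ennreal (width / 2)" by (rule nn_integral_triangle[OF axes_pos(3)])
  finally show ?thesis .
qed

text \<open>The cone measure turns the integral over \<open>Y\<close> into twice an integral over the solid domain, and the
  moment map turns that into the two integrals above.\<close>

theorem ruelle_invariant_eq: "ruelle_invariant Y liouville_form = width + height"
proof -
  have double: "2 * ennreal (x / 2) = ennreal x" if "x \<ge> 0" for x
  proof -
    have "2 * ennreal (x / 2) = ennreal 2 * ennreal (x / 2)" by simp
    also have "\<dots> = ennreal (2 * (x / 2))" using that by (intro ennreal_mult[symmetric]) auto
    finally show ?thesis by simp
  qed
  define q where "q y = (\<nu>1 y + \<nu>2 y) / pi" for y
  have qm: "q \<in> borel_measurable borel" unfolding q_def[abs_def] by measurable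
  then have qr: "q \<in> borel_measurable (restrict_space borel Y)" by (rule measurable_restrict_space1)
  have qc: "q \<in> borel_measurable cone_measure"
    using qr measurable_cong_sets[OF sets_cone_measure refl] by blast
  have sp: "space cone_measure = Y" by (simp add: cone_measure_def space_restrict_space)
  have "AE y in cone_measure. rotation_number Y liouville_form y = q y"
    using AE_cone_generic AE_space
    by eventually_elim (simp add: sp rotation_number_generic q_def)
  then have "ruelle_invariant Y liouville_form = (\<integral>y. q y \<partial>cone_measure)"
    unfolding ruelle_invariant_def contact_measure_eq_cone_measure
    by (rule integral_completion_cong_AE[OF qc])
  also have "\<dots> = enn2real (\<integral>\<^sup>+y. ennreal (q y) \<partial>cone_measure)"
  proof (rule integral_eq_nn_integral[OF qc])
    show "AE y in cone_measure. 0 \<le> q y"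
      using AE_cone_generic
    proof eventually_elim
      case (elim y)
      then have "\<nu>1 y + \<nu>2 y > 0" using \<nu>_pos by (intro add_pos_pos) blast+
      then show ?case by (simp add: q_def)
    qed
  qed
  also have "(\<integral>\<^sup>+y. ennreal (q y) \<partial>cone_measure) = 2 * (\<integral>\<^sup>+z\<in>punctured_domain. ennreal (q (proj z)) \<partial>lborel)"
    using qr by (intro nn_integral_cone) measurable
  also have "(\<integral>\<^sup>+z\<in>punctured_domain. ennreal (q (proj z)) \<partial>lborel)
      = (\<integral>\<^sup>+z. (\<lambda>x. ennreal (mgauge1 x) * indicator mdomain x + ennreal (mgauge2 x) * indicator mdomain x) (moment z) \<partial>lborel)"
  proof (rule nn_integral_cong_AE)
    show "AE z in lborel. ennreal (q (proj z)) * indicator punctured_domain z =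
        ennreal (mgauge1 (moment z)) * indicator mdomain (moment z) + ennreal (mgauge2 (moment z)) * indicator mdomain (moment z)"
      using AE_generic
    proof eventually_elim
      case (elim z)
      have z: "z \<noteq> 0" using elim by (rule generic_nonzero)
      have m: "fst (moment z) > 0" "snd (moment z) > 0" using elim moment_generic by blast+
      have "(G z)\<^sup>2 \<le> 1 \<longleftrightarrow> G z \<le> 1" using G_nonneg[of z] by (simp add: power_le_one_iff)
      then have i: "(indicator punctured_domain z :: ennreal) = indicator mdomain (moment z)"
        using z m by (simp add: punctured_domain_def mdomain_def mgauge_moment indicator_def)
      show ?case
        unfolding i q_def rotation_density_proj[OF z]
        using mgauge_pos(1)[OF m] mgauge_pos(2)[OF m] by (simp add: ennreal_plus distrib_right)
    qed
  qed
  also have "\<dots> = (\<integral>\<^sup>+x. (ennreal (mgauge1 x) * indicator mdomain x + ennreal (mgauge2 x) * indicator mdomain x)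
      * indicator ({0..} \<times> {0..}) x \<partial>lborel)"
    by (rule nn_integral_moment) measurable
  also have "\<dots> = (\<integral>\<^sup>+x. ennreal (mgauge1 x) * indicator mdomain x + ennreal (mgauge2 x) * indicator mdomain x \<partial>lborel)"
    by (rule nn_integral_cong) (auto simp: mdomain_def indicator_def)
  also have "\<dots> = ennreal (height / 2) + ennreal (width / 2)"
    by (subst nn_integral_add) (simp_all add: nn_integral_mgauge1 nn_integral_mgauge2)
  also have "\<dots> = ennreal ((width + height) / 2)"
    using axes_pos(3,4) by (subst ennreal_plus[symmetric]) (auto simp: add_divide_distrib add.commute)
  also have "2 * ennreal ((width + height) / 2) = ennreal (width + height)"
    using axes_pos(3,4) by (intro double) auto
  finally show ?thesis using axes_pos(3,4) by simp
qed

end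

section \<open>Toric domains with a boundary curve of negative slope\<close>

lemma toric_domain_eq: "toric_domain \<Omega> = moment -` \<Omega>"
  by (auto simp: toric_domain_def moment_def)

lemma continuous_on_moment: "continuous_on S moment"
  unfolding moment_def by (intro continuous_intros)

lemma moment_rotate: "moment (torus_rotate a b z) = moment z"
  by (simp add: moment_def norm_mult)

text \<open>The gauge inherits the torus symmetry because the domain determines it.\<close>

lemma toric_gauge_from_domain:
  assumes "star_gauge G N" and dom: "toric_domain \<Omega> = {z. G z \<le> 1}"
  shows "toric_gauge G N"
proof -
  interpret star_gauge_c2 G N using assms(1) by (simp add: star_gauge_c2_def)
  have le: "G (torus_rotate a b z) \<le> G z" for a b z
  proof (cases "z = 0")
    case False
    have "proj z \<in> toric_domain \<Omega>" using proj_in_Y[OF False] dom by simp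
    then have "torus_rotate a b (proj z) \<in> toric_domain \<Omega>" by (simp add: toric_domain_eq moment_rotate)
    then have "G ((1 / G z) *\<^sub>R torus_rotate a b z) \<le> 1" using dom by (simp add: rotate_scaleR)
    then show ?thesis using homog[of "1 / G z" "torus_rotate a b z"] pos[OF False] by (simp add: field_simps)
  next
    case True
    then show ?thesis by (simp add: rotate_zero)
  qed
  have "G (torus_rotate a b z) = G z" for a b z
    using le[of a b z] le[of "-a" "-b" "torus_rotate a b z"] by simp
  then show ?thesis by unfold_locales
qed

text \<open>In moment coordinates the boundary curve has tangent direction \<open>(- \<nu>2, \<nu>1)\<close>, up to a positive factor.
  A slope \<open>m\<close> therefore means \<open>\<nu>1 = - m \<nu>2\<close>. If \<open>m < 0\<close>, then \<open>\<nu>1\<close> and \<open>\<nu>2\<close> have the same sign, and it is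
  positive because \<open>\<nu>1 |p\<^sub>1|\<^sup>2 + \<nu>2 |p\<^sub>2|\<^sup>2 = 1\<close>.\<close>

lemma (in toric_gauge) negative_slope_imp_positive:
  assumes dom: "toric_domain \<Omega> = {z. G z \<le> 1}" and fr: "frontier (toric_domain \<Omega>) = Y"
    and slope: "\<forall>p\<in>boundary_plus \<Omega>. \<exists>m<0. has_slope (boundary_plus \<Omega>) p m" and gen: "generic z"
  shows "\<nu>1 z > 0 \<and> \<nu>2 z > 0"
proof -
  have z0: "z \<noteq> 0" using gen by (rule generic_nonzero)
  define p where "p = proj z"
  have pY: "p \<in> Y" using proj_in_Y[OF z0] by (simp add: p_def)
  have pg: "generic p" using gen pos[OF z0] by (simp add: p_def generic_def)
  have bd: "moment y \<in> boundary_plus \<Omega>" if y: "y \<in> Y" "generic y" for y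
  proof -
    have "y \<in> toric_domain \<Omega>" using y(1) dom by simp
    then have "moment y \<in> closure \<Omega>" using closure_subset by (auto simp: toric_domain_eq)
    moreover have "moment y \<notin> interior \<Omega>"
    proof
      assume i: "moment y \<in> interior \<Omega>"
      have "open (moment -` interior \<Omega>)"
        by (rule open_vimage[OF open_interior continuous_on_moment])
      moreover have "moment -` interior \<Omega> \<subseteq> toric_domain \<Omega>"
        unfolding toric_domain_eq by (rule vimage_mono[OF interior_subset])
      ultimately have "moment -` interior \<Omega> \<subseteq> interior (toric_domain \<Omega>)" by (rule interior_maximal[rotated])
      then have "y \<in> interior (toric_domain \<Omega>)" using i by auto
      moreover have "y \<in> frontier (toric_domain \<Omega>)" using y(1) fr by simp
      ultimately show False by (simp add: frontier_def)
    qed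
    ultimately have "moment y \<in> {q \<in> frontier \<Omega>. fst q > 0 \<and> snd q > 0}"
      using y(2) moment_generic[of y] by (simp add: frontier_def)
    then show ?thesis unfolding boundary_plus_def by (rule subsetD[OF closure_subset])
  qed
  obtain m where m: "m < 0" "has_slope (boundary_plus \<Omega>) (moment p) m" using slope bd[OF pY pg] by blast
  define A where "A = fst p \<bullet> fst p"
  define B where "B = snd p \<bullet> snd p"
  have AB: "A > 0" "B > 0" using pg by (simp_all add: A_def B_def generic_def)
  (* a radial vector in each coordinate, with weights that make it orthogonal to N p *)
  define v where "v = ((- (\<nu>2 p * B)) *\<^sub>R fst p, (\<nu>1 p * A) *\<^sub>R snd p)"
  have eul: "\<nu>1 p * A + \<nu>2 p * B = 1" using \<nu>_euler[OF pg] pY by (simp add: A_def B_def)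
  have "N p \<bullet> v = 0"
  proof -
    have "N p = (\<nu>1 p *\<^sub>R fst p, \<nu>2 p *\<^sub>R snd p)" using N_generic[OF pg] by (simp add: scaleR_conv_of_real)
    then show ?thesis by (simp add: v_def inner_prod_def A_def B_def)
  qed
  then have "v \<in> tangent_space Y p" using tangent_space_Y[OF pY] by simp
  then obtain c :: "real \<Rightarrow> c2" where c: "\<And>t. c t \<in> Y" "c 0 = p" "(c has_vector_derivative v) (at 0)"
    unfolding tangent_space_def by blast
  define u where "u t = pi * (fst (c t) \<bullet> fst (c t))" for t
  define w where "w t = pi * (snd (c t) \<bullet> snd (c t))" for t
  have mom: "moment (c t) = (u t, w t)" for t
    by (simp add: moment_def u_def w_def dot_square_norm)
  define \<kappa> where "\<kappa> = 2 * pi * A * B"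
  have \<kappa>: "\<kappa> > 0" using AB by (simp add: \<kappa>_def)
  have dc: "(c has_derivative (\<lambda>h. h *\<^sub>R v)) (at 0)" using c(3) by (simp add: has_vector_derivative_def)
  have du: "(u has_real_derivative (- \<kappa> * \<nu>2 p)) (at 0)"
  proof -
    have "(u has_derivative (\<lambda>h. pi * (fst (c 0) \<bullet> fst (h *\<^sub>R v) + fst (h *\<^sub>R v) \<bullet> fst (c 0)))) (at 0)"
      unfolding u_def[abs_def] by (intro has_derivative_mult_right has_derivative_inner has_derivative_fst dc)
    then show ?thesis
      by (rule has_derivative_imp_has_field_derivative) (simp add: v_def c(2) A_def[symmetric] \<kappa>_def)
  qed
  have dw: "(w has_real_derivative (\<kappa> * \<nu>1 p)) (at 0)"
  proof -
    have "(w has_derivative (\<lambda>h. pi * (snd (c 0) \<bullet> snd (h *\<^sub>R v) + snd (h *\<^sub>R v) \<bullet> snd (c 0)))) (at 0)"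
      unfolding w_def[abs_def] by (intro has_derivative_mult_right has_derivative_inner has_derivative_snd dc)
    then show ?thesis
      by (rule has_derivative_imp_has_field_derivative) (simp add: v_def c(2) B_def[symmetric] \<kappa>_def)
  qed
  have lu: "((\<lambda>t. (u t - u 0) / t) \<longlongrightarrow> - \<kappa> * \<nu>2 p) (at 0)"
    using du by (simp add: has_field_derivative_iff)
  have lw: "((\<lambda>t. (w t - w 0) / t) \<longlongrightarrow> \<kappa> * \<nu>1 p) (at 0)"
    using dw by (simp add: has_field_derivative_iff)
  have ne: "\<forall>\<^sub>F t in at 0. (u t, w t) \<noteq> (u 0, w 0)"
  proof (cases "\<nu>2 p = 0")
    case True
    then have "\<kappa> * \<nu>1 p \<noteq> 0" using eul \<kappa> by auto
    from tendsto_imp_eventually_ne[OF lw this] show ?thesis by eventually_elim auto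
  next
    case False
    then have "- \<kappa> * \<nu>2 p \<noteq> 0" using \<kappa> by auto
    from tendsto_imp_eventually_ne[OF lu this] show ?thesis by eventually_elim auto
  qed
  have cc: "(c \<longlongrightarrow> p) (at 0)"
    using has_derivative_continuous[OF dc] c(2) by (simp add: continuous_within)
  have "\<forall>\<^sub>F t in at 0. generic (c t)" using topological_tendstoD[OF cc open_generic] pg by simp
  then have inC: "\<forall>\<^sub>F t in at 0. (u t, w t) \<in> boundary_plus \<Omega>"
    by eventually_elim (metis bd c(1) mom)
  have P: "moment p = (u 0, w 0)" using mom[of 0] c(2) by simp
  have "((\<lambda>t. (u t, w t)) \<longlongrightarrow> (u 0, w 0)) (at 0)"
  proof -
    have "isCont moment p"
      using continuous_on_moment[of UNIV] continuous_on_eq_continuous_at[OF open_UNIV] by blast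
    from isCont_tendsto_compose[OF this cc] show ?thesis by (simp add: mom P)
  qed
  then have "filterlim (\<lambda>t. (u t, w t)) (at (u 0, w 0) within boundary_plus \<Omega>) (at 0)"
    unfolding filterlim_at using ne inC by (auto elim: eventually_elim2)
  from filterlim_compose[OF m(2)[unfolded has_slope_def P] this]
  have sl: "((\<lambda>t. (w t - w 0) / (u t - u 0)) \<longlongrightarrow> m) (at 0)" by simp
  have "((\<lambda>t. (w t - w 0) / (u t - u 0) * ((u t - u 0) / t)) \<longlongrightarrow> m * (- \<kappa> * \<nu>2 p)) (at 0)"
    by (rule tendsto_mult[OF sl lu])
  moreover have "\<forall>\<^sub>F t in at 0. (w t - w 0) / (u t - u 0) * ((u t - u 0) / t) = (w t - w 0) / t"
    (* where u t = u 0 the secant slope is 0 by convention, which cannot happen close to the limit m < 0 *)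
    using tendsto_imp_eventually_ne[OF sl less_imp_neq[OF m(1)]] by eventually_elim auto
  ultimately have "((\<lambda>t. (w t - w 0) / t) \<longlongrightarrow> m * (- \<kappa> * \<nu>2 p)) (at 0)"
    by (rule Lim_transform_eventually)
  from tendsto_unique[OF at_neq_bot lw this] have "\<kappa> * \<nu>1 p = m * (- \<kappa> * \<nu>2 p)" .
  then have "\<kappa> * \<nu>1 p = \<kappa> * ((- m) * \<nu>2 p)" by (simp add: algebra_simps)
  then have n1: "\<nu>1 p = (- m) * \<nu>2 p" using \<kappa> by (metis less_irrefl mult_left_cancel)
  then have e2: "\<nu>2 p * ((- m) * A + B) = 1" using eul by (simp add: algebra_simps)
  have "(- m) * A + B > 0" using m(1) AB by (intro add_pos_pos mult_pos_pos) auto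
  then have "\<nu>2 p > 0" using e2 by (metis zero_less_mult_pos2 zero_less_one)
  moreover have "\<nu>1 p > 0" unfolding n1 using m(1) calculation by (intro mult_pos_pos) auto
  ultimately show ?thesis using \<nu>_proj[OF z0] pos[OF z0] by (simp add: p_def zero_less_mult_iff)
qed

lemma (in toric_gauge) axis_lengths:
  assumes dom: "toric_domain \<Omega> = {z. G z \<le> 1}" and quadrant: "\<Omega> \<subseteq> {0..} \<times> {0..}"
  shows "a_of \<Omega> = width" "b_of \<Omega> = height"
proof -
  have mem: "moment z \<in> \<Omega> \<longleftrightarrow> G z \<le> 1" for z using dom by (auto simp: toric_domain_eq)
  have aux: "sqrt (x / pi) * r \<le> 1 \<longleftrightarrow> x \<le> pi / r\<^sup>2" if "x \<ge> 0" "r > 0" for x r :: real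
  proof -
    have "sqrt (x / pi) * r \<le> 1 \<longleftrightarrow> (sqrt (x / pi) * r)\<^sup>2 \<le> 1"
      using that by (simp add: power_le_one_iff)
    also have "\<dots> \<longleftrightarrow> x \<le> pi / r\<^sup>2" using that by (simp add: power_mult_distrib field_simps)
    finally show ?thesis .
  qed
  have "{x. (x, 0) \<in> \<Omega>} = {0..width}"
  proof -
    have "(x, 0) \<in> \<Omega> \<longleftrightarrow> x \<le> width" if x: "x \<ge> 0" for x
    proof -
      have "moment (of_real (sqrt (x / pi)), 0) = (x, 0)" using x by (simp add: moment_def)
      then show ?thesis using mem[of "(of_real (sqrt (x / pi)), 0)"] aux[OF x axes_pos(1)] x
        by (simp add: G_axes)
    qed
    moreover have "x \<ge> 0" if "(x, 0) \<in> \<Omega>" for x using that quadrant by auto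
    ultimately show ?thesis by (auto simp: set_eq_iff)
  qed
  then show "a_of \<Omega> = width" using axes_pos(3) by (simp add: a_of_def)
  have "{x. (0, x) \<in> \<Omega>} = {0..height}"
  proof -
    have "(0, x) \<in> \<Omega> \<longleftrightarrow> x \<le> height" if x: "x \<ge> 0" for x
    proof -
      have "moment (0, of_real (sqrt (x / pi))) = (0, x)" using x by (simp add: moment_def)
      then show ?thesis using mem[of "(0, of_real (sqrt (x / pi)))"] aux[OF x axes_pos(2)] x
        by (simp add: G_axes)
    qed
    moreover have "x \<ge> 0" if "(0, x) \<in> \<Omega>" for x using that quadrant by auto
    ultimately show ?thesis by (auto simp: set_eq_iff)
  qed
  then show "b_of \<Omega> = height" using axes_pos(4) by (simp add: b_of_def)
qed

theorem proposition1p11: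
  fixes \<Omega> :: "(real \<times> real) set"
  assumes "nice_toric \<Omega>"
    and "\<forall>p\<in>boundary_plus \<Omega>. \<exists>m<0. has_slope (boundary_plus \<Omega>) p m"
  shows "Ru (toric_domain \<Omega>) = a_of \<Omega> + b_of \<Omega>"
proof -
  let ?X = "toric_domain \<Omega>"
  have q: "\<Omega> \<subseteq> {0..} \<times> {0..}" and nice: "nice_star_shaped ?X"
    using assms(1) by (simp_all add: nice_toric_def)
  obtain G N where G: "star_gauge G N" "?X = {z. G z \<le> 1}" "frontier ?X = {z. G z = 1}"
    using star_shaped_gauge[of ?X] nice unfolding nice_star_shaped_def by blast
  interpret toric_gauge G N using toric_gauge_from_domain[OF G(1,2)] .
  interpret positive_toric_gauge G N
    by unfold_locales (use negative_slope_imp_positive[OF G(2,3) assms(2)] in blast)+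
  show ?thesis
    unfolding Ru_def G(3) ruelle_invariant_eq axis_lengths[OF G(2) q] ..
qed

end
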